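(* Let $d=2$, let $\nu_1$ be the uniform probability measure on the unit circle $S^1$, and let $\Lambda(A)=\int_{S^1}\int_{\mathbb R}\mathbf 1\{H(u,r)\in A\}\,dr\,\nu_1(du)$ for measurable sets $A$ of lines. Let $W\subset\mathbb R^2$ be compact and convex with interior points, and put $W_R=RW$. Then, as $R\to\infty$, $$\frac{1}{R\sqrt{\log R}}\Big[\mathrm{Vol}_1(Y(1,W_R))-\mathbb E\,\mathrm{Vol}_1(Y(1,W_R))\Big]\Longrightarrow \mathcal N\big(0,\pi\,\mathrm{Vol}_2(W)\big),$$ where $\Longrightarrow$ denotes convergence in law and $\mathcal N(0,\sigma^2)$ is the centred normal law with variance $\sigma^2$.
   Context: Notation: for $u\in S^{1}$ and $r\in\mathbb R$, $H(u,r)=\{x\in\mathbb R^2:\langle x,u\rangle=r\}$; $\mathcal H$ is the space of lines in $\mathbb R^2$. The measure $\Lambda$ is the isometry-invariant line measure normalized to unit length density, i.e. $\int\mathrm{Vol}_1(H\cap B)\,\Lambda(dH)=\mathrm{Vol}_2(B)$ for Borel sets $B$. For a compact convex set $c$, $[c]=\{H\in\mathcal H: H\cap c\neq\emptyset\}$. STIT tessellation via the MNW-construction: for compact convex $W$ with interior points and $t>0$, $Y(t,W)=Y(t\Lambda,W)$ is the state at time $t$ of the following continuous-time random cell-splitting process. At time $0$ there is the single cell $W$. Each existing cell $c$, independently of all other cells, lives for an exponentially distributed time with parameter $\Lambda([c])$; at the end of its lifetime it is split into the two cells $c\cap H^+$ and $c\cap H^-$ (the intersections of $c$ with the two closed half-planes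 bounded by $H$), where $H$ is a random line with law $\Lambda(\cdot\cap[c])/\Lambda([c])$ independent of everything else; the two new cells then evolve in the same way. Each split creates a segment $c\cap H$; $\mathrm{Vol}_1(Y(t,W))$ denotes the total length of all segments created during $[0,t]$ (equivalently, the total length of the cell boundaries of $Y(t,W)$ in the interior of $W$). *)

theory Defs
  imports "HOL-Probability.Probability"
begin

definition dirv :: "real \<Rightarrow> real^2" where
  "dirv \<theta> = (\<chi> i. if i = 1 then cos \<theta> else sin \<theta>)"

definition Hline :: "real^2 \<Rightarrow> real \<Rightarrow> (real^2) set" where
  "Hline u r = {x. x \<bullet> u = r}"

definition unif_angle :: "real measure" where
  "unif_angle = uniform_measure lborel {0..<2*pi}"

definition nu1 :: "(real^2) measure" where
  "nu1 = distr unif_angle borel dirv"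

definition Lambda :: "(real^2) set set \<Rightarrow> ennreal" where
  "Lambda A = emeasure (nu1 \<Otimes>\<^sub>M lborel) {(u, r). Hline u r \<in> A}"

definition hitting :: "(real^2) set \<Rightarrow> (real^2) set set" where
  "hitting c = {H. \<exists>u r. H = Hline u r \<and> H \<inter> c \<noteq> {}}"

definition Lambda_hit :: "(real^2) set \<Rightarrow> real" where
  "Lambda_hit c = enn2real (Lambda (hitting c))"

text \<open>Length Vol_1 of the chord H(u,r) \<inter> c for a unit vector u, via arc-length
  parametrisation t \<mapsto> r u + t u^perp of the line.\<close>
definition perp :: "real^2 \<Rightarrow> real^2" where
  "perp u = (\<chi> i. if i = 1 then - (u $ 2) else u $ 1)"

definition chord_len :: "real^2 \<Rightarrow> real \<Rightarrow> (real^2) set \<Rightarrow> real" where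
  "chord_len u r c = measure lborel {t::real. r *\<^sub>R u + t *\<^sub>R perp u \<in> c}"

section \<open>MNW construction of the STIT tessellation on an explicit probability space\<close>

text \<open>Randomness attached to each node of the (infinite binary) splitting tree:
  an Exp(1) variable (rescaled to the lifetime Exp(Lambda([c]))) and an iid sequence
  of uniform (angle, offset) pairs used to sample the splitting line from
  Lambda(. \<inter> [c]) / Lambda([c]) by rejection.\<close>
type_synonym node_rand = "real \<times> (nat \<Rightarrow> real \<times> real)"

definition node_measure :: "node_rand measure" where
  "node_measure = density lborel (exponential_density 1) \<Otimes>\<^sub>M
      (\<Pi>\<^sub>M k\<in>(UNIV::nat set). unif_angle \<Otimes>\<^sub>M uniform_measure lborel {-1..1::real})"

text \<open>Nodes are addressed by bool lists (the head is the most recent branching).\<close>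
definition Omega :: "(bool list \<Rightarrow> node_rand) measure" where
  "Omega = (\<Pi>\<^sub>M v\<in>(UNIV::bool list set). node_measure)"

text \<open>Radius rho with W inside the ball of radius rho: lines hitting a cell c \<subseteq> W
  have offset |r| \<le> rho.\<close>
definition bound_radius :: "(real^2) set \<Rightarrow> real" where
  "bound_radius W = Sup (norm ` W) + 1"

definition split_line :: "real \<Rightarrow> (real^2) set \<Rightarrow> (nat \<Rightarrow> real \<times> real) \<Rightarrow> (real^2) \<times> real" where
  "split_line \<rho> c seq =
     (if \<exists>k. Hline (dirv (fst (seq k))) (\<rho> * snd (seq k)) \<inter> c \<noteq> {}
      then (let k = (LEAST k. Hline (dirv (fst (seq k))) (\<rho> * snd (seq k)) \<inter> c \<noteq> {})
            in (dirv (fst (seq k)), \<rho> * snd (seq k)))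
      else (dirv 0, 0))"

text \<open>state w rho W v = (cell of node v, birth time of node v).\<close>
primrec node_state ::
  "(bool list \<Rightarrow> node_rand) \<Rightarrow> real \<Rightarrow> (real^2) set \<Rightarrow> bool list \<Rightarrow> (real^2) set \<times> real" where
  "node_state \<omega> \<rho> W [] = (W, 0)"
| "node_state \<omega> \<rho> W (b # v) =
     (let (c, s) = node_state \<omega> \<rho> W v;
          (u, r) = split_line \<rho> c (snd (\<omega> v));
          d = s + fst (\<omega> v) / Lambda_hit c
      in (if b then c \<inter> {x. r \<le> x \<bullet> u} else c \<inter> {x. x \<bullet> u \<le> r}, d))"

definition node_cell :: "(bool list \<Rightarrow> node_rand) \<Rightarrow> (real^2) set \<Rightarrow> bool list \<Rightarrow> (real^2) set" where
  "node_cell \<omega> W v = fst (node_state \<omega> (bound_radius W) W v)"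

definition node_death :: "(bool list \<Rightarrow> node_rand) \<Rightarrow> (real^2) set \<Rightarrow> bool list \<Rightarrow> real" where
  "node_death \<omega> W v = snd (node_state \<omega> (bound_radius W) W (True # v))"

definition node_seg_len :: "(bool list \<Rightarrow> node_rand) \<Rightarrow> (real^2) set \<Rightarrow> bool list \<Rightarrow> real" where
  "node_seg_len \<omega> W v =
     (let c = node_cell \<omega> W v; (u, r) = split_line (bound_radius W) c (snd (\<omega> v))
      in chord_len u r c)"

definition Vol1_Y :: "real \<Rightarrow> (real^2) set \<Rightarrow> (bool list \<Rightarrow> node_rand) \<Rightarrow> real" where
  "Vol1_Y t W \<omega> = infsum (\<lambda>v. if node_death \<omega> W v \<le> t then node_seg_len \<omega> W v else 0) UNIV"

definition converges_in_law :: "'i filter \<Rightarrow> ('i \<Rightarrow> real measure) \<Rightarrow> real measure \<Rightarrow> bool" where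
  "converges_in_law F \<mu> \<mu>0 \<longleftrightarrow>
     (\<forall>f :: real \<Rightarrow> real. continuous_on UNIV f \<and> bounded (range f) \<longrightarrow>
        ((\<lambda>i. \<integral>x. f x \<partial>(\<mu> i)) \<longlongrightarrow> (\<integral>x. f x \<partial>\<mu>0)) F)"

end

theory Submission
  imports Defs "HOL-Real_Asymp.Real_Asymp"
begin

text \<open>
  Let \<open>X\<close> be the length created inside a cell \<open>c\<close> up to time \<open>t\<close>. It has expectation \<open>t Vol\<^sub>2(c)\<close> and variance
  \<open>V(t, c) = \<integral> \<Lambda>(dH) \<integral> \<integral> F\<^sub>t(|x - y|) dx dy\<close>, where \<open>x\<close> and \<open>y\<close> range over the chord \<open>H \<inter> c\<close> and
  \<open>F\<^sub>t(h) = \<integral>\<^sub>0\<^sup>t exp (- (2/\<pi>) h s) ds\<close>: by Crofton's formula the exponential is the probability that two points at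
  distance \<open>h\<close> are not separated by a line before time \<open>s\<close>.
  Splitting \<open>c\<close> by a line \<open>H\<close> decreases \<open>V\<close> by at most a multiple of \<open>diam(W) Vol\<^sub>1(H \<inter> c)\<close>. Therefore
  \<open>exp (i \<theta> t Vol\<^sub>2(c) - \<theta>\<^sup>2 V(t, c) / 2)\<close> satisfies the first-split equation of the characteristic function of \<open>X\<close> up to
  an error which is only a multiple \<open>|\<theta>| diam(W)\<close> of the source term \<open>\<theta>\<^sup>2 \<integral> Vol\<^sub>1(H \<inter> c)\<^sup>2 \<Lambda>(dH)\<close> of the first-split equation
  of \<open>\<theta>\<^sup>2 V\<close>. Induction over the generations of the splitting tree yields
  \<open>|E exp (i \<theta> X) - exp (i \<theta> t Vol\<^sub>2(c) - \<theta>\<^sup>2 V(t, c) / 2)| \<le> const |\<theta>|\<^sup>3 diam(W) V(t, c)\<close>. For the window \<open>W\<^sub>R\<close> and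
  \<open>\<theta> = \<tau> / (R \<surd>log R)\<close> this bound vanishes as \<open>R\<close> grows, because \<open>V(1, W\<^sub>R) \<sim> \<pi> Vol\<^sub>2(W) R\<^sup>2 log R\<close>.
\<close>

text \<open>The logarithm comes from the tail of F_1: F_1(h) behaves like pi / (2 |h|), and for |h|
  much smaller than R two points at that distance fit into the window almost everywhere, so both
  signs of h together give pi log R times the area. The drop of V at a split contains no logarithm.
  The area of pairs at distance |h| separated by H is at most |h| times the chord, and |h| F_t(h) is
  at most pi / 2, so the factor |h| cancels. This is why the one-step error is a small multiple of
  the squared chord. Since V solves its own first-split equation with exactly that source, the error
  propagates to the same multiple of V, without loss over the generations. Cutting the tree after n
  generations makes all quantities bounded before any moment is known. A cell splits at rate at most
  2 rho and has two children, so the cut costs a multiple of (4 rho t)^n / n!, which vanishes for a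
  fixed window. Two formal obstacles shape the text: sets of points carry no convenient
  sigma-algebra, and a cell reduced to a point has rate 0, where the lifetime becomes a division by
  zero.\<close>

section \<open>Orthonormal frames and Lebesgue measure in the plane\<close>

lemma inner_vec2: "(x::real^2) \<bullet> y = x $ 1 * y $ 1 + x $ 2 * y $ 2"
  by (simp add: inner_vec_def sum_2)

lemma norm_vec2: "norm (x::real^2)^2 = (x $ 1)^2 + (x $ 2)^2"
  by (simp only: power2_norm_eq_inner inner_vec2) (simp add: power2_eq_square)

lemma perp_nth [simp]: "perp u $ 1 = - (u $ 2)" "perp u $ 2 = u $ 1"
  by (simp_all add: perp_def)

lemma dirv_nth [simp]: "dirv a $ 1 = cos a" "dirv a $ 2 = sin a"
  by (simp_all add: dirv_def)

lemma norm_dirv [simp]: "norm (dirv a) = 1"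
  using norm_vec2[of "dirv a"] power2_eq_imp_eq[of "norm (dirv a)" 1] by simp

lemma inner_perp_self [simp]: "u \<bullet> perp u = 0" "perp u \<bullet> u = 0"
  by (simp_all add: inner_vec2)

lemma norm_perp [simp]: "norm (perp u) = norm u"
proof -
  have "norm (perp u)^2 = norm u^2" by (simp add: norm_vec2)
  then show ?thesis by (rule power2_eq_imp_eq) auto
qed

lemma perp_expansion:
  assumes "norm u = 1"
  shows "(x \<bullet> u) *\<^sub>R u + (x \<bullet> perp u) *\<^sub>R perp u = x"
proof -
  have s: "(u$1)^2 + (u$2)^2 = 1" using norm_vec2[of u] assms by simp
  have "((x \<bullet> u) *\<^sub>R u + (x \<bullet> perp u) *\<^sub>R perp u) $ 1 = x $ 1 * ((u$1)^2 + (u$2)^2)"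
    by (simp add: inner_vec2 algebra_simps power2_eq_square)
  moreover have "((x \<bullet> u) *\<^sub>R u + (x \<bullet> perp u) *\<^sub>R perp u) $ 2 = x $ 2 * ((u$1)^2 + (u$2)^2)"
    by (simp add: inner_vec2 algebra_simps power2_eq_square)
  ultimately show ?thesis using s by (simp add: vec_eq_iff forall_2)
qed

lemma continuous_perp [continuous_intros]:
  "continuous_on S f \<Longrightarrow> continuous_on S (\<lambda>x. perp (f x))"
proof -
  have "continuous_on UNIV perp" unfolding perp_def
  proof (rule continuous_on_vec_lambda)
    fix i :: 2 show "continuous_on UNIV (\<lambda>x::real^2. if i = 1 then - (x $ 2) else x $ 1)"
      by (cases "i = 1") (auto intro!: continuous_intros)
  qed
  then show "continuous_on S f \<Longrightarrow> continuous_on S (\<lambda>x. perp (f x))"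
    by (rule continuous_on_compose2) auto
qed

lemma perp_measurable [measurable]: "perp \<in> borel_measurable borel"
  by (intro borel_measurable_continuous_onI continuous_intros)

lemma continuous_dirv [continuous_intros]: "continuous_on S dirv"
  unfolding dirv_def
proof (rule continuous_on_vec_lambda)
  fix i :: 2 show "continuous_on S (\<lambda>\<theta>. if i = 1 then cos \<theta> else sin \<theta>)"
    by (cases "i = 1") (auto intro!: continuous_intros)
qed

lemma dirv_measurable [measurable]: "dirv \<in> borel_measurable borel"
  by (intro borel_measurable_continuous_onI continuous_intros)

text \<open>Boxes in \<open>real^2\<close> pull back to boxes in the product with the same side
  lengths. This is the bridge by which Fubini on pairs becomes available for
  \<open>real^2\<close>.\<close>

lemma distr_lborel_vec2:
  "distr lborel borel (\<lambda>(a, b). (\<chi> i. if i = 1 then a else b) :: real^2) = lborel" (is "distr _ _ ?T = _")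
proof (rule lborel_eqI[symmetric])
  have [measurable]: "?T \<in> borel_measurable borel"
  proof (intro borel_measurable_continuous_onI)
    show "continuous_on UNIV ?T" unfolding split_def
    proof (rule continuous_on_vec_lambda)
      fix i :: 2 show "continuous_on UNIV (\<lambda>x::real\<times>real. if i = 1 then fst x else snd x)"
        by (cases "i = 1") (auto intro!: continuous_intros)
    qed
  qed
  fix l u :: "real^2" assume lu: "\<And>b. b \<in> Basis \<Longrightarrow> l \<bullet> b \<le> u \<bullet> b"
  have B: "(Basis :: (real^2) set) = {axis 1 1, axis 2 1}"
    by (auto simp: Basis_vec_def UNIV_2)
  have ne: "axis 1 (1::real) \<noteq> (axis 2 1 :: real^2)" by (simp add: axis_eq_axis)
  have "?T -` box l u = box (l$1, l$2) (u$1, u$2)"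
    by (auto simp: mem_box B inner_axis Basis_prod_def)
  then have "emeasure (distr lborel borel ?T) (box l u) = emeasure lborel (box (l$1, l$2) (u$1, u$2))"
    by (simp add: emeasure_distr)
  also have "\<dots> = ennreal (\<Prod>b\<in>Basis. ((u$1, u$2) - (l$1, l$2)) \<bullet> b)"
    using lu[of "axis 1 1"] lu[of "axis 2 1"]
    by (intro emeasure_lborel_box) (auto simp: Basis_prod_def B inner_axis)
  also have "(\<Prod>b\<in>Basis. ((u$1, u$2) - (l$1, l$2)) \<bullet> b) = (u$1 - l$1) * (u$2 - l$2)"
    by (simp add: Basis_prod_def)
  also have "\<dots> = (\<Prod>b\<in>Basis. (u - l) \<bullet> b)"
    using ne by (simp add: B inner_axis)
  finally show "emeasure (distr lborel borel ?T) (box l u) = (\<Prod>b\<in>Basis. (u - l) \<bullet> b)" .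
qed simp

text \<open>\<open>Q\<close> turns coordinates in the frame \<open>u\<close>, \<open>perp u\<close>
  into points. Its inverse \<open>P\<close> is linear and preserves norms, so the preimage of a box
  under \<open>Q\<close> is an orthogonal image of that box and keeps its measure.\<close>

lemma distr_lborel_rotation:
  fixes u :: "real^2"
  assumes "norm u = 1"
  shows "distr lborel borel (\<lambda>x::real^2. (x$1) *\<^sub>R u + (x$2) *\<^sub>R perp u) = lborel"
proof -
  define Q where "Q = (\<lambda>x::real^2. (x$1) *\<^sub>R u + (x$2) *\<^sub>R perp u)"
  define P where "P = (\<lambda>x::real^2. (\<chi> i. if i = 1 then x \<bullet> u else x \<bullet> perp u) :: real^2)"
  have P: "P x $ 1 = x \<bullet> u" "P x $ 2 = x \<bullet> perp u" for x by (simp_all add: P_def)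
  have [measurable]: "Q \<in> borel_measurable borel" unfolding Q_def
    by (intro borel_measurable_continuous_onI continuous_intros)
  have s: "(u$1)^2 + (u$2)^2 = 1" using norm_vec2[of u] assms by simp
  have QP: "Q (P x) = x" for x unfolding Q_def P by (rule perp_expansion[OF assms])
  have PQ: "P (Q x) = x" for x
  proof -
    have "P (Q x) $ 1 = x $ 1 * ((u$1)^2 + (u$2)^2)"
      unfolding P inner_vec2 by (simp add: Q_def algebra_simps power2_eq_square)
    moreover have "P (Q x) $ 2 = x $ 2 * ((u$1)^2 + (u$2)^2)"
      unfolding P inner_vec2 by (simp add: Q_def algebra_simps power2_eq_square)
    ultimately show ?thesis using s by (simp add: vec_eq_iff forall_2)
  qed
  have lin: "linear P"
    by (rule linearI) (simp_all add: P_def vec_eq_iff inner_add_left)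
  have "P x \<bullet> P x = x \<bullet> x" for x
  proof -
    have "P x \<bullet> P x = x \<bullet> Q (P x)"
      by (subst inner_vec2) (simp add: Q_def P inner_add_right)
    then show ?thesis by (simp only: QP)
  qed
  then have "norm (P x) = norm x" for x by (simp add: norm_eq_sqrt_inner)
  with lin have orth: "orthogonal_transformation P"
    by (simp add: orthogonal_transformation)
  have "distr lborel borel Q = lborel"
  proof (rule lborel_eqI[symmetric])
    fix l v :: "real^2" assume lu: "\<And>b. b \<in> Basis \<Longrightarrow> l \<bullet> b \<le> v \<bullet> b"
    have img: "Q -` box l v = P ` box l v"
    proof safe
      fix x assume "Q x \<in> box l v"
      then have "P (Q x) \<in> P ` box l v" by blast
      then show "x \<in> P ` box l v" by (simp only: PQ)
    qed (simp add: QP)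
    have meas: "Q -` box l v \<in> sets borel"
      using measurable_sets[of Q borel borel "box l v"] by simp
    have "emeasure (distr lborel borel Q) (box l v) = emeasure lborel (Q -` box l v)"
      by (simp add: emeasure_distr)
    also have "\<dots> = emeasure lebesgue (P ` box l v)"
      using meas by (simp add: img)
    also have "\<dots> = measure lebesgue (P ` box l v)"
      using measurable_orthogonal_image[OF orth lmeasurable_box, of l v]
      by (simp add: emeasure_eq_measure2 fmeasurableD2 )
    also have "\<dots> = measure lebesgue (box l v)"
      by (simp add: measure_orthogonal_image[OF orth lmeasurable_box])
    also have "\<dots> = emeasure lborel (box l v)"
      using fmeasurableD2[OF lmeasurable_box, of l v]
      by (simp add: emeasure_eq_ennreal_measure)
    also have "\<dots> = (\<Prod>b\<in>Basis. (v - l) \<bullet> b)" using lu by (rule emeasure_lborel_box)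
    finally show "emeasure (distr lborel borel Q) (box l v) = (\<Prod>b\<in>Basis. (v - l) \<bullet> b)" .
  qed simp
  then show ?thesis unfolding Q_def .
qed

text \<open>Fubini along the lines with normal \<open>u\<close>: \<open>a\<close> is the offset of
  the line and \<open>b\<close> the arc length on it, matching the parametrisation in
  \<open>chord_len\<close>.\<close>

lemma nn_integral_orthonormal_coordinates:
  fixes u :: "real^2" and g :: "real^2 \<Rightarrow> ennreal"
  assumes "norm u = 1" and [measurable]: "g \<in> borel_measurable borel"
  shows "(\<integral>\<^sup>+x. g x \<partial>lborel) = (\<integral>\<^sup>+a. \<integral>\<^sup>+b. g (a *\<^sub>R u + b *\<^sub>R perp u) \<partial>lborel \<partial>lborel)"
proof -
  let ?T = "\<lambda>(a, b). (\<chi> i. if i = 1 then a else b) :: real^2"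
  let ?Q = "\<lambda>x::real^2. (x$1) *\<^sub>R u + (x$2) *\<^sub>R perp u"
  have [measurable]: "?T \<in> borel_measurable borel"
  proof (intro borel_measurable_continuous_onI)
    show "continuous_on UNIV ?T" unfolding split_def
    proof (rule continuous_on_vec_lambda)
      fix i :: 2 show "continuous_on UNIV (\<lambda>x::real\<times>real. if i = 1 then fst x else snd x)"
        by (cases "i = 1") (auto intro!: continuous_intros)
    qed
  qed
  have [measurable]: "?Q \<in> borel_measurable borel"
    by (intro borel_measurable_continuous_onI continuous_intros)
  have "(\<integral>\<^sup>+x. g x \<partial>lborel) = (\<integral>\<^sup>+x. g x \<partial>distr (distr lborel borel ?T) borel ?Q)"
    by (simp add: distr_lborel_vec2 distr_lborel_rotation[OF assms(1)])
  also have "\<dots> = (\<integral>\<^sup>+x. g (?Q (?T x)) \<partial>lborel)"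
    by (simp add: nn_integral_distr)
  also have "\<dots> = (\<integral>\<^sup>+(a,b). g (a *\<^sub>R u + b *\<^sub>R perp u) \<partial>(lborel \<Otimes>\<^sub>M lborel))"
    by (simp add: lborel_prod split_def)
  also have "\<dots> = (\<integral>\<^sup>+a. \<integral>\<^sup>+b. g (a *\<^sub>R u + b *\<^sub>R perp u) \<partial>lborel \<partial>lborel)"
    by (subst lborel.nn_integral_fst[symmetric]) (auto simp: split_def)
  finally show ?thesis .
qed

subsection \<open>The direction distribution and Crofton's formula\<close>

lemma sets_unif_angle [simp, measurable_cong]: "sets unif_angle = sets borel"
  by (simp add: unif_angle_def)

lemma prob_space_unif_angle: "prob_space unif_angle"
  unfolding unif_angle_def by (rule prob_space_uniform_measure) auto

lemma sets_nu1 [simp, measurable_cong]: "sets nu1 = sets borel"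
  by (simp add: nu1_def)

lemma space_nu1 [simp]: "space nu1 = UNIV"
  by (simp add: nu1_def)

lemma prob_space_nu1: "prob_space nu1"
  unfolding nu1_def
  by (rule prob_space.prob_space_distr[OF prob_space_unif_angle]) simp

interpretation nu1: prob_space nu1 by (rule prob_space_nu1)

lemma AE_nu1_unit: "AE u in nu1. norm u = 1"
  unfolding nu1_def by (subst AE_distr_iff) auto

lemma integral_abs_cos: "((\<lambda>x. \<bar>cos x\<bar>) has_integral 4) {0..2*pi}"
proof -
  have 1: "((\<lambda>x. \<bar>cos x\<bar>) has_integral (sin (pi/2) - sin 0)) {0..pi/2}"
  proof (rule has_integral_eq[OF _ fundamental_theorem_of_calculus])
    show "cos x = \<bar>cos x\<bar>" if "x \<in> {0..pi/2}" for x
      using that cos_ge_zero[of x] by auto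
  qed (auto intro!: derivative_eq_intros simp: has_real_derivative_iff_has_vector_derivative[symmetric])
  have 2: "((\<lambda>x. \<bar>cos x\<bar>) has_integral ((- sin (3*pi/2)) - (- sin (pi/2)))) {pi/2..3*pi/2}"
  proof (rule has_integral_eq[OF _ fundamental_theorem_of_calculus])
    show "- cos x = \<bar>cos x\<bar>" if "x \<in> {pi/2..3*pi/2}" for x
      using that cos_ge_zero[of "x - pi"] by auto
  qed (auto intro!: derivative_eq_intros simp: has_real_derivative_iff_has_vector_derivative[symmetric])
  have 3: "((\<lambda>x. \<bar>cos x\<bar>) has_integral (sin (2*pi) - sin (3*pi/2))) {3*pi/2..2*pi}"
  proof (rule has_integral_eq[OF _ fundamental_theorem_of_calculus])
    show "cos x = \<bar>cos x\<bar>" if "x \<in> {3*pi/2..2*pi}" for x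
    proof -
      have "cos (x - 2*pi) = cos x" using cos_periodic[of "x - 2*pi"] by simp
      then show ?thesis using that cos_ge_zero[of "x - 2*pi"] by auto
    qed
  qed (auto intro!: derivative_eq_intros simp: has_real_derivative_iff_has_vector_derivative[symmetric])
  have s: "sin (3*pi/2) = -1" using sin_3over2_pi by (simp add: field_simps)
  have "((\<lambda>x. \<bar>cos x\<bar>) has_integral (3::real)) {0..3*pi/2}"
    using has_integral_combine[OF _ _ 1 2] s by simp
  from has_integral_combine[OF _ _ this 3] s show ?thesis by simp
qed

text \<open>Only the angle between \<open>u\<close> and \<open>z\<close> matters, and the mean of
  |cos| over a full turn is 4 / (2 pi). The resulting 2 / pi is the separation rate per unit
  distance that reappears in \<open>decay\<close>.\<close>

lemma crofton_nn:
  "(\<integral>\<^sup>+u. ennreal \<bar>z \<bullet> u\<bar> \<partial>nu1) = ennreal (2 / pi * norm z)"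
proof (cases "z = 0")
  case True then show ?thesis by simp
next
  case False
  define n where "n = norm z"
  have n: "n > 0" using False by (simp add: n_def)
  have "(z$1/n)^2 + (z$2/n)^2 = 1"
  proof -
    have "(z$1/n)^2 + (z$2/n)^2 = n^2 / n^2"
      using norm_vec2[of z] unfolding n_def[symmetric] by (simp only: power_divide add_divide_distrib)
    then show ?thesis using n by simp
  qed
  then obtain \<phi> where \<phi>: "0 \<le> \<phi>" "\<phi> < 2*pi" "z$1/n = cos \<phi>" "z$2/n = sin \<phi>"
    using sincos_total_2pi by metis
  have z: "z$1 = n * cos \<phi>" "z$2 = n * sin \<phi>" using \<phi> n by (auto simp: field_simps)
  let ?g = "\<lambda>x. ennreal \<bar>cos x\<bar>"
  let ?I = "\<lambda>a b. \<integral>\<^sup>+x. ?g x * indicator {a..<b} x \<partial>lborel"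
  have shift: "(\<integral>\<^sup>+x. f (x + c) \<partial>lborel) = (\<integral>\<^sup>+x. f x \<partial>lborel)"
    if [measurable]: "f \<in> borel_measurable borel" for f :: "real \<Rightarrow> ennreal" and c
    by (subst (2) lborel_distr_plus[symmetric, of c]) (simp add: nn_integral_distr add.commute)
  have "ennreal \<bar>z \<bullet> dirv \<theta>\<bar> = ennreal n * ?g (\<theta> - \<phi>)" for \<theta>
  proof -
    have "z \<bullet> dirv \<theta> = n * cos (\<theta> - \<phi>)"
      by (simp add: inner_vec2 z cos_diff algebra_simps)
    then show ?thesis using n by (simp add: abs_mult ennreal_mult'[symmetric])
  qed
  then have 1: "(\<integral>\<^sup>+u. ennreal \<bar>z \<bullet> u\<bar> \<partial>nu1) = (\<integral>\<^sup>+\<theta>. ennreal n * ?g (\<theta> - \<phi>) \<partial>unif_angle)"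
    unfolding nu1_def by (subst nn_integral_distr) auto
  have 2: "(\<integral>\<^sup>+\<theta>. ennreal n * ?g (\<theta> - \<phi>) \<partial>unif_angle) = ennreal n * (\<integral>\<^sup>+\<theta>. ?g (\<theta> - \<phi>) \<partial>unif_angle)"
    by (rule nn_integral_cmult) measurable
  have 3: "(\<integral>\<^sup>+\<theta>. ?g (\<theta> - \<phi>) \<partial>unif_angle) =
      (\<integral>\<^sup>+\<theta>. ?g (\<theta> - \<phi>) * indicator {0..<2*pi} \<theta> \<partial>lborel) / ennreal (2*pi)"
    unfolding unif_angle_def by (subst nn_integral_uniform_measure) auto
  \<comment> \<open>From here to step 9 periodicity is used: the part of the shifted period to the
    left of 0 is translated by 2 pi, which restores the interval from 0 to 2 pi.\<close>
  have 4: "(\<integral>\<^sup>+\<theta>. ?g (\<theta> - \<phi>) * indicator {0..<2*pi} \<theta> \<partial>lborel) = ?I (-\<phi>) (2*pi-\<phi>)"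
    by (subst shift[symmetric, of _ "-\<phi>"])
       (auto intro!: nn_integral_cong simp: indicator_def)
  have 5: "?I (-\<phi>) (2*pi-\<phi>) = (\<integral>\<^sup>+x. ?g x * indicator {-\<phi>..<0} x + ?g x * indicator {0..<2*pi-\<phi>} x \<partial>lborel)"
    using \<phi> by (intro nn_integral_cong) (auto simp: indicator_def)
  have 6: "\<dots> = ?I (-\<phi>) 0 + ?I 0 (2*pi-\<phi>)"
    by (rule nn_integral_add) auto
  have 7: "?I (-\<phi>) 0 = ?I (2*pi-\<phi>) (2*pi)"
    by (subst shift[symmetric, of "\<lambda>x. ?g x * indicator {2*pi-\<phi>..<2*pi} x" "2*pi"])
       (auto intro!: nn_integral_cong simp: indicator_def)
  have 8: "?I (2*pi-\<phi>) (2*pi) + ?I 0 (2*pi-\<phi>) =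
     (\<integral>\<^sup>+x. ?g x * indicator {2*pi-\<phi>..<2*pi} x + ?g x * indicator {0..<2*pi-\<phi>} x \<partial>lborel)"
    by (rule nn_integral_add[symmetric]) auto
  have 9: "\<dots> = ?I 0 (2*pi)"
    using \<phi> by (intro nn_integral_cong) (auto simp: indicator_def)
  have 10: "?I 0 (2*pi) = (\<integral>\<^sup>+x. ?g x * indicator {0..2*pi} x \<partial>lborel)"
    by (rule nn_integral_cong_AE, rule AE_mp[OF AE_lborel_singleton[of "2*pi"]]) (auto simp: indicator_def)
  have 11: "\<dots> = ennreal 4"
    by (subst nn_integral_has_integral_lebesgue[OF _ integral_abs_cos, symmetric])
       (auto intro!: nn_integral_cong simp: indicator_def)
  have 12: "ennreal 4 / ennreal (2*pi) = ennreal (4 / (2*pi))"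
    by (rule divide_ennreal) auto
  have 13: "ennreal n * ennreal (4 / (2*pi)) = ennreal (n * (4 / (2*pi)))"
    using n by (intro ennreal_mult[symmetric]) auto
  have "n * (4 / (2*pi)) = 2 / pi * norm z"
    by (simp add: n_def)
  then show ?thesis
    by (simp only: 1 2 3 4 5 6 7 8 9 10 11 12 13)
qed

subsection \<open>Cells as measurable functions of half-plane sequences\<close>

text \<open>A cell is represented by the sequence of half-planes \<open>{x. x \<bullet> u \<le> r}\<close> cutting it out of the window (padded by
  \<open>(0, 0)\<close>, which imposes no condition), so that measurability in the cell makes sense.\<close>

type_synonym hplane = "(real^2) \<times> real"

text \<open>Every half-plane is stored as an upper bound, so the side
  \<open>snd H \<le> x \<bullet> fst H\<close> is encoded by the negated pair.\<close>

definition child :: "bool \<Rightarrow> hplane \<Rightarrow> (nat \<Rightarrow> hplane) \<Rightarrow> nat \<Rightarrow> hplane" where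
  "child b H p = case_nat (if b then (- fst H, - snd H) else H) p"

text \<open>Bounding the offsets turns the line measure into a finite measure, so that bounded
  measurable functions of lines are integrable.\<close>

definition Ir :: "real \<Rightarrow> real measure" where
  "Ir a = density lborel (indicator {-a..a})"

text \<open>Strict inequalities make the segment cross the line transversally, which gives a
  well-defined crossing point. For given points, the lines through one of them form a null
  set.\<close>

definition separates :: "hplane \<Rightarrow> real^2 \<Rightarrow> real^2 \<Rightarrow> bool" where
  "separates H x y \<longleftrightarrow> x \<bullet> fst H < snd H \<and> snd H < y \<bullet> fst H \<or> y \<bullet> fst H < snd H \<and> snd H < x \<bullet> fst H"

lemma sets_Ir [simp, measurable_cong]: "sets (Ir a) = sets borel"
  by (simp add: Ir_def)

lemma space_Ir [simp]: "space (Ir a) = UNIV"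
  by (simp add: Ir_def)

lemma nn_integral_Ir:
  "f \<in> borel_measurable borel \<Longrightarrow> (\<integral>\<^sup>+x. f x \<partial>Ir a) = (\<integral>\<^sup>+x. indicator {-a..a} x * f x \<partial>lborel)"
  by (simp add: Ir_def nn_integral_density)

lemma finite_measure_Ir: "finite_measure (Ir a)"
proof
  have "emeasure (Ir a) (space (Ir a)) = (\<integral>\<^sup>+x. indicator {-a..a} x \<partial>lborel)"
    by (simp add: Ir_def emeasure_density)
  then show "emeasure (Ir a) (space (Ir a)) \<noteq> \<infinity>" by (simp add: emeasure_lborel_Icc_eq)
qed

interpretation Ir: finite_measure "Ir a" for a by (rule finite_measure_Ir)

lemma measurable_coordinate [measurable]: "(\<lambda>p::nat \<Rightarrow> hplane. p i) \<in> borel_measurable borel"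
  by (intro borel_measurable_continuous_onI continuous_on_product_coordinates)

lemma measurable_child [measurable]: "(\<lambda>(H, p). child b H p) \<in> borel_measurable (borel \<Otimes>\<^sub>M borel)"
proof (rule measurable_coordinatewise_then_product)
  fix i
  have "(\<lambda>x::hplane \<times> (nat \<Rightarrow> hplane). (- fst (fst x), - snd (fst x))) \<in> borel_measurable (borel \<Otimes>\<^sub>M borel)"
    unfolding borel_prod by (intro borel_measurable_continuous_onI continuous_intros)
  then show "(\<lambda>x. (case x of (H, p) \<Rightarrow> child b H p) i) \<in> borel_measurable (borel \<Otimes>\<^sub>M borel)"
    by (cases i; cases b) (auto simp: child_def split_def)
qed

lemma measurable_separates [measurable (raw)]:
  assumes [measurable]: "f \<in> borel_measurable M" "g \<in> borel_measurable M" "h \<in> borel_measurable M"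
  shows "Measurable.pred M (\<lambda>x. separates (f x) (g x) (h x))"
proof -
  have [measurable]: "(\<lambda>x. fst (f x)) \<in> borel_measurable M" "(\<lambda>x. snd (f x)) \<in> borel_measurable M"
    using assms(1) by (auto simp: borel_prod[symmetric])
  show ?thesis unfolding separates_def by measurable
qed

text \<open>Tube lemma: the projection along a compact factor is a closed map. It makes
  \<open>hit\<close> measurable, since hitting a cell is an existential statement over the compact
  window.\<close>

lemma closed_projection_compact:
  assumes "compact (S :: 'a::topological_space set)" "closed (T :: ('a \<times> 'b::topological_space) set)"
  shows "closed (snd ` ((S \<times> UNIV) \<inter> T))"
proof -
  have "closed_map (prod_topology (top_of_set S) (euclidean :: 'b topology)) euclidean snd"
    using assms(1) by (intro closed_map_snd) (simp add: compact_space_subtopology)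
  moreover have "prod_topology (top_of_set S) (euclidean :: 'b topology) = top_of_set (S \<times> UNIV)"
    using prod_topology_subtopology(1)[of euclidean S "euclidean :: 'b topology"] by simp
  moreover have "closedin (top_of_set (S \<times> UNIV)) ((S \<times> UNIV) \<inter> T)"
    using assms(2) by (auto simp: closedin_closed)
  ultimately show ?thesis unfolding closed_map_def by simp
qed

section \<open>Cells of a window and the measure of the lines hitting them\<close>

locale convex_window =
  fixes W :: "(real^2) set"
  assumes compact_W: "compact W" and convex_W: "convex W" and nonempty_W: "W \<noteq> {}"
begin

abbreviation "\<rho> \<equiv> bound_radius W"

lemma norm_le: "x \<in> W \<Longrightarrow> norm x \<le> \<rho>"
proof -
  assume x: "x \<in> W"
  have "bdd_above (norm ` W)"
    using compact_imp_bounded[OF compact_W] by (auto simp: bounded_iff bdd_above_def)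
  then have "norm x \<le> Sup (norm ` W)" using x by (intro cSup_upper) auto
  then show ?thesis by (simp add: bound_radius_def)
qed

lemma rho_ge_1: "1 \<le> \<rho>"
proof -
  obtain x where "x \<in> W" using nonempty_W by auto
  have "bdd_above (norm ` W)"
    using compact_imp_bounded[OF compact_W] by (auto simp: bounded_iff bdd_above_def)
  then have "norm x \<le> Sup (norm ` W)" using \<open>x \<in> W\<close> by (intro cSup_upper) auto
  then have "0 \<le> Sup (norm ` W)" using norm_ge_zero[of x] by linarith
  then show ?thesis by (simp add: bound_radius_def)
qed

lemma rho_pos: "0 < \<rho>"
  using rho_ge_1 by linarith

definition cell :: "(nat \<Rightarrow> hplane) \<Rightarrow> (real^2) set" where
  "cell p = {x \<in> W. \<forall>i. x \<bullet> fst (p i) \<le> snd (p i)}"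

definition hit :: "(nat \<Rightarrow> hplane) \<Rightarrow> hplane \<Rightarrow> bool" where
  "hit p H \<longleftrightarrow> (\<exists>x\<in>cell p. x \<bullet> fst H = snd H)"

text \<open>Finite substitute for the measure behind \<open>Lambda\<close>, with offsets cut off at
  \<open>\<rho>\<close>; \<open>emeasure_lines_hit\<close> shows that nothing is lost for
  cells.\<close>

definition lines :: "hplane measure" where
  "lines = nu1 \<Otimes>\<^sub>M Ir \<rho>"

definition Lam :: "(nat \<Rightarrow> hplane) \<Rightarrow> real" where
  "Lam p = measure lines {H. hit p H}"

definition ell :: "(nat \<Rightarrow> hplane) \<Rightarrow> hplane \<Rightarrow> real" where
  "ell p H = chord_len (fst H) (snd H) (cell p)"

definition area :: "(nat \<Rightarrow> hplane) \<Rightarrow> real" where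
  "area p = measure lborel (cell p)"

text \<open>Set covariogram of the cell in the direction \<open>perp u\<close>, which is the
  direction of the chords with normal \<open>u\<close>.\<close>

definition gcov :: "(nat \<Rightarrow> hplane) \<Rightarrow> real^2 \<Rightarrow> real \<Rightarrow> ennreal" where
  "gcov p u h = emeasure lborel {x. x \<in> cell p \<and> x + h *\<^sub>R perp u \<in> cell p}"

text \<open>Part of the covariogram that is lost when the cell is split by \<open>H\<close>.\<close>

definition gsep :: "(nat \<Rightarrow> hplane) \<Rightarrow> hplane \<Rightarrow> real^2 \<Rightarrow> real \<Rightarrow> ennreal" where
  "gsep p H u h = emeasure lborel
     {x. x \<in> cell p \<and> x + h *\<^sub>R perp u \<in> cell p \<and> separates H x (x + h *\<^sub>R perp u)}"

lemma sets_lines [simp, measurable_cong]: "sets lines = sets borel"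
proof -
  have "sets lines = sets (borel \<Otimes>\<^sub>M borel :: hplane measure)"
    unfolding lines_def by (intro sets_pair_measure_cong) auto
  also have "\<dots> = sets borel" by (rule arg_cong[OF borel_prod])
  finally show ?thesis .
qed

lemma finite_measure_lines: "finite_measure lines"
  unfolding lines_def
  by (rule finite_measure_pair_measure) (rule finite_measure_Ir nu1.finite_measure_axioms)+

sublocale lines: finite_measure lines by (rule finite_measure_lines)

lemma cell_subset: "cell p \<subseteq> W" by (auto simp: cell_def)

lemma cell_child:
  "cell (child True H p) = cell p \<inter> {x. snd H \<le> x \<bullet> fst H}"
  "cell (child False H p) = cell p \<inter> {x. x \<bullet> fst H \<le> snd H}"
  by (auto simp: cell_def child_def split: nat.splits)

lemma cell_child_subset: "cell (child b H p) \<subseteq> cell p"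
  by (cases b) (auto simp: cell_child)

text \<open>The defining inequalities are jointly continuous in the point and, in the product
  topology, in the half-planes. A closed graph makes membership jointly measurable, and
  measurability in \<open>p\<close> of the functionals below rests on this.\<close>

lemma closed_cell_graph: "closed {(p, x). x \<in> cell p}"
proof -
  have "{(p, x). x \<in> cell p} = (UNIV \<times> W) \<inter> {z. \<forall>i. snd z \<bullet> fst (fst z i) \<le> snd (fst z i)}"
    by (auto simp: cell_def)
  moreover have "closed {z :: (nat \<Rightarrow> hplane) \<times> (real^2). \<forall>i. snd z \<bullet> fst (fst z i) \<le> snd (fst z i)}"
    by (intro closed_Collect_all closed_Collect_le continuous_intros
       continuous_on_compose2[OF continuous_on_product_coordinates, of UNIV]) auto
  ultimately show ?thesis
    using compact_imp_closed[OF compact_W] by (simp add: closed_Int closed_Times)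
qed

lemma measurable_cell [measurable (raw)]:
  assumes [measurable]: "f \<in> borel_measurable M" "g \<in> borel_measurable M"
  shows "Measurable.pred M (\<lambda>z. g z \<in> cell (f z))"
proof -
  have "{(p, x). x \<in> cell p} \<in> sets (borel \<Otimes>\<^sub>M borel)"
    unfolding borel_prod using closed_cell_graph by (rule borel_closed)
  then have "Measurable.pred (borel \<Otimes>\<^sub>M borel) (\<lambda>z. z \<in> {(p, x). x \<in> cell p})"
    unfolding pred_def by (simp add: space_pair_measure)
  from measurable_compose[OF _ this, of "\<lambda>z. (f z, g z)" M] show ?thesis by simp
qed

lemma closed_cell: "closed (cell p)"
proof -
  have "cell p = W \<inter> (\<Inter>i. {x. x \<bullet> fst (p i) \<le> snd (p i)})" by (auto simp: cell_def)
  moreover have "closed {x. x \<bullet> fst (p i) \<le> snd (p i)}" for i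
    by (intro closed_Collect_le continuous_intros)
  ultimately show ?thesis using compact_imp_closed[OF compact_W] by (auto intro!: closed_Int closed_INT)
qed

lemma cell_borel [measurable]: "cell p \<in> sets borel"
  using closed_cell by (rule borel_closed)

lemma convex_cell: "convex (cell p)"
proof -
  have "cell p = W \<inter> (\<Inter>i. {x. fst (p i) \<bullet> x \<le> snd (p i)})" by (auto simp: cell_def inner_commute)
  then show ?thesis using convex_W by (auto intro!: convex_Int convex_INT convex_halfspace_le)
qed

lemma closed_hit_graph: "closed {(p, H). hit p H}"
proof -
  have "{(p, H). hit p H} = snd ` ((W \<times> UNIV) \<inter>
     {z :: (real^2) \<times> (nat \<Rightarrow> hplane) \<times> hplane.
        (\<forall>i. fst z \<bullet> fst (fst (snd z) i) \<le> snd (fst (snd z) i)) \<and> fst z \<bullet> fst (snd (snd z)) = snd (snd (snd z))})"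
    by (force simp: hit_def cell_def image_iff)
  moreover have "closed {z :: (real^2) \<times> (nat \<Rightarrow> hplane) \<times> hplane.
        (\<forall>i. fst z \<bullet> fst (fst (snd z) i) \<le> snd (fst (snd z) i)) \<and> fst z \<bullet> fst (snd (snd z)) = snd (snd (snd z))}"
    by (intro closed_Collect_conj closed_Collect_all closed_Collect_le closed_Collect_eq continuous_intros
       continuous_on_compose2[OF continuous_on_product_coordinates, of UNIV]) auto
  ultimately show ?thesis
    using closed_projection_compact[OF compact_W] by simp
qed

lemma measurable_hit [measurable (raw)]:
  assumes [measurable]: "f \<in> borel_measurable M" "g \<in> borel_measurable M"
  shows "Measurable.pred M (\<lambda>z. hit (f z) (g z))"
proof -
  have "{(p, H). hit p H} \<in> sets (borel \<Otimes>\<^sub>M borel)"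
    unfolding borel_prod using closed_hit_graph by (rule borel_closed)
  then have "Measurable.pred (borel \<Otimes>\<^sub>M borel) (\<lambda>z. z \<in> {(p, H). hit p H})"
    unfolding pred_def by (simp add: space_pair_measure)
  from measurable_compose[OF _ this, of "\<lambda>z. (f z, g z)" M] show ?thesis by simp
qed

lemma hit_iff: "hit p H \<longleftrightarrow> Hline (fst H) (snd H) \<inter> cell p \<noteq> {}"
  by (auto simp: hit_def Hline_def)

lemma measurable_fst_hplane [measurable]: "(fst :: hplane \<Rightarrow> _) \<in> borel_measurable borel"
  by (intro borel_measurable_continuous_onI continuous_intros)

lemma measurable_snd_hplane [measurable]: "(snd :: hplane \<Rightarrow> _) \<in> borel_measurable borel"
  by (intro borel_measurable_continuous_onI continuous_intros)

lemma measurable_ell [measurable (raw)]: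
  assumes [measurable]: "f \<in> borel_measurable M" "g \<in> borel_measurable M"
  shows "(\<lambda>z. ell (f z) (g z)) \<in> borel_measurable M"
  unfolding ell_def chord_len_def measure_def by measurable

lemma measurable_gcov [measurable (raw)]:
  assumes [measurable]: "f \<in> borel_measurable M" "g \<in> borel_measurable M" "h \<in> borel_measurable M"
  shows "(\<lambda>z. gcov (f z) (g z) (h z)) \<in> borel_measurable M"
  unfolding gcov_def by measurable

lemma measurable_gsep [measurable (raw)]:
  assumes [measurable]: "f \<in> borel_measurable M" "g \<in> borel_measurable M" "h \<in> borel_measurable M" "k \<in> borel_measurable M"
  shows "(\<lambda>z. gsep (f z) (k z) (g z) (h z)) \<in> borel_measurable M"
  unfolding gsep_def by measurable

lemma AE_lines_unit: "AE H in lines. norm (fst H) = 1"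
proof -
  have "AE u in nu1. AE r in Ir \<rho>. norm (fst (u, r)) = 1"
    using AE_nu1_unit by eventually_elim simp
  then show ?thesis
    unfolding lines_def
  proof (intro pair_sigma_finite.AE_pair_measure)
    show "pair_sigma_finite nu1 (Ir \<rho>)" ..
    have "Measurable.pred (nu1 \<Otimes>\<^sub>M Ir \<rho>) (\<lambda>H. norm (fst H) = 1)" by measurable
    then show "{H \<in> space (nu1 \<Otimes>\<^sub>M Ir \<rho>). norm (fst H) = 1} \<in> sets (nu1 \<Otimes>\<^sub>M Ir \<rho>)"
      by (simp add: pred_def)
  qed
qed

lemma nn_integral_lines:
  assumes [measurable]: "f \<in> borel_measurable borel"
  shows "(\<integral>\<^sup>+H. f H \<partial>lines) = (\<integral>\<^sup>+u. \<integral>\<^sup>+r. indicator {-\<rho>..\<rho>} r * f (u, r) \<partial>lborel \<partial>nu1)"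
proof -
  have [measurable]: "f \<in> borel_measurable (nu1 \<Otimes>\<^sub>M Ir \<rho>)"
    unfolding lines_def[symmetric] measurable_cong_sets[OF sets_lines refl] by fact
  show ?thesis
    unfolding lines_def
    by (subst Ir.nn_integral_fst[symmetric]) (auto simp: nn_integral_Ir)
qed

lemma nn_integral_lines_unrestricted:
  assumes [measurable]: "f \<in> borel_measurable borel"
  assumes "\<And>u r. norm u = 1 \<Longrightarrow> \<rho> < \<bar>r\<bar> \<Longrightarrow> f (u, r) = 0"
  shows "(\<integral>\<^sup>+H. f H \<partial>lines) = (\<integral>\<^sup>+u. \<integral>\<^sup>+r. f (u, r) \<partial>lborel \<partial>nu1)"
  unfolding nn_integral_lines[OF assms(1)]
proof (rule nn_integral_cong_AE)
  show "AE u in nu1. (\<integral>\<^sup>+r. indicator {-\<rho>..\<rho>} r * f (u, r) \<partial>lborel) = (\<integral>\<^sup>+r. f (u, r) \<partial>lborel)"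
    using AE_nu1_unit
  proof eventually_elim
    case (elim u)
    show ?case
      using assms(2)[OF elim] by (intro nn_integral_cong) (auto simp: indicator_def abs_le_iff not_le)
  qed
qed

lemma hit_imp_abs_le: "norm (fst H) = 1 \<Longrightarrow> hit p H \<Longrightarrow> \<bar>snd H\<bar> \<le> \<rho>"
proof -
  assume u: "norm (fst H) = 1" and "hit p H"
  then obtain x where x: "x \<in> W" "x \<bullet> fst H = snd H" using cell_subset by (auto simp: hit_def)
  have "\<bar>x \<bullet> fst H\<bar> \<le> norm x * norm (fst H)" by (rule Cauchy_Schwarz_ineq2)
  then show ?thesis using x u norm_le[of x] by simp
qed

text \<open>A line with unit normal that meets a subset of the ball of radius \<open>\<rho>\<close>
  has an offset of modulus at most \<open>\<rho>\<close>, and almost every normal is a unit vector.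
  So the finite measure agrees with the one of the construction.\<close>

lemma emeasure_lines_hit: "emeasure lines {H. hit p H} = Lambda (hitting (cell p))"
proof -
  have "sets (nu1 \<Otimes>\<^sub>M lborel :: hplane measure) = sets (borel \<Otimes>\<^sub>M borel)"
    by (intro sets_pair_measure_cong) auto
  then have S: "sets (nu1 \<Otimes>\<^sub>M lborel :: hplane measure) = sets borel"
    unfolding borel_prod .
  have "{H \<in> space borel. hit p H} \<in> sets borel" by measurable
  then have meas: "{H. hit p H} \<in> sets (nu1 \<Otimes>\<^sub>M lborel)"
    unfolding S space_borel by simp
  have [measurable]: "(\<lambda>H. indicator {H. hit p H} H :: ennreal) \<in> borel_measurable (nu1 \<Otimes>\<^sub>M lborel)"
    using meas by (rule borel_measurable_indicator)
  have "emeasure lines {H. hit p H} = (\<integral>\<^sup>+H. indicator {H. hit p H} H \<partial>lines)"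
    by (rule nn_integral_indicator[symmetric]) simp
  also have "\<dots> = (\<integral>\<^sup>+u. \<integral>\<^sup>+r. indicator {H. hit p H} (u, r) \<partial>lborel \<partial>nu1)"
    using hit_imp_abs_le by (intro nn_integral_lines_unrestricted) (fastforce simp: indicator_def)+
  also have "\<dots> = (\<integral>\<^sup>+H. indicator {H. hit p H} H \<partial>(nu1 \<Otimes>\<^sub>M lborel))"
    by (subst lborel.nn_integral_fst[symmetric]) auto
  also have "\<dots> = emeasure (nu1 \<Otimes>\<^sub>M lborel) {H. hit p H}"
    using meas by (rule nn_integral_indicator)
  finally have *: "emeasure lines {H. hit p H} = emeasure (nu1 \<Otimes>\<^sub>M lborel) {H. hit p H}" .
  have "{H. hit p H} = {(u, r). Hline u r \<in> hitting (cell p)}"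
    by (auto simp: hit_iff hitting_def)
  with * show ?thesis by (simp only: Lambda_def)
qed

lemma Lam_eq: "Lambda_hit (cell p) = Lam p"
  by (simp add: Lambda_hit_def Lam_def measure_def emeasure_lines_hit)

lemma measurable_Lam [measurable (raw)]:
  assumes [measurable]: "f \<in> borel_measurable M"
  shows "(\<lambda>z. Lam (f z)) \<in> borel_measurable M"
proof -
  have *: "emeasure lines {H. hit p H} = (\<integral>\<^sup>+H. indicator {z. hit (fst z) (snd z)} (p, H) \<partial>lines)" for p
  proof -
    have "emeasure lines {H. hit p H} = (\<integral>\<^sup>+H. indicator {H. hit p H} H \<partial>lines)"
      by (rule nn_integral_indicator[symmetric]) simp
    then show ?thesis by (simp add: indicator_def)
  qed
  have "(\<lambda>p. \<integral>\<^sup>+H. indicator {z. hit (fst z) (snd z)} (p, H) \<partial>lines) \<in> borel_measurable borel"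
    by measurable
  then have "Lam \<in> borel_measurable borel"
    unfolding Lam_def measure_def * by measurable
  then show ?thesis using assms by measurable
qed

subsection \<open>Chords\<close>

lemma chord_norm:
  assumes "norm u = 1"
  shows "norm (r *\<^sub>R u + t *\<^sub>R perp u) ^ 2 = r^2 + t^2"
proof -
  have "u \<bullet> u = 1" "perp u \<bullet> perp u = 1"
    using assms by (simp_all add: dot_square_norm)
  then show ?thesis
    unfolding power2_norm_eq_inner by (simp add: inner_add_left inner_add_right power2_eq_square)
qed

lemma chord_in_cell:
  assumes "norm u = 1" "r *\<^sub>R u + t *\<^sub>R perp u \<in> cell p"
  shows "\<bar>t\<bar> \<le> \<rho>" "\<bar>r\<bar> \<le> \<rho>" "hit p (u, r)"
proof -
  have n: "norm (r *\<^sub>R u + t *\<^sub>R perp u) \<le> \<rho>" using assms(2) cell_subset norm_le by blast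
  have "norm (r *\<^sub>R u + t *\<^sub>R perp u) ^ 2 \<le> \<rho>^2"
    using n by (intro power_mono) auto
  then have "r^2 + t^2 \<le> \<rho>^2" using chord_norm[OF assms(1), of r t] by simp
  then have "t^2 \<le> \<rho>^2" "r^2 \<le> \<rho>^2" using zero_le_power2[of t] zero_le_power2[of r] by linarith+
  then show "\<bar>t\<bar> \<le> \<rho>" "\<bar>r\<bar> \<le> \<rho>" using rho_pos by (auto simp: abs_le_square_iff[symmetric])
  have "(r *\<^sub>R u + t *\<^sub>R perp u) \<bullet> u = r"
    using assms(1) by (simp add: inner_add_left dot_square_norm)
  then show "hit p (u, r)" unfolding hit_def using assms(2) by auto
qed

lemma emeasure_chord:
  assumes "norm (fst H) = 1"
  shows "emeasure lborel {t. snd H *\<^sub>R fst H + t *\<^sub>R perp (fst H) \<in> cell p} = ennreal (ell p H)"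
    "ell p H \<le> 2 * \<rho>"
proof -
  let ?S = "{t. snd H *\<^sub>R fst H + t *\<^sub>R perp (fst H) \<in> cell p}"
  have sub: "?S \<subseteq> {-\<rho>..\<rho>}" using chord_in_cell(1)[OF assms, of "snd H" _ p] by (fastforce simp: abs_le_iff)
  have "emeasure lborel ?S \<le> emeasure lborel {-\<rho>..\<rho>}" by (rule emeasure_mono[OF sub]) simp
  also have "\<dots> = ennreal (2 * \<rho>)" using rho_pos by simp
  finally have le: "emeasure lborel ?S \<le> ennreal (2 * \<rho>)" .
  then have "emeasure lborel ?S < \<infinity>" unfolding infinity_ennreal_def using ennreal_less_top by (rule le_less_trans)
  then show *: "emeasure lborel ?S = ennreal (ell p H)"
    unfolding ell_def chord_len_def by (intro emeasure_eq_ennreal_measure) auto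
  show "ell p H \<le> 2 * \<rho>" using le rho_pos unfolding * by (simp add: ennreal_le_iff)
qed

lemma ell_nonneg [simp]: "0 \<le> ell p H"
  by (simp add: ell_def chord_len_def)

lemma ell_eq_0: "norm (fst H) = 1 \<Longrightarrow> \<not> hit p H \<Longrightarrow> ell p H = 0"
proof -
  assume "norm (fst H) = 1" "\<not> hit p H"
  then have "{t. snd H *\<^sub>R fst H + t *\<^sub>R perp (fst H) \<in> cell p} = {}"
    using chord_in_cell(3)[of "fst H" "snd H"] by auto
  then show ?thesis by (simp add: ell_def chord_len_def)
qed

lemma area_nonneg [simp]: "0 \<le> area p"
  by (simp add: area_def)

lemma emeasure_W_finite: "emeasure lborel W < \<infinity>"
  using emeasure_bounded_finite[OF compact_imp_bounded[OF compact_W]] by simp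

lemma emeasure_cell: "emeasure lborel (cell p) = ennreal (area p)"
proof -
  have "emeasure lborel (cell p) \<le> emeasure lborel W"
    using cell_subset compact_imp_closed[OF compact_W] by (intro emeasure_mono) auto
  then have "emeasure lborel (cell p) < \<infinity>" using emeasure_W_finite by (rule le_less_trans)
  then show ?thesis unfolding area_def by (intro emeasure_eq_ennreal_measure) auto
qed

lemma nn_integral_chord:
  assumes u: "norm u = 1"
  shows "(\<integral>\<^sup>+t. indicator (cell p) (r *\<^sub>R u + t *\<^sub>R perp u) \<partial>lborel) = ennreal (ell p (u, r))"
proof -
  have "(\<integral>\<^sup>+t. indicator (cell p) (r *\<^sub>R u + t *\<^sub>R perp u) \<partial>lborel) =
      (\<integral>\<^sup>+t. indicator {t. r *\<^sub>R u + t *\<^sub>R perp u \<in> cell p} t \<partial>lborel)"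
    by (simp add: indicator_def)
  also have "\<dots> = emeasure lborel {t. r *\<^sub>R u + t *\<^sub>R perp u \<in> cell p}"
    by (rule nn_integral_indicator) simp
  also have "\<dots> = ennreal (ell p (u, r))" using emeasure_chord(1)[of "(u, r)" p] u by simp
  finally show ?thesis .
qed

text \<open>For each unit normal, Cavalieri's principle over the parallel chords gives the area, and
  averaging over normals changes nothing. This is the unit length density and the source of the mean
  \<open>t * area p\<close>.\<close>

lemma nn_integral_ell: "(\<integral>\<^sup>+H. ennreal (ell p H) \<partial>lines) = ennreal (area p)"
proof -
  have "(\<integral>\<^sup>+H. ennreal (ell p H) \<partial>lines) = (\<integral>\<^sup>+u. \<integral>\<^sup>+r. ennreal (ell p (u, r)) \<partial>lborel \<partial>nu1)"
    using hit_imp_abs_le ell_eq_0 by (intro nn_integral_lines_unrestricted) fastforce+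
  also have "\<dots> = (\<integral>\<^sup>+u. ennreal (area p) \<partial>nu1)"
  proof (rule nn_integral_cong_AE)
    show "AE u in nu1. (\<integral>\<^sup>+r. ennreal (ell p (u, r)) \<partial>lborel) = ennreal (area p)"
      using AE_nu1_unit
    proof eventually_elim
      case (elim u)
      have "(\<integral>\<^sup>+r. ennreal (ell p (u, r)) \<partial>lborel) = (\<integral>\<^sup>+r. \<integral>\<^sup>+t. indicator (cell p) (r *\<^sub>R u + t *\<^sub>R perp u) \<partial>lborel \<partial>lborel)"
        by (simp add: nn_integral_chord[OF elim])
      also have "\<dots> = (\<integral>\<^sup>+x. indicator (cell p) x \<partial>lborel)"
        by (rule nn_integral_orthonormal_coordinates[OF elim, symmetric]) simp
      finally show ?case by (simp add: emeasure_cell)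
    qed
  qed
  also have "\<dots> = ennreal (area p)" using nu1.emeasure_space_1 by simp
  finally show ?thesis .
qed

end

subsection \<open>Covariograms of cells\<close>

lemma nn_integral_shift:
  fixes f :: "real \<Rightarrow> ennreal"
  assumes [measurable]: "f \<in> borel_measurable borel"
  shows "(\<integral>\<^sup>+x. f (x + c) \<partial>lborel) = (\<integral>\<^sup>+x. f x \<partial>lborel)"
  by (subst (2) lborel_distr_plus[symmetric, of c]) (simp add: nn_integral_distr add.commute)

lemma emeasure_between:
  "emeasure lborel {r::real. a < r \<and> r < b \<or> b < r \<and> r < a} = ennreal \<bar>a - b\<bar>"
proof -
  have "{r. a < r \<and> r < b \<or> b < r \<and> r < a} = {min a b <..< max a b}" by auto
  then show ?thesis by (auto simp: max_def min_def)
qed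

lemma AE_not_in_hyperplane:
  fixes n :: "'a::euclidean_space"
  assumes "n \<noteq> 0"
  shows "AE x in lborel. x \<bullet> n \<noteq> r"
proof -
  have "negligible {x. n \<bullet> x = r}" using assms by (intro negligible_hyperplane) auto
  then have "AE x in lebesgue. x \<notin> {x. n \<bullet> x = r}"
    by (simp only: negligible_iff_null_sets AE_not_in)
  then have "AE x in lebesgue. x \<bullet> n \<noteq> r" by eventually_elim (simp add: inner_commute)
  then show ?thesis by (subst (asm) AE_completion_iff)
qed

context convex_window
begin

interpretation lines_lborel: pair_sigma_finite lines "lborel :: (real^2) measure" ..
interpretation nu1_lborel: pair_sigma_finite nu1 "lborel :: real measure" ..
interpretation lines_nu1: pair_sigma_finite lines nu1 ..

text \<open>The affine function \<open>x \<bullet> fst H - snd H\<close> changes sign along the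
  segment and \<open>\<tau>\<close> is the parameter of its zero; convexity keeps that point in the
  cell.\<close>

lemma crossing_point:
  assumes "x \<in> cell p" "y \<in> cell p" "separates H x y"
  defines "\<tau> \<equiv> (snd H - x \<bullet> fst H) / ((y - x) \<bullet> fst H)"
  shows "x + \<tau> *\<^sub>R (y - x) \<in> cell p" "(x + \<tau> *\<^sub>R (y - x)) \<bullet> fst H = snd H"
proof -
  have d: "(y - x) \<bullet> fst H \<noteq> 0"
    using assms(3) by (auto simp: separates_def inner_diff_left)
  have t: "0 \<le> \<tau>" "\<tau> \<le> 1"
    using assms(3) by (auto simp: \<tau>_def separates_def inner_diff_left divide_simps)
  have "(1 - \<tau>) *\<^sub>R x + \<tau> *\<^sub>R y \<in> cell p"
    using convexD_alt[OF convex_cell assms(1,2) t] by simp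
  then show "x + \<tau> *\<^sub>R (y - x) \<in> cell p" by (simp add: algebra_simps)
  show "(x + \<tau> *\<^sub>R (y - x)) \<bullet> fst H = snd H"
    using d by (simp add: \<tau>_def inner_add_left)
qed

lemma separates_imp_hit: "x \<in> cell p \<Longrightarrow> y \<in> cell p \<Longrightarrow> separates H x y \<Longrightarrow> hit p H"
  using crossing_point[of x p y H] unfolding hit_def by blast

text \<open>For a fixed normal \<open>u\<close> the separating offsets fill an open interval of
  length \<open>\<bar>(x - y) \<bullet> u\<bar>\<close>; averaging this over \<open>u\<close> is
  Crofton's formula.\<close>

lemma nn_integral_separates:
  assumes "x \<in> W" "y \<in> W"
  shows "(\<integral>\<^sup>+H. indicator {H. separates H x y} H \<partial>lines) = ennreal (2 / pi * norm (x - y))"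
proof -
  have bd: "\<bar>z \<bullet> u\<bar> \<le> \<rho>" if "norm u = 1" "z \<in> W" for u z
    using Cauchy_Schwarz_ineq2[of z u] norm_le[OF that(2)] that(1) by simp
  have "(\<integral>\<^sup>+H. indicator {H. separates H x y} H \<partial>lines) =
      (\<integral>\<^sup>+u. \<integral>\<^sup>+r. indicator {H. separates H x y} (u, r) \<partial>lborel \<partial>nu1)"
  proof (rule nn_integral_lines_unrestricted)
    fix u :: "real^2" and r assume "norm u = 1" "\<rho> < \<bar>r\<bar>"
    then show "indicator {H. separates H x y} (u, r) = 0"
      using bd[OF _ assms(1), of u] bd[OF _ assms(2), of u]
      by (auto simp: indicator_def separates_def abs_le_iff)
  qed simp
  also have "\<dots> = (\<integral>\<^sup>+u. ennreal \<bar>(x - y) \<bullet> u\<bar> \<partial>nu1)"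
  proof (rule nn_integral_cong)
    fix u
    have "(\<integral>\<^sup>+r. indicator {H. separates H x y} (u, r) \<partial>lborel) =
       (\<integral>\<^sup>+r. indicator {r. x \<bullet> u < r \<and> r < y \<bullet> u \<or> y \<bullet> u < r \<and> r < x \<bullet> u} r \<partial>lborel)"
      by (simp add: indicator_def separates_def)
    also have "\<dots> = ennreal \<bar>(x - y) \<bullet> u\<bar>"
      by (subst nn_integral_indicator) (auto simp: emeasure_between inner_diff_left)
    finally show "(\<integral>\<^sup>+r. indicator {H. separates H x y} (u, r) \<partial>lborel) = ennreal \<bar>(x - y) \<bullet> u\<bar>" .
  qed
  finally show ?thesis by (simp add: crofton_nn)
qed

lemma Lam_nonneg [simp]: "0 \<le> Lam p"
  by (simp add: Lam_def)

lemma emeasure_hit: "emeasure lines {H. hit p H} = ennreal (Lam p)"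
  by (simp add: Lam_def lines.emeasure_eq_measure)

text \<open>Lines separating two points of a convex cell hit the cell. The bound serves to show that
  a cell with \<open>Lam p = 0\<close> has at most one point.\<close>

lemma Lam_ge:
  assumes "x \<in> cell p" "y \<in> cell p"
  shows "2 / pi * norm (x - y) \<le> Lam p"
proof -
  have "ennreal (2 / pi * norm (x - y)) = (\<integral>\<^sup>+H. indicator {H. separates H x y} H \<partial>lines)"
    using assms cell_subset by (intro nn_integral_separates[symmetric]) auto
  also have "\<dots> \<le> (\<integral>\<^sup>+H. indicator {H. hit p H} H \<partial>lines)"
    using separates_imp_hit[OF assms] by (intro nn_integral_mono) (auto simp: indicator_def)
  also have "\<dots> = ennreal (Lam p)"
    by (subst nn_integral_indicator) (auto simp: emeasure_hit)
  finally show ?thesis by simp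
qed

lemma Lam_le: "Lam p \<le> 2 * \<rho>"
proof -
  have "emeasure lines {H. hit p H} \<le> emeasure lines (space lines)"
    by (rule emeasure_space)
  also have "\<dots> = (\<integral>\<^sup>+H. 1 \<partial>lines)" by simp
  also have "\<dots> = (\<integral>\<^sup>+(u::real^2). \<integral>\<^sup>+r. indicator {-\<rho>..\<rho>} r * 1 \<partial>lborel \<partial>nu1)"
    by (rule nn_integral_lines) simp
  also have "\<dots> = ennreal (2 * \<rho>)"
    using rho_pos nu1.emeasure_space_1 by simp
  finally show ?thesis using rho_pos by (simp add: emeasure_hit ennreal_le_iff)
qed

lemma Lam_eq_0: "Lam p = 0 \<Longrightarrow> x \<in> cell p \<Longrightarrow> y \<in> cell p \<Longrightarrow> x = y"
  using Lam_ge[of x p y] pi_gt_zero by (auto simp: mult_le_0_iff divide_le_0_iff)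



lemma gcov_eq_0:
  assumes "norm u = 1" "2 * \<rho> < \<bar>h\<bar>"
  shows "gcov p u h = 0"
proof -
  have "x \<notin> cell p \<or> x + h *\<^sub>R perp u \<notin> cell p" for x
  proof (rule ccontr)
    assume "\<not> ?thesis"
    then have "x \<in> W" "x + h *\<^sub>R perp u \<in> W" using cell_subset by auto
    then have "norm x \<le> \<rho>" "norm (x + h *\<^sub>R perp u) \<le> \<rho>" using norm_le by auto
    moreover have "norm (h *\<^sub>R perp u) \<le> norm (x + h *\<^sub>R perp u) + norm x"
      using norm_triangle_ineq4[of "x + h *\<^sub>R perp u" x] by simp
    ultimately show False using assms by simp
  qed
  then have "{x. x \<in> cell p \<and> x + h *\<^sub>R perp u \<in> cell p} = {}" by auto
  then show ?thesis by (simp only: gcov_def) simp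
qed

lemma gsep_le_gcov: "gsep p H u h \<le> gcov p u h"
  unfolding gsep_def gcov_def by (intro emeasure_mono) auto

lemma gcov_le_area: "gcov p u h \<le> ennreal (area p)"
  unfolding gcov_def emeasure_cell[symmetric] by (intro emeasure_mono) auto

text \<open>If \<open>x\<close> is off the line, the pair \<open>x\<close>,
  \<open>x + h *\<^sub>R perp u\<close> either lies in exactly one child or is separated. The points
  \<open>x\<close> on the line form a null set.\<close>

lemma gcov_split:
  assumes "norm (fst H) = 1"
  shows "gcov p u h = gcov (child False H p) u h + gcov (child True H p) u h + gsep p H u h"
proof -
  let ?C = "\<lambda>p. {x. x \<in> cell p \<and> x + h *\<^sub>R perp u \<in> cell p}"
  let ?S = "{x. x \<in> cell p \<and> x + h *\<^sub>R perp u \<in> cell p \<and> separates H x (x + h *\<^sub>R perp u)}"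
  have n: "fst H \<noteq> 0" using assms by auto
  have ind: "gcov q u h = (\<integral>\<^sup>+x. indicator (?C q) x \<partial>lborel)" for q
    unfolding gcov_def by (rule nn_integral_indicator[symmetric]) simp
  have ind2: "gsep p H u h = (\<integral>\<^sup>+x. indicator ?S x \<partial>lborel)"
    unfolding gsep_def by (rule nn_integral_indicator[symmetric]) simp
  have "gcov p u h = (\<integral>\<^sup>+x. indicator (?C (child False H p)) x + indicator (?C (child True H p)) x + indicator ?S x \<partial>lborel)"
    unfolding ind
  proof (rule nn_integral_cong_AE)
    show "AE x in lborel. indicator (?C p) x =
      (indicator (?C (child False H p)) x + indicator (?C (child True H p)) x + indicator ?S x :: ennreal)"
      using AE_not_in_hyperplane[OF n, of "snd H"]
    proof eventually_elim
      case (elim x)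
      then show ?case
        by (auto simp: indicator_def cell_child separates_def)
    qed
  qed
  also have "\<dots> = gcov (child False H p) u h + gcov (child True H p) u h + gsep p H u h"
    unfolding ind ind2 by (simp add: nn_integral_add)
  finally show ?thesis .
qed

text \<open>In coordinates across and along \<open>H\<close>, separated pairs start in a strip of
  width \<open>\<bar>\<delta>\<bar>\<close>, which is at most |h|. Pairs starting at the same
  distance from \<open>H\<close> cross it after the same displacement, so each slice of the strip
  fits into a translate of the chord.\<close>

lemma gsep_le_ell:
  assumes n: "norm (fst H) = 1" and u: "norm u = 1"
  shows "gsep p H u h \<le> ennreal (\<bar>h\<bar> * ell p H)"
proof -
  let ?S = "{x. x \<in> cell p \<and> x + h *\<^sub>R perp u \<in> cell p \<and> separates H x (x + h *\<^sub>R perp u)}"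
  define n m r v where "n = fst H" and "m = perp n" and "r = snd H" and "v = perp u"
  define \<delta> where "\<delta> = h * (v \<bullet> n)"
  have n1: "norm n = 1" "n \<bullet> n = 1" "m \<bullet> n = 0" "n \<bullet> m = 0" "m \<bullet> m = 1"
    using n by (auto simp: n_def m_def dot_square_norm)
  let ?B = "{a. r - \<delta> < a \<and> a < r \<or> r < a \<and> a < r - \<delta>}"
  have "gsep p H u h = (\<integral>\<^sup>+x. indicator ?S x \<partial>lborel)"
    unfolding gsep_def by (rule nn_integral_indicator[symmetric]) simp
  also have "\<dots> = (\<integral>\<^sup>+a. \<integral>\<^sup>+b. indicator ?S (a *\<^sub>R n + b *\<^sub>R m) \<partial>lborel \<partial>lborel)"
    unfolding m_def by (rule nn_integral_orthonormal_coordinates[OF n1(1)]) simp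
  also have "\<dots> \<le> (\<integral>\<^sup>+a. indicator ?B a * ennreal (ell p H) \<partial>lborel)"
  proof (rule nn_integral_mono)
    fix a
    show "(\<integral>\<^sup>+b. indicator ?S (a *\<^sub>R n + b *\<^sub>R m) \<partial>lborel) \<le> indicator ?B a * ennreal (ell p H)"
    proof (cases "a \<in> ?B")
      case False
      have nS: "a *\<^sub>R n + b *\<^sub>R m \<notin> ?S" for b
        using False n1 by (auto simp: separates_def n_def[symmetric] r_def[symmetric] v_def[symmetric] inner_add_left \<delta>_def)
      have "(\<integral>\<^sup>+b. indicator ?S (a *\<^sub>R n + b *\<^sub>R m) \<partial>lborel) = (\<integral>\<^sup>+b. 0 \<partial>(lborel :: real measure))"
        by (rule nn_integral_cong, rule indicator_simps(2), rule nS)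
      also have "\<dots> = 0" by simp
      finally show ?thesis by (rule ord_eq_le_trans) simp
    next
      case True
      \<comment> \<open>Displacement along \<open>H\<close> between starting point and crossing
        point. It does not depend on \<open>b\<close>, so translation invariance turns the slice
        into the chord.\<close>
      define c where "c = (r - a) / \<delta> * h * (v \<bullet> m)"
      have "indicator ?S (a *\<^sub>R n + b *\<^sub>R m) \<le> (indicator (cell p) (r *\<^sub>R n + (b + c) *\<^sub>R m) :: ennreal)" for b
      proof (cases "a *\<^sub>R n + b *\<^sub>R m \<in> ?S")
        case S: True
        let ?x = "a *\<^sub>R n + b *\<^sub>R m"
        let ?t = "(r - a) / \<delta>"
        let ?z = "?x + ?t *\<^sub>R (h *\<^sub>R v)"
        have S': "?x \<in> cell p" "?x + h *\<^sub>R v \<in> cell p" "separates H ?x (?x + h *\<^sub>R v)"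
          using S by (auto simp: v_def)
        have xn: "?x \<bullet> n = a" "?x \<bullet> m = b" using n1 by (auto simp: inner_add_left)
        have z: "?z \<in> cell p" "?z \<bullet> n = r"
          using crossing_point[OF S'] by (simp_all add: n_def[symmetric] r_def[symmetric] xn \<delta>_def[symmetric])
        have "?z = (?z \<bullet> n) *\<^sub>R n + (?z \<bullet> m) *\<^sub>R m"
          using perp_expansion[OF n1(1), of ?z] by (simp add: m_def)
        also have "?z \<bullet> m = b + c"
          using xn by (simp add: inner_add_left c_def)
        finally have "?z = r *\<^sub>R n + (b + c) *\<^sub>R m" by (simp only: z)
        then show ?thesis using z(1) by (simp add: indicator_def)
      qed (auto simp: indicator_def)
      then have "(\<integral>\<^sup>+b. indicator ?S (a *\<^sub>R n + b *\<^sub>R m) \<partial>lborel) \<le>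
          (\<integral>\<^sup>+b. indicator (cell p) (r *\<^sub>R n + (b + c) *\<^sub>R m) \<partial>lborel)"
        by (intro nn_integral_mono)
      also have "\<dots> = (\<integral>\<^sup>+b. indicator (cell p) (r *\<^sub>R n + b *\<^sub>R m) \<partial>lborel)"
        by (rule nn_integral_shift) simp
      also have "\<dots> = ennreal (ell p H)"
        using nn_integral_chord[OF n1(1), of p r] by (simp add: m_def n_def r_def)
      finally show ?thesis using True by simp
    qed
  qed
  also have "\<dots> = (\<integral>\<^sup>+a. indicator ?B a \<partial>lborel) * ennreal (ell p H)"
    by (rule nn_integral_multc) simp
  also have "(\<integral>\<^sup>+a. indicator ?B a \<partial>lborel) = emeasure lborel ?B"
    by (rule nn_integral_indicator) simp
  also have "\<dots> = ennreal \<bar>\<delta>\<bar>" by (simp add: emeasure_between)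
  also have "\<dots> * ennreal (ell p H) = ennreal (\<bar>\<delta>\<bar> * ell p H)" by (simp add: ennreal_mult)
  also have "\<dots> \<le> ennreal (\<bar>h\<bar> * ell p H)"
  proof -
    have "\<bar>v \<bullet> n\<bar> \<le> 1" using Cauchy_Schwarz_ineq2[of v n] n1(1) u by (simp add: v_def)
    then have "\<bar>\<delta>\<bar> \<le> \<bar>h\<bar>" unfolding \<delta>_def abs_mult by (rule mult_left_le) simp
    then show ?thesis by (intro ennreal_leI mult_right_mono) auto
  qed
  finally show ?thesis .
qed

text \<open>By Fubini the lines can be integrated first, and every pair at distance |h| is separated
  by lines of the same total measure, wherever it lies.\<close>

lemma nn_integral_gsep:
  assumes u: "norm u = 1"
  shows "(\<integral>\<^sup>+H. gsep p H u h \<partial>lines) = ennreal (2 / pi * \<bar>h\<bar>) * gcov p u h"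
proof -
  let ?C = "{x. x \<in> cell p \<and> x + h *\<^sub>R perp u \<in> cell p}"
  have "gsep p H u h = (\<integral>\<^sup>+x. indicator ?C x * indicator {H. separates H x (x + h *\<^sub>R perp u)} H \<partial>lborel)" for H
  proof -
    let ?S = "{x. x \<in> cell p \<and> x + h *\<^sub>R perp u \<in> cell p \<and> separates H x (x + h *\<^sub>R perp u)}"
    have "gsep p H u h = (\<integral>\<^sup>+x. indicator ?S x \<partial>lborel)"
      unfolding gsep_def by (rule nn_integral_indicator[symmetric]) simp
    also have "\<dots> = (\<integral>\<^sup>+x. indicator ?C x * indicator {H. separates H x (x + h *\<^sub>R perp u)} H \<partial>lborel)"
      by (intro nn_integral_cong) (simp add: indicator_def)
    finally show ?thesis .
  qed
  then have "(\<integral>\<^sup>+H. gsep p H u h \<partial>lines) =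
    (\<integral>\<^sup>+H. \<integral>\<^sup>+x. indicator ?C x * indicator {H. separates H x (x + h *\<^sub>R perp u)} H \<partial>lborel \<partial>lines)"
    by simp
  also have "\<dots> = (\<integral>\<^sup>+x. \<integral>\<^sup>+H. indicator ?C x * indicator {H. separates H x (x + h *\<^sub>R perp u)} H \<partial>lines \<partial>lborel)"
    by (rule lines_lborel.Fubini'[symmetric]) (simp add: indicator_def)
  also have "\<dots> = (\<integral>\<^sup>+x. indicator ?C x * ennreal (2 / pi * \<bar>h\<bar>) \<partial>lborel)"
  proof (rule nn_integral_cong)
    fix x
    show "(\<integral>\<^sup>+H. indicator ?C x * indicator {H. separates H x (x + h *\<^sub>R perp u)} H \<partial>lines) =
        indicator ?C x * ennreal (2 / pi * \<bar>h\<bar>)"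
    proof (cases "x \<in> ?C")
      case True
      then have "x \<in> W" "x + h *\<^sub>R perp u \<in> W" using cell_subset by auto
      from nn_integral_separates[OF this] True u show ?thesis by simp
    qed simp
  qed
  also have "\<dots> = emeasure lborel ?C * ennreal (2 / pi * \<bar>h\<bar>)"
    by (subst nn_integral_multc) auto
  finally show ?thesis by (simp add: gcov_def mult.commute)
qed

text \<open>A pair counted by \<open>gcov p u h\<close> lies on one chord with normal
  \<open>u\<close>. Letting \<open>h\<close> run through the reals counts all ordered pairs on each
  chord, which gives the square of its length.\<close>

lemma nn_integral_gcov:
  assumes u: "norm u = 1"
  shows "(\<integral>\<^sup>+h. gcov p u h \<partial>lborel) = (\<integral>\<^sup>+r. ennreal (ell p (u, r))^2 \<partial>lborel)"
proof -

  let ?I = "indicator (cell p) :: _ \<Rightarrow> ennreal"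
  let ?v = "perp u"
  have "gcov p u h = (\<integral>\<^sup>+x. ?I x * ?I (x + h *\<^sub>R ?v) \<partial>lborel)" for h
  proof -
    let ?C = "{x. x \<in> cell p \<and> x + h *\<^sub>R perp u \<in> cell p}"
    have "gcov p u h = (\<integral>\<^sup>+x. indicator ?C x \<partial>lborel)"
      unfolding gcov_def by (rule nn_integral_indicator[symmetric]) simp
    also have "\<dots> = (\<integral>\<^sup>+x. ?I x * ?I (x + h *\<^sub>R ?v) \<partial>lborel)"
      by (intro nn_integral_cong) (simp add: indicator_def)
    finally show ?thesis .
  qed
  then have "(\<integral>\<^sup>+h. gcov p u h \<partial>lborel) = (\<integral>\<^sup>+h. \<integral>\<^sup>+x. ?I x * ?I (x + h *\<^sub>R ?v) \<partial>lborel \<partial>lborel)"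
    by simp
  also have "\<dots> = (\<integral>\<^sup>+x. \<integral>\<^sup>+h. ?I x * ?I (x + h *\<^sub>R ?v) \<partial>lborel \<partial>lborel)"
    by (rule lborel_pair.Fubini'[symmetric]) (simp add: indicator_def)
  also have "\<dots> = (\<integral>\<^sup>+a. \<integral>\<^sup>+b. \<integral>\<^sup>+h. ?I (a *\<^sub>R u + b *\<^sub>R ?v) * ?I (a *\<^sub>R u + b *\<^sub>R ?v + h *\<^sub>R ?v) \<partial>lborel \<partial>lborel \<partial>lborel)"
    by (rule nn_integral_orthonormal_coordinates[OF u]) (simp add: indicator_def)
  also have "\<dots> = (\<integral>\<^sup>+a. ennreal (ell p (u, a))^2 \<partial>lborel)"
  proof (rule nn_integral_cong)
    fix a
    have "(\<integral>\<^sup>+h. ?I (a *\<^sub>R u + b *\<^sub>R ?v) * ?I (a *\<^sub>R u + b *\<^sub>R ?v + h *\<^sub>R ?v) \<partial>lborel) =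
       ?I (a *\<^sub>R u + b *\<^sub>R ?v) * ennreal (ell p (u, a))" for b
    proof -
      have "(\<integral>\<^sup>+h. ?I (a *\<^sub>R u + b *\<^sub>R ?v) * ?I (a *\<^sub>R u + b *\<^sub>R ?v + h *\<^sub>R ?v) \<partial>lborel) =
        ?I (a *\<^sub>R u + b *\<^sub>R ?v) * (\<integral>\<^sup>+h. ?I (a *\<^sub>R u + (h + b) *\<^sub>R ?v) \<partial>lborel)"
        by (subst nn_integral_cmult) (auto simp: algebra_simps)
      also have "(\<integral>\<^sup>+h. ?I (a *\<^sub>R u + (h + b) *\<^sub>R ?v) \<partial>lborel) = (\<integral>\<^sup>+h. ?I (a *\<^sub>R u + h *\<^sub>R ?v) \<partial>lborel)"
        by (rule nn_integral_shift) simp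
      finally show ?thesis by (simp add: nn_integral_chord[OF u])
    qed
    then have "(\<integral>\<^sup>+b. \<integral>\<^sup>+h. ?I (a *\<^sub>R u + b *\<^sub>R ?v) * ?I (a *\<^sub>R u + b *\<^sub>R ?v + h *\<^sub>R ?v) \<partial>lborel \<partial>lborel) =
       (\<integral>\<^sup>+b. ?I (a *\<^sub>R u + b *\<^sub>R ?v) * ennreal (ell p (u, a)) \<partial>lborel)" by simp
    also have "\<dots> = (\<integral>\<^sup>+b. ?I (a *\<^sub>R u + b *\<^sub>R ?v) \<partial>lborel) * ennreal (ell p (u, a))"
      by (rule nn_integral_multc) simp
    finally show "(\<integral>\<^sup>+b. \<integral>\<^sup>+h. ?I (a *\<^sub>R u + b *\<^sub>R ?v) * ?I (a *\<^sub>R u + b *\<^sub>R ?v + h *\<^sub>R ?v) \<partial>lborel \<partial>lborel) =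
       ennreal (ell p (u, a))^2" by (simp add: nn_integral_chord[OF u] power2_eq_square)
  qed
  finally show ?thesis .
qed

text \<open>Isotropic covariogram: F_t depends on the distance only, so directions can be averaged
  first. With signed \<open>h\<close>, integrating a function of |h| against \<open>cov p\<close>
  amounts to its double integral over pairs on all chords.\<close>

definition cov :: "(nat \<Rightarrow> hplane) \<Rightarrow> real \<Rightarrow> ennreal" where
  "cov p h = (\<integral>\<^sup>+u. gcov p u h \<partial>nu1)"

definition csep :: "(nat \<Rightarrow> hplane) \<Rightarrow> hplane \<Rightarrow> real \<Rightarrow> ennreal" where
  "csep p H h = (\<integral>\<^sup>+u. gsep p H u h \<partial>nu1)"

lemma measurable_cov [measurable (raw)]:
  assumes [measurable]: "f \<in> borel_measurable M" "g \<in> borel_measurable M"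
  shows "(\<lambda>z. cov (f z) (g z)) \<in> borel_measurable M"
  unfolding cov_def by measurable

lemma measurable_csep [measurable (raw)]:
  assumes [measurable]: "f \<in> borel_measurable M" "g \<in> borel_measurable M" "h \<in> borel_measurable M"
  shows "(\<lambda>z. csep (f z) (g z) (h z)) \<in> borel_measurable M"
  unfolding csep_def by measurable

lemma cov_split:
  assumes "norm (fst H) = 1"
  shows "cov p h = cov (child False H p) h + cov (child True H p) h + csep p H h"
  unfolding cov_def csep_def
  by (subst gcov_split[OF assms, of p]) (simp add: nn_integral_add)

lemma cov_eq_0: "2 * \<rho> < \<bar>h\<bar> \<Longrightarrow> cov p h = 0"
proof -
  assume h: "2 * \<rho> < \<bar>h\<bar>"
  have "cov p h = (\<integral>\<^sup>+(u::real^2). 0 \<partial>nu1)" unfolding cov_def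
    using AE_nu1_unit by (intro nn_integral_cong_AE) (auto elim!: eventually_mono simp: gcov_eq_0[OF _ h])
  then show ?thesis by simp
qed

lemma csep_le_cov: "csep p H h \<le> cov p h"
  unfolding csep_def cov_def by (intro nn_integral_mono gsep_le_gcov)

lemma cov_le_area: "cov p h \<le> ennreal (area p)"
proof -
  have "cov p h \<le> (\<integral>\<^sup>+(u::real^2). ennreal (area p) \<partial>nu1)"
    unfolding cov_def by (intro nn_integral_mono gcov_le_area)
  then show ?thesis using nu1.emeasure_space_1 by simp
qed

lemma csep_le_ell:
  assumes "norm (fst H) = 1"
  shows "csep p H h \<le> ennreal (\<bar>h\<bar> * ell p H)"
proof -
  have "csep p H h \<le> (\<integral>\<^sup>+(u::real^2). ennreal (\<bar>h\<bar> * ell p H) \<partial>nu1)" unfolding csep_def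
    using AE_nu1_unit by (intro nn_integral_mono_AE) (auto elim!: eventually_mono intro: gsep_le_ell[OF assms])
  then show ?thesis using nu1.emeasure_space_1 by simp
qed

lemma nn_integral_csep:
  "(\<integral>\<^sup>+H. csep p H h \<partial>lines) = ennreal (2 / pi * \<bar>h\<bar>) * cov p h"
proof -
  have "(\<integral>\<^sup>+H. csep p H h \<partial>lines) = (\<integral>\<^sup>+u. \<integral>\<^sup>+H. gsep p H u h \<partial>lines \<partial>nu1)"
    unfolding csep_def by (rule lines_nu1.Fubini'[symmetric]) simp
  also have "\<dots> = (\<integral>\<^sup>+u. ennreal (2 / pi * \<bar>h\<bar>) * gcov p u h \<partial>nu1)"
    using AE_nu1_unit by (intro nn_integral_cong_AE) (auto elim!: eventually_mono simp: nn_integral_gsep)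
  also have "\<dots> = ennreal (2 / pi * \<bar>h\<bar>) * cov p h"
    unfolding cov_def by (rule nn_integral_cmult) simp
  finally show ?thesis .
qed

lemma nn_integral_cov: "(\<integral>\<^sup>+h. cov p h \<partial>lborel) = (\<integral>\<^sup>+H. ennreal (ell p H)^2 \<partial>lines)"
proof -
  have "(\<integral>\<^sup>+h. cov p h \<partial>lborel) = (\<integral>\<^sup>+u. \<integral>\<^sup>+h. gcov p u h \<partial>lborel \<partial>nu1)"
    unfolding cov_def by (rule nu1_lborel.Fubini') simp
  also have "\<dots> = (\<integral>\<^sup>+u. \<integral>\<^sup>+r. ennreal (ell p (u, r))^2 \<partial>lborel \<partial>nu1)"
    using AE_nu1_unit by (intro nn_integral_cong_AE) (auto elim!: eventually_mono simp: nn_integral_gcov)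
  also have "\<dots> = (\<integral>\<^sup>+H. ennreal (ell p H)^2 \<partial>lines)"
    using hit_imp_abs_le ell_eq_0 by (intro nn_integral_lines_unrestricted[symmetric]) fastforce+
  finally show ?thesis .
qed

end

subsection \<open>The variance functional\<close>

definition decay :: "real \<Rightarrow> real \<Rightarrow> real" where
  "decay t h = exp (- (2 / pi * \<bar>h\<bar> * t))"

text \<open>Closed form of the integral of \<open>decay\<close> over the times from 0 to
  \<open>t\<close>, the function F_t of the overview. The value at \<open>h = 0\<close> is set
  separately because the quotient would be 0 there.\<close>

definition idecay :: "real \<Rightarrow> real \<Rightarrow> real" where
  "idecay t h = (if h = 0 then t else (1 - exp (- (2 / pi * \<bar>h\<bar> * t))) / (2 / pi * \<bar>h\<bar>))"

lemma measurable_decay [measurable (raw)]: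
  assumes [measurable]: "f \<in> borel_measurable M" "g \<in> borel_measurable M"
  shows "(\<lambda>z. decay (f z) (g z)) \<in> borel_measurable M"
  unfolding decay_def by measurable

lemma measurable_idecay [measurable (raw)]:
  assumes [measurable]: "f \<in> borel_measurable M" "g \<in> borel_measurable M"
  shows "(\<lambda>z. idecay (f z) (g z)) \<in> borel_measurable M"
  unfolding idecay_def by measurable

lemma decay_bounds: "0 < decay t h" "0 \<le> t \<Longrightarrow> decay t h \<le> 1"
  by (auto simp: decay_def)

text \<open>As \<open>decay\<close> is the time derivative of \<open>idecay\<close>, this is a
  linear differential equation for F_t. It yields both the first-split equation of \<open>V\<close>
  and the bound pi / 2 for |h| F_t(h).\<close>

lemma idecay_mult: "2 / pi * \<bar>h\<bar> * idecay t h = 1 - decay t h"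
  by (simp add: idecay_def decay_def)

lemma idecay_nonneg: "0 \<le> t \<Longrightarrow> 0 \<le> idecay t h"
  by (auto simp: idecay_def intro!: divide_nonneg_pos)

lemma idecay_0 [simp]: "idecay 0 h = 0"
  by (simp add: idecay_def)

lemma idecay_deriv: "((\<lambda>t. idecay t h) has_real_derivative decay t h) (at t within S)"
proof (cases "h = 0")
  case True
  then show ?thesis by (simp add: idecay_def decay_def)
next
  case False
  then have "2 / pi * \<bar>h\<bar> \<noteq> 0" by simp
  then have "((\<lambda>t. (1 - exp (- (2 / pi * \<bar>h\<bar> * t))) / (2 / pi * \<bar>h\<bar>)) has_real_derivative decay t h) (at t within S)"
    unfolding decay_def by (auto intro!: derivative_eq_intros)
  then show ?thesis using False by (simp add: idecay_def)
qed

lemma decay_lipschitz: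
  assumes "0 \<le> s" "0 \<le> t"
  shows "\<bar>decay s h - decay t h\<bar> \<le> \<bar>h\<bar> * \<bar>s - t\<bar>"
proof -
  have *: "decay s h - decay t h \<le> \<bar>h\<bar> * (t - s)" if "0 \<le> s" "s \<le> t" for s t
  proof -
    define k where "k = 2 / pi * \<bar>h\<bar>"
    have "2 / pi \<le> 1" using pi_gt3 by simp
    from mult_right_mono[OF this, of "\<bar>h\<bar>"] have k: "0 \<le> k" "k \<le> \<bar>h\<bar>"
      by (simp_all add: k_def)
    have "1 - exp (- (k * (t - s))) \<le> k * (t - s)"
      using exp_ge_add_one_self[of "- (k * (t - s))"] by simp
    also have "\<dots> \<le> \<bar>h\<bar> * (t - s)" using k that by (intro mult_right_mono) auto
    finally have 1: "1 - exp (- (k * (t - s))) \<le> \<bar>h\<bar> * (t - s)" .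
    have d: "decay x h = exp (- (k * x))" for x by (simp add: decay_def k_def)
    have "decay s h - decay t h = exp (- (k * s)) * (1 - exp (- (k * (t - s))))"
      by (simp add: d right_diff_distrib exp_add[symmetric])
    also have "\<dots> \<le> 1 * (1 - exp (- (k * (t - s))))"
      using k that by (intro mult_right_mono) auto
    finally show ?thesis using 1 by simp
  qed
  have **: "decay t h \<le> decay s h" if "s \<le> t" for s t
    using mult_left_mono[OF that, of "2 / pi * \<bar>h\<bar>"] by (simp add: decay_def)
  show ?thesis
    using *[of s t] *[of t s] **[of s t] **[of t s] assms by (cases "s \<le> t") auto
qed

lemma idecay_le: "0 \<le> t \<Longrightarrow> idecay t h \<le> t"
proof -
  assume t: "0 \<le> t"
  have "((\<lambda>t. t - idecay t h) has_real_derivative 1 - decay s h) (at s)" for s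
    by (auto intro!: derivative_eq_intros idecay_deriv)
  then have "0 - idecay 0 h \<le> t - idecay t h"
    using t decay_bounds(2)
    by (intro DERIV_nonneg_imp_nondecreasing[of 0 t "\<lambda>t. t - idecay t h"]) (auto intro!: exI[of _ "1 - decay _ h"])
  then show ?thesis by simp
qed

text \<open>Mean value theorem and the Lipschitz bound of the derivative. A quadratic remainder that
  is uniform for bounded |h| is what allows \<open>V\<close> to be differentiated under the
  integral.\<close>

lemma idecay_taylor:
  assumes "0 \<le> s" "0 \<le> t"
  shows "\<bar>idecay s h - idecay t h - (s - t) * decay t h\<bar> \<le> \<bar>h\<bar> * (s - t)^2"
proof (cases "s = t")
  case False
  have "\<exists>z. z > min s t \<and> z < max s t \<and> idecay (max s t) h - idecay (min s t) h = (max s t - min s t) * decay z h"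
    using False by (intro MVT2 idecay_deriv) auto
  then obtain z where z: "min s t < z" "z < max s t"
    "idecay (max s t) h - idecay (min s t) h = (max s t - min s t) * decay z h" by blast
  have "idecay s h - idecay t h = (s - t) * decay z h"
    using z(3) by (auto simp: max_def min_def algebra_simps split: if_splits)
  then have "\<bar>idecay s h - idecay t h - (s - t) * decay t h\<bar> = \<bar>s - t\<bar> * \<bar>decay z h - decay t h\<bar>"
    by (simp add: abs_mult[symmetric] algebra_simps)
  also have "\<dots> \<le> \<bar>s - t\<bar> * (\<bar>h\<bar> * \<bar>z - t\<bar>)"
    using z assms by (intro mult_left_mono decay_lipschitz) auto
  also have "\<dots> \<le> \<bar>s - t\<bar> * (\<bar>h\<bar> * \<bar>s - t\<bar>)"
    using z by (intro mult_left_mono) (auto simp: max_def min_def split: if_splits)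
  also have "\<dots> = \<bar>h\<bar> * (s - t)^2" by (metis abs_mult_self_eq mult.left_commute power2_eq_square)
  finally show ?thesis .
qed simp

lemma has_vector_derivative_quadratic:
  fixes f :: "real \<Rightarrow> real"
  assumes "\<And>s. s \<in> S \<Longrightarrow> \<bar>f s - f t - (s - t) * D\<bar> \<le> B * (s - t)^2"
  shows "(f has_real_derivative D) (at t within S)"
proof -
  have "((\<lambda>s. (f s - f t) / (s - t) - D) \<longlongrightarrow> 0) (at t within S)"
  proof (rule Lim_null_comparison)
    show "eventually (\<lambda>s. norm ((f s - f t) / (s - t) - D) \<le> B * \<bar>s - t\<bar>) (at t within S)"
      unfolding eventually_at_filter
    proof (rule always_eventually, intro allI impI)
      fix s assume s: "s \<noteq> t" "s \<in> S"
      have "(f s - f t) / (s - t) - D = (f s - f t - (s - t) * D) / (s - t)"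
        using s by (simp add: diff_divide_distrib)
      then have "\<bar>(f s - f t) / (s - t) - D\<bar> = \<bar>f s - f t - (s - t) * D\<bar> / \<bar>s - t\<bar>"
        by (simp only: abs_divide)
      also have "\<dots> \<le> B * (s - t)^2 / \<bar>s - t\<bar>"
        using assms[OF s(2)] by (intro divide_right_mono) auto
      also have "\<dots> = B * \<bar>s - t\<bar>"
      proof -
        have "(s - t)^2 = \<bar>s - t\<bar> * \<bar>s - t\<bar>" by (simp add: power2_eq_square)
        then show ?thesis using s by (simp del: abs_mult_self_eq)
      qed
      finally show "norm ((f s - f t) / (s - t) - D) \<le> B * \<bar>s - t\<bar>" by simp
    qed
    have "((\<lambda>s. B * \<bar>s - t\<bar>) \<longlongrightarrow> B * \<bar>t - t\<bar>) (at t within S)"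
      by (intro tendsto_intros)
    then show "((\<lambda>s. B * \<bar>s - t\<bar>) \<longlongrightarrow> 0) (at t within S)" by simp
  qed
  then have "((\<lambda>s. (f s - f t) / (s - t)) \<longlongrightarrow> D) (at t within S)"
    by (simp add: LIM_zero_iff)
  then show ?thesis by (simp add: has_field_derivative_iff)
qed

lemma integral_abs_bound_AE:
  fixes f g :: "'a \<Rightarrow> real"
  assumes "integrable M f" "integrable M g" "AE x in M. \<bar>f x\<bar> \<le> g x"
  shows "\<bar>\<integral>x. f x \<partial>M\<bar> \<le> (\<integral>x. g x \<partial>M)"
proof -
  have "\<bar>\<integral>x. f x \<partial>M\<bar> \<le> (\<integral>x. \<bar>f x\<bar> \<partial>M)" by (rule integral_abs_bound)
  also have "\<dots> \<le> (\<integral>x. g x \<partial>M)" using assms by (intro integral_mono_AE) auto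
  finally show ?thesis .
qed

text \<open>The integrand is the derivative of \<open>- exp (- s \<beta>) * y (t - s)\<close> in
  \<open>s\<close>. The formula rewrites \<open>y\<close> as a solution of an integral equation with
  the exponential weight of a cell's survival.\<close>

lemma variation_of_constants:
  fixes y :: "real \<Rightarrow> 'a::{real_normed_field, euclidean_space}"
  assumes "0 \<le> t"
    and y: "\<And>s. s \<in> {0..t} \<Longrightarrow> (y has_vector_derivative y' s) (at s within {0..t})"
    and y': "continuous_on {0..t} y'"
  shows "(\<integral>s. indicator {0..t} s *\<^sub>R (exp (- (of_real s * \<beta>)) * (\<beta> * y (t - s) + y' (t - s))) \<partial>lborel) =
      y t - exp (- (of_real t * \<beta>)) * y 0"
proof -
  have cy: "continuous_on {0..t} y"
    unfolding continuous_on_eq_continuous_within using has_vector_derivative_continuous[OF y] by blast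
  have maps: "(\<lambda>s. t - s) ` {0..t} \<subseteq> {0..t}" by auto
  have e: "((\<lambda>s. exp (- (of_real s * \<beta>))) has_vector_derivative - \<beta> * exp (- (of_real s * \<beta>))) (at s within S)" for s S
  proof -
    have "((\<lambda>z. exp (- (z * \<beta>))) has_field_derivative - \<beta> * exp (- (of_real s * \<beta>))) (at (of_real s))"
      by (auto intro!: derivative_eq_intros)
    then have "((\<lambda>z. exp (- (z * \<beta>))) \<circ> of_real has_vector_derivative 1 * (- \<beta> * exp (- (of_real s * \<beta>)))) (at s within S)"
      by (intro field_vector_diff_chain_within)
         (auto intro: has_field_derivative_at_within has_vector_derivative_of_real derivative_eq_intros)
    then show ?thesis by (simp add: o_def)
  qed
  have ys: "((\<lambda>s. y (t - s)) has_vector_derivative - y' (t - s)) (at s within {0..t})" if "s \<in> {0..t}" for s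
  proof -
    have "(y has_vector_derivative y' (t - s)) (at (t - s) within (\<lambda>s. t - s) ` {0..t})"
      using that by (intro has_vector_derivative_within_subset[OF y maps]) auto
    moreover have "((\<lambda>s. t - s) has_vector_derivative -1) (at s within {0..t})"
      by (auto intro!: derivative_eq_intros)
    ultimately have "(y \<circ> (\<lambda>s. t - s) has_vector_derivative (-1) *\<^sub>R y' (t - s)) (at s within {0..t})"
      by (intro vector_diff_chain_within)
    then show ?thesis by (simp add: o_def)
  qed
  have "(\<integral>s. indicator {0..t} s *\<^sub>R (exp (- (of_real s * \<beta>)) * (\<beta> * y (t - s) + y' (t - s))) \<partial>lborel) =
     (- (exp (- (of_real t * \<beta>)) * y (t - t))) - (- (exp (- (of_real 0 * \<beta>)) * y (t - 0)))"
  proof (rule integral_FTC_Icc[OF assms(1)])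
    fix s assume "0 \<le> s" "s \<le> t"
    then have s: "s \<in> {0..t}" by simp
    have "((\<lambda>s. - (exp (- (of_real s * \<beta>)) * y (t - s))) has_vector_derivative
      - (exp (- (of_real s * \<beta>)) * (- y' (t - s)) + (- \<beta> * exp (- (of_real s * \<beta>))) * y (t - s))) (at s within {0..t})"
      by (intro has_vector_derivative_minus has_vector_derivative_mult e ys s)
    then show "((\<lambda>s. - (exp (- (of_real s * \<beta>)) * y (t - s))) has_vector_derivative
        exp (- (of_real s * \<beta>)) * (\<beta> * y (t - s) + y' (t - s))) (at s within {0..t})"
      by (simp add: algebra_simps)
  next
    show "continuous_on {0..t} (\<lambda>s. exp (- (of_real s * \<beta>)) * (\<beta> * y (t - s) + y' (t - s)))"
      by (intro continuous_intros continuous_on_compose2[OF cy _ maps] continuous_on_compose2[OF y' _ maps])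
  qed
  then show ?thesis by simp
qed

context convex_window
begin

definition V :: "real \<Rightarrow> (nat \<Rightarrow> hplane) \<Rightarrow> real" where
  "V t p = enn2real (\<integral>\<^sup>+h. ennreal (idecay t h) * cov p h \<partial>lborel)"

text \<open>Time derivative of \<open>V\<close>, proved to be so in \<open>V_deriv\<close>.\<close>

definition V' :: "real \<Rightarrow> (nat \<Rightarrow> hplane) \<Rightarrow> real" where
  "V' t p = enn2real (\<integral>\<^sup>+h. ennreal (decay t h) * cov p h \<partial>lborel)"

text \<open>Amount by which \<open>V\<close> drops when the cell is split by \<open>H\<close>; see
  \<open>V_split\<close>.\<close>

definition Vsep :: "real \<Rightarrow> (nat \<Rightarrow> hplane) \<Rightarrow> hplane \<Rightarrow> real" where
  "Vsep t p H = enn2real (\<integral>\<^sup>+h. ennreal (idecay t h) * csep p H h \<partial>lborel)"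

lemma measurable_Vsep [measurable (raw)]:
  assumes [measurable]: "f \<in> borel_measurable M" "g \<in> borel_measurable M" "k \<in> borel_measurable M"
  shows "(\<lambda>z. Vsep (f z) (g z) (k z)) \<in> borel_measurable M"
  unfolding Vsep_def by measurable

lemma V_nonneg [simp]: "0 \<le> V t p" by (simp add: V_def)
lemma V'_nonneg [simp]: "0 \<le> V' t p" by (simp add: V'_def)
lemma Vsep_nonneg [simp]: "0 \<le> Vsep t p H" by (simp add: Vsep_def)

lemma V_0 [simp]: "V 0 p = 0" by (simp add: V_def)

lemma finite_ell2: "(\<integral>\<^sup>+H. ennreal (ell p H)^2 \<partial>lines) < \<infinity>"
proof -
  have "(\<integral>\<^sup>+H. ennreal (ell p H)^2 \<partial>lines) \<le> (\<integral>\<^sup>+H. ennreal ((2*\<rho>)^2) \<partial>lines)"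
  proof (rule nn_integral_mono_AE)
    show "AE H in lines. ennreal (ell p H)^2 \<le> ennreal ((2*\<rho>)^2)"
      using AE_lines_unit
    proof eventually_elim
      case (elim H)
      from power_mono[OF emeasure_chord(2)[OF elim, of p] ell_nonneg, of 2]
      show ?case by (subst ennreal_power) (auto intro!: ennreal_leI)
    qed
  qed
  also have "\<dots> = ennreal ((2*\<rho>)^2 * measure lines (space lines))"
    by (simp add: lines.emeasure_eq_measure ennreal_mult)
  also have "\<dots> < \<infinity>" by simp
  finally show ?thesis .
qed

text \<open>With \<open>cov p\<close> as the density of a finite measure, \<open>V\<close> and
  \<open>V'\<close> become Bochner integrals, for which linearity and absolute bounds are at
  hand.\<close>

definition covm :: "(nat \<Rightarrow> hplane) \<Rightarrow> real measure" where
  "covm p = density lborel (cov p)"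

lemma sets_covm [simp, measurable_cong]: "sets (covm p) = sets borel" by (simp add: covm_def)
lemma space_covm [simp]: "space (covm p) = UNIV" by (simp add: covm_def)

lemma emeasure_covm: "emeasure (covm p) UNIV = (\<integral>\<^sup>+h. cov p h \<partial>lborel)"
  by (simp add: covm_def emeasure_density)

lemma finite_measure_covm: "finite_measure (covm p)"
proof
  show "emeasure (covm p) (space (covm p)) \<noteq> \<infinity>"
    unfolding space_covm emeasure_covm nn_integral_cov using finite_ell2[of p] by (rule less_imp_neq)
qed

lemma AE_covm: "AE h in covm p. \<bar>h\<bar> \<le> 2 * \<rho>"
proof -
  have "cov p h = 0" if "\<not> \<bar>h\<bar> \<le> 2 * \<rho>" for h
    using that by (intro cov_eq_0) auto
  then have "AE h in lborel. 0 < cov p h \<longrightarrow> \<bar>h\<bar> \<le> 2 * \<rho>"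
    by (intro AE_I2) (metis less_irrefl)
  then show ?thesis unfolding covm_def by (subst AE_density) auto
qed

lemma nn_integral_covm:
  assumes [measurable]: "f \<in> borel_measurable borel" and f: "\<And>h. 0 \<le> f h" "\<And>h. f h \<le> B"
  shows "(\<integral>\<^sup>+h. ennreal (f h) * cov p h \<partial>lborel) = ennreal (\<integral>h. f h \<partial>covm p)" "integrable (covm p) f"
proof -
  interpret C: finite_measure "covm p" by (rule finite_measure_covm)
  show I: "integrable (covm p) f"
    using f by (intro C.integrable_const_bound[of _ B]) auto
  have "(\<integral>\<^sup>+h. ennreal (f h) * cov p h \<partial>lborel) = (\<integral>\<^sup>+h. ennreal (f h) \<partial>covm p)"
    unfolding covm_def by (subst nn_integral_density) (auto simp: mult.commute)
  also have "\<dots> = ennreal (\<integral>h. f h \<partial>covm p)"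
    using I f by (intro nn_integral_eq_integral) auto
  finally show "(\<integral>\<^sup>+h. ennreal (f h) * cov p h \<partial>lborel) = ennreal (\<integral>h. f h \<partial>covm p)" .
qed

lemma V_covm:
  assumes "0 \<le> t"
  shows "ennreal (V t p) = (\<integral>\<^sup>+h. ennreal (idecay t h) * cov p h \<partial>lborel)"
    "V t p = (\<integral>h. idecay t h \<partial>covm p)" "integrable (covm p) (idecay t)"
proof -
  have *: "(\<integral>\<^sup>+h. ennreal (idecay t h) * cov p h \<partial>lborel) = ennreal (\<integral>h. idecay t h \<partial>covm p)"
    "integrable (covm p) (idecay t)"
    using assms by (intro nn_integral_covm[where B=t] idecay_nonneg idecay_le; measurable)+
  then show "integrable (covm p) (idecay t)" by simp
  show "V t p = (\<integral>h. idecay t h \<partial>covm p)"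
    unfolding V_def * using assms by (simp add: integral_nonneg_AE idecay_nonneg)
  then show "ennreal (V t p) = (\<integral>\<^sup>+h. ennreal (idecay t h) * cov p h \<partial>lborel)"
    by (simp add: *)
qed

lemma V'_covm:
  assumes "0 \<le> t"
  shows "ennreal (V' t p) = (\<integral>\<^sup>+h. ennreal (decay t h) * cov p h \<partial>lborel)"
    "V' t p = (\<integral>h. decay t h \<partial>covm p)" "integrable (covm p) (decay t)"
proof -
  have *: "(\<integral>\<^sup>+h. ennreal (decay t h) * cov p h \<partial>lborel) = ennreal (\<integral>h. decay t h \<partial>covm p)"
    "integrable (covm p) (decay t)"
    using assms by (intro nn_integral_covm[where B=1] decay_bounds less_imp_le[OF decay_bounds(1)]; measurable)+
  then show "integrable (covm p) (decay t)" by simp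
  show "V' t p = (\<integral>h. decay t h \<partial>covm p)"
    unfolding V'_def * using assms by (simp add: integral_nonneg_AE less_imp_le[OF decay_bounds(1)])
  then show "ennreal (V' t p) = (\<integral>\<^sup>+h. ennreal (decay t h) * cov p h \<partial>lborel)"
    by (simp add: *)
qed

text \<open>The Taylor remainder of \<open>idecay\<close> is at most |h| \<open>(s - t)^2\<close>,
  and |h| is at most \<open>2 * \<rho>\<close> almost everywhere for \<open>covm p\<close>, so the
  remainder of \<open>V\<close> is quadratic as well.\<close>

lemma V_deriv:
  assumes "t \<in> {0..T}"
  shows "((\<lambda>t. V t p) has_real_derivative V' t p) (at t within {0..T})"
proof (rule has_vector_derivative_quadratic)
  interpret C: finite_measure "covm p" by (rule finite_measure_covm)
  fix s assume s: "s \<in> {0..T}"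
  have "V s p - V t p - (s - t) * V' t p = (\<integral>h. idecay s h - idecay t h - (s - t) * decay t h \<partial>covm p)"
    using assms s by (simp add: V_covm V'_covm)
  also have "\<bar>\<dots>\<bar> \<le> (\<integral>h. 2 * \<rho> * (s - t)^2 \<partial>covm p)"
  proof (rule integral_abs_bound_AE)
    show "AE h in covm p. \<bar>idecay s h - idecay t h - (s - t) * decay t h\<bar> \<le> 2 * \<rho> * (s - t)^2"
      using AE_covm
    proof eventually_elim
      case (elim h)
      have "\<bar>idecay s h - idecay t h - (s - t) * decay t h\<bar> \<le> \<bar>h\<bar> * (s - t)^2"
        using assms s by (intro idecay_taylor) auto
      also have "\<dots> \<le> 2 * \<rho> * (s - t)^2" using elim by (intro mult_right_mono) auto
      finally show ?case .
    qed
  qed (use assms s V_covm V'_covm in auto)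
  finally show "\<bar>V s p - V t p - (s - t) * V' t p\<bar> \<le> (2 * \<rho> * measure (covm p) UNIV) * (s - t)^2"
    by (simp add: mult_ac)
qed

lemma V'_continuous: "continuous_on {0..T} (\<lambda>t. V' t p)"
proof -
  interpret C: finite_measure "covm p" by (rule finite_measure_covm)
  have "\<bar>V' s p - V' t p\<bar> \<le> (2 * \<rho> * measure (covm p) UNIV) * \<bar>s - t\<bar>" if "0 \<le> s" "0 \<le> t" for s t
  proof -
    have "V' s p - V' t p = (\<integral>h. decay s h - decay t h \<partial>covm p)"
      using that by (simp add: V'_covm)
    also have "\<bar>\<dots>\<bar> \<le> (\<integral>h. 2 * \<rho> * \<bar>s - t\<bar> \<partial>covm p)"
    proof (rule integral_abs_bound_AE)
      show "AE h in covm p. \<bar>decay s h - decay t h\<bar> \<le> 2 * \<rho> * \<bar>s - t\<bar>"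
        using AE_covm
      proof eventually_elim
        case (elim h)
        have "\<bar>decay s h - decay t h\<bar> \<le> \<bar>h\<bar> * \<bar>s - t\<bar>"
          using that by (intro decay_lipschitz) auto
        also have "\<dots> \<le> 2 * \<rho> * \<bar>s - t\<bar>" using elim by (intro mult_right_mono) auto
        finally show ?case .
      qed
    qed (use that V'_covm in auto)
    finally show ?thesis by (simp add: mult_ac)
  qed
  then have "(2 * \<rho> * measure (covm p) UNIV)-lipschitz_on {0..T} (\<lambda>t. V' t p)"
    using rho_pos by (intro lipschitz_onI) (auto simp: dist_real_def)
  then show ?thesis by (rule lipschitz_on_continuous_on)
qed

text \<open>Here the logarithm disappears: \<open>csep\<close> is at most |h| times the chord, and
  |h| \<open>idecay t h\<close> is at most pi / 2 for every \<open>t\<close>. What remains is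
  constant in \<open>h\<close> on an interval of length \<open>4 * \<rho>\<close>, and pi / 2 times
  this length gives the constant.\<close>

lemma nn_integral_Vsep_finite:
  assumes "0 \<le> t" "norm (fst H) = 1"
  shows "(\<integral>\<^sup>+h. ennreal (idecay t h) * csep p H h \<partial>lborel) \<le> ennreal (2 * pi * \<rho> * ell p H)"
proof -
  have "(\<integral>\<^sup>+h. ennreal (idecay t h) * csep p H h \<partial>lborel) \<le>
      (\<integral>\<^sup>+h. ennreal (pi / 2 * ell p H) * indicator {-2*\<rho>..2*\<rho>} h \<partial>lborel)"
  proof (rule nn_integral_mono)
    fix h
    show "ennreal (idecay t h) * csep p H h \<le> ennreal (pi / 2 * ell p H) * indicator {-2*\<rho>..2*\<rho>} h"
    proof (cases "2 * \<rho> < \<bar>h\<bar>")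
      case True
      then have "csep p H h = 0" using cov_eq_0[OF True, of p] csep_le_cov[of p H h] by simp
      then show ?thesis by simp
    next
      case False
      have "\<bar>h\<bar> * idecay t h \<le> pi / 2"
        using idecay_mult[of h t] mult_pos_pos[OF pi_gt_zero decay_bounds(1)[of t h]] by (simp add: field_simps)
      then have "idecay t h * (\<bar>h\<bar> * ell p H) \<le> pi / 2 * ell p H"
        using mult_right_mono[of "\<bar>h\<bar> * idecay t h" "pi/2" "ell p H"] by (simp add: mult_ac)
      then have "ennreal (idecay t h) * ennreal (\<bar>h\<bar> * ell p H) \<le> ennreal (pi / 2 * ell p H)"
        using assms by (simp add: ennreal_mult[symmetric] idecay_nonneg ennreal_leI)
      moreover have "ennreal (idecay t h) * csep p H h \<le> ennreal (idecay t h) * ennreal (\<bar>h\<bar> * ell p H)"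
        by (intro mult_left_mono csep_le_ell assms) auto
      ultimately show ?thesis using False by (auto simp: indicator_def abs_le_iff intro: order_trans)
    qed
  qed
  also have "\<dots> = ennreal (pi / 2 * ell p H) * ennreal (4 * \<rho>)"
    using rho_pos by (subst nn_integral_cmult) auto
  also have "\<dots> = ennreal (2 * pi * \<rho> * ell p H)"
    using rho_pos by (subst ennreal_mult[symmetric]) (auto simp: mult_ac)
  finally show ?thesis .
qed

lemma Vsep_ennreal:
  assumes "0 \<le> t" "norm (fst H) = 1"
  shows "ennreal (Vsep t p H) = (\<integral>\<^sup>+h. ennreal (idecay t h) * csep p H h \<partial>lborel)"
    "Vsep t p H \<le> 2 * pi * \<rho> * ell p H"
proof -
  have "(\<integral>\<^sup>+h. ennreal (idecay t h) * csep p H h \<partial>lborel) < \<top>"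
    using nn_integral_Vsep_finite[OF assms, of p] ennreal_less_top by (rule le_less_trans)
  then show 1: "ennreal (Vsep t p H) = (\<integral>\<^sup>+h. ennreal (idecay t h) * csep p H h \<partial>lborel)"
    unfolding Vsep_def by simp
  have "0 \<le> 2 * pi * \<rho> * ell p H" using rho_pos by simp
  then show "Vsep t p H \<le> 2 * pi * \<rho> * ell p H"
    using nn_integral_Vsep_finite[OF assms, of p] unfolding 1[symmetric] by (simp add: ennreal_le_iff)
qed

lemma V_split:
  assumes "0 \<le> t" "norm (fst H) = 1"
  shows "V t p = V t (child False H p) + V t (child True H p) + Vsep t p H"
proof -
  have "ennreal (V t p) = (\<integral>\<^sup>+h. ennreal (idecay t h) * cov (child False H p) h +
      ennreal (idecay t h) * cov (child True H p) h + ennreal (idecay t h) * csep p H h \<partial>lborel)"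
    unfolding V_covm(1)[OF assms(1)] by (subst cov_split[OF assms(2), of p]) (simp add: distrib_left)
  also have "\<dots> = ennreal (V t (child False H p)) + ennreal (V t (child True H p)) + ennreal (Vsep t p H)"
    unfolding V_covm(1)[OF assms(1)] Vsep_ennreal(1)[OF assms] by (simp add: nn_integral_add)
  also have "\<dots> = ennreal (V t (child False H p) + V t (child True H p) + Vsep t p H)"
    by simp
  finally show ?thesis by (subst (asm) ennreal_inj) auto
qed

lemma integrable_lines_bounded:
  fixes f :: "hplane \<Rightarrow> 'a::{banach, second_countable_topology}"
  assumes "f \<in> borel_measurable borel" "\<And>H. norm (fst H) = 1 \<Longrightarrow> norm (f H) \<le> B"
  shows "integrable lines f"
proof (rule lines.integrable_const_bound)
  show "AE H in lines. norm (f H) \<le> B" using AE_lines_unit by eventually_elim (rule assms(2))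
  show "f \<in> borel_measurable lines" unfolding measurable_cong_sets[OF sets_lines refl] by fact
qed

lemma integrable_ell: "integrable lines (ell p)" "integrable lines (\<lambda>H. ell p H ^ 2)"
proof -
  show "integrable lines (ell p)"
    using emeasure_chord(2) by (intro integrable_lines_bounded[where B="2 * \<rho>"]) auto
  show "integrable lines (\<lambda>H. ell p H ^ 2)"
  proof (rule integrable_lines_bounded[where B="(2 * \<rho>)^2"])
    fix H :: hplane assume "norm (fst H) = 1"
    from power_mono[OF emeasure_chord(2)[OF this, of p] ell_nonneg, of 2]
    show "norm (ell p H ^ 2) \<le> (2 * \<rho>)^2" by simp
  qed measurable
qed

lemma integrable_Vsep: "0 \<le> t \<Longrightarrow> integrable lines (Vsep t p)"
proof (rule integrable_lines_bounded[where B="2 * pi * \<rho> * (2 * \<rho>)"])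
  fix H :: hplane assume t: "0 \<le> t" and "norm (fst H) = 1"
  then have "Vsep t p H \<le> 2 * pi * \<rho> * ell p H" "ell p H \<le> 2 * \<rho>"
    using Vsep_ennreal(2) emeasure_chord(2) by auto
  moreover have "2 * pi * \<rho> * ell p H \<le> 2 * pi * \<rho> * (2 * \<rho>)"
    using rho_pos calculation(2) by (intro mult_left_mono) auto
  ultimately have "Vsep t p H \<le> 2 * pi * \<rho> * (2 * \<rho>)" by (meson order_trans)
  then show "norm (Vsep t p H) \<le> 2 * pi * \<rho> * (2 * \<rho>)" by (simp only: real_norm_def abs_of_nonneg[OF Vsep_nonneg])
qed measurable

lemma integral_ell: "(\<integral>H. ell p H \<partial>lines) = area p"
  using nn_integral_eq_integral[OF integrable_ell(1), of p] nn_integral_ell[of p]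
  by (simp add: integral_nonneg_AE)

text \<open>Integrating \<open>csep\<close> over all lines produces the factor 2 / pi times |h|, so
  by \<open>idecay_mult\<close> the integral of \<open>Vsep\<close> is that of
  \<open>1 - decay t h\<close> against \<open>cov p\<close>. Added to \<open>V'\<close> this gives
  the total mass of \<open>cov p\<close>, which is the integral of the squared chord. Combined with
  \<open>V_split\<close> it is the first-split equation of \<open>V\<close>.\<close>

lemma V'_eq:
  assumes "0 \<le> t"
  shows "V' t p = (\<integral>H. ell p H ^ 2 - Vsep t p H \<partial>lines)"
proof -
  interpret P: pair_sigma_finite lines "lborel :: real measure" ..
  have "ennreal (\<integral>H. Vsep t p H \<partial>lines) = (\<integral>\<^sup>+H. ennreal (Vsep t p H) \<partial>lines)"
    by (intro nn_integral_eq_integral[symmetric] integrable_Vsep assms) simp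
  also have "\<dots> = (\<integral>\<^sup>+H. \<integral>\<^sup>+h. ennreal (idecay t h) * csep p H h \<partial>lborel \<partial>lines)"
    using AE_lines_unit assms by (intro nn_integral_cong_AE) (auto elim!: eventually_mono simp: Vsep_ennreal)
  also have "\<dots> = (\<integral>\<^sup>+h. \<integral>\<^sup>+H. ennreal (idecay t h) * csep p H h \<partial>lines \<partial>lborel)"
    by (rule P.Fubini'[symmetric]) simp
  also have "\<dots> = (\<integral>\<^sup>+h. ennreal (1 - decay t h) * cov p h \<partial>lborel)"
  proof (rule nn_integral_cong)
    fix h
    have "(\<integral>\<^sup>+H. ennreal (idecay t h) * csep p H h \<partial>lines) = ennreal (idecay t h) * (ennreal (2 / pi * \<bar>h\<bar>) * cov p h)"
      unfolding nn_integral_csep[symmetric]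
      using measurable_csep[of "\<lambda>_. p" borel "\<lambda>H. H" "\<lambda>_. h"]
      by (intro nn_integral_cmult) (simp add: measurable_cong_sets[OF sets_lines refl])
    also have "\<dots> = ennreal (1 - decay t h) * cov p h"
    proof -
      have "ennreal (1 - decay t h) = ennreal (2 / pi * \<bar>h\<bar>) * ennreal (idecay t h)"
        unfolding idecay_mult[symmetric] using assms by (intro ennreal_mult idecay_nonneg) auto
      then show ?thesis by (simp only: mult_ac)
    qed
    finally show "(\<integral>\<^sup>+H. ennreal (idecay t h) * csep p H h \<partial>lines) = ennreal (1 - decay t h) * cov p h" .
  qed
  finally have 1: "ennreal (\<integral>H. Vsep t p H \<partial>lines) = (\<integral>\<^sup>+h. ennreal (1 - decay t h) * cov p h \<partial>lborel)" .
  have "ennreal (V' t p) + ennreal (\<integral>H. Vsep t p H \<partial>lines) =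
    (\<integral>\<^sup>+h. ennreal (decay t h) * cov p h + ennreal (1 - decay t h) * cov p h \<partial>lborel)"
    unfolding 1 V'_covm(1)[OF assms] by (simp add: nn_integral_add)
  also have "\<dots> = (\<integral>\<^sup>+h. cov p h \<partial>lborel)"
    using assms decay_bounds less_imp_le[OF decay_bounds(1)]
    by (intro nn_integral_cong) (simp add: distrib_right[symmetric] ennreal_plus[symmetric] del: ennreal_plus)
  also have "\<dots> = (\<integral>\<^sup>+H. ennreal (ell p H ^ 2) \<partial>lines)"
    by (simp add: nn_integral_cov ennreal_power)
  also have "\<dots> = ennreal (\<integral>H. ell p H ^ 2 \<partial>lines)"
    by (intro nn_integral_eq_integral integrable_ell) simp
  finally have "ennreal (V' t p + (\<integral>H. Vsep t p H \<partial>lines)) = ennreal (\<integral>H. ell p H ^ 2 \<partial>lines)"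
    by (simp add: integral_nonneg_AE)
  then have "V' t p + (\<integral>H. Vsep t p H \<partial>lines) = (\<integral>H. ell p H ^ 2 \<partial>lines)"
    by (subst (asm) ennreal_inj) (auto intro!: add_nonneg_nonneg integral_nonneg_AE)
  then show ?thesis
    by (simp add: integrable_ell integrable_Vsep[OF assms])
qed

lemma area_split:
  assumes "norm (fst H) = 1"
  shows "area p = area (child False H p) + area (child True H p)"
proof -
  have n: "fst H \<noteq> 0" using assms by auto
  have e: "ennreal (area q) = (\<integral>\<^sup>+x. indicator (cell q) x \<partial>lborel)" for q
    by (simp add: emeasure_cell)
  have "ennreal (area p) = (\<integral>\<^sup>+x. indicator (cell (child False H p)) x + indicator (cell (child True H p)) x \<partial>lborel)"
    unfolding e
  proof (rule nn_integral_cong_AE)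
    show "AE x in lborel. indicator (cell p) x =
      (indicator (cell (child False H p)) x + indicator (cell (child True H p)) x :: ennreal)"
      using AE_not_in_hyperplane[OF n, of "snd H"]
      by eventually_elim (auto simp: indicator_def cell_child)
  qed
  also have "\<dots> = ennreal (area (child False H p)) + ennreal (area (child True H p))"
    unfolding e by (rule nn_integral_add) auto
  also have "\<dots> = ennreal (area (child False H p) + area (child True H p))" by simp
  finally show ?thesis by (subst (asm) ennreal_inj) auto
qed

end

subsection \<open>The splitting lines\<close>

definition proposal :: "(real \<times> real) measure" where
  "proposal = unif_angle \<Otimes>\<^sub>M uniform_measure lborel {-1..1::real}"

definition proposals :: "(nat \<Rightarrow> real \<times> real) measure" where
  "proposals = (\<Pi>\<^sub>M k\<in>(UNIV::nat set). proposal)"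

definition to_hplane :: "real \<Rightarrow> real \<times> real \<Rightarrow> hplane" where
  "to_hplane \<rho> x = (dirv (fst x), \<rho> * snd x)"

lemma node_measure_eq: "node_measure = density lborel (exponential_density 1) \<Otimes>\<^sub>M proposals"
  by (simp add: node_measure_def proposals_def proposal_def)

lemma prob_space_proposal: "prob_space proposal"
proof -
  interpret U: prob_space "uniform_measure lborel {-1..1::real}"
    by (rule prob_space_uniform_measure) auto
  interpret A: prob_space unif_angle by (rule prob_space_unif_angle)
  interpret AU: pair_prob_space unif_angle "uniform_measure lborel {-1..1::real}" ..
  show ?thesis unfolding proposal_def by (rule AU.P.prob_space_axioms)
qed

interpretation proposal: prob_space proposal by (rule prob_space_proposal)
interpretation proposals: sequence_space proposal ..

lemma prob_space_proposals: "prob_space proposals"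
  unfolding proposals_def by (rule prob_space_PiM) (rule prob_space_proposal)

lemma prob_space_node_measure: "prob_space node_measure"
proof -
  interpret E: prob_space "density lborel (exponential_density 1)"
    by (rule prob_space_exponential_density) simp
  interpret Q: prob_space proposals by (rule prob_space_proposals)
  interpret EP: pair_prob_space "density lborel (exponential_density 1)" proposals ..
  show ?thesis unfolding node_measure_eq by (rule EP.P.prob_space_axioms)
qed

lemma sets_proposal [measurable_cong]: "sets proposal = sets (borel \<Otimes>\<^sub>M borel)"
  unfolding proposal_def by (intro sets_pair_measure_cong) auto

lemma space_proposal [simp]: "space proposal = UNIV"
  by (simp add: proposal_def space_pair_measure unif_angle_def)

lemma space_proposals [simp]: "space proposals = UNIV"
  by (simp add: proposals_def space_PiM)

lemma space_node_measure [simp]: "space node_measure = UNIV"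
  by (simp add: node_measure_eq space_pair_measure)

lemma space_Omega [simp]: "space Omega = UNIV"
  by (simp add: Omega_def space_PiM)

lemma measurable_to_hplane [measurable]: "to_hplane r \<in> borel_measurable proposal"
proof -
  have "to_hplane r \<in> borel_measurable borel"
    unfolding to_hplane_def
    by (intro borel_measurable_continuous_onI continuous_intros
        continuous_on_compose2[OF continuous_dirv]) auto
  then show ?thesis
    unfolding measurable_cong_sets[OF sets_proposal refl] borel_prod .
qed

lemma measurable_proposals_nth [measurable]: "(\<lambda>\<omega>. \<omega> k) \<in> measurable proposals proposal"
  unfolding proposals_def by measurable

lemma exponential_scale:
  assumes "0 < l"
  shows "distr (density lborel (exponential_density 1)) borel (\<lambda>x. x / l) = density lborel (exponential_density l)"
proof -
  have "distributed (density lborel (exponential_density 1)) lborel (\<lambda>x. x / l) (exponential_density l)"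
  proof -
    interpret E: prob_space "density lborel (exponential_density 1)"
      by (rule prob_space_exponential_density) simp
    have "distributed (density lborel (exponential_density 1)) lborel (\<lambda>x. x) (exponential_density 1)"
      by (auto simp: distributed_def distr_id2)
    moreover have "ennreal \<bar>1 / l\<bar> * exponential_density l (x * (1 / l) + 0) = exponential_density 1 x" for x
    proof (cases "x < 0")
      case True
      then have "x * (1 / l) + 0 < 0" using assms by (simp add: divide_neg_pos)
      with True show ?thesis unfolding exponential_density_def by simp
    next
      case False
      then have "\<not> x * (1 / l) + 0 < 0" using assms by (simp add: not_less)
      with False show ?thesis using assms unfolding exponential_density_def
        by (simp add: ennreal_mult[symmetric])
    qed
    moreover have "(x / l - 0) / (1 / l) = x" for x using assms by simp
    ultimately have "distributed (density lborel (exponential_density 1)) lborel (\<lambda>x. (x / l - 0) / (1 / l))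
       (\<lambda>x. ennreal \<bar>1 / l\<bar> * exponential_density l (x * (1 / l) + 0))"
      by (simp only:)
    then show ?thesis
      by (rule E.distributed_affineI) (use assms in auto)
  qed
  then show ?thesis by (auto simp: distributed_def cong: distr_cong)
qed

context convex_window
begin

definition draw :: "(nat \<Rightarrow> hplane) \<Rightarrow> (nat \<Rightarrow> real \<times> real) \<Rightarrow> hplane" where
  "draw p s = split_line \<rho> (cell p) s"

lemma draw_eq: "draw p s = (if \<exists>k. hit p (to_hplane \<rho> (s k))
   then to_hplane \<rho> (s (LEAST k. hit p (to_hplane \<rho> (s k)))) else (dirv 0, 0))"
  by (simp add: draw_def split_line_def hit_iff to_hplane_def Let_def)

lemma norm_fst_draw [simp]: "norm (fst (draw p s)) = 1"
  by (simp add: draw_eq to_hplane_def)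

text \<open>Rejection sampling restarts: after a miss the draw is that of the remaining sequence. If
  nothing ever hits, both sides are the default line.\<close>

lemma draw_case_nat:
  "draw p (case_nat x s) = (if hit p (to_hplane \<rho> x) then to_hplane \<rho> x else draw p s)"
proof (cases "hit p (to_hplane \<rho> x)")
  case True
  have "(LEAST k. hit p (to_hplane \<rho> (case_nat x s k))) = 0"
    by (rule Least_eq_0) (simp add: True)
  moreover have "\<exists>k. hit p (to_hplane \<rho> (case_nat x s k))" by (rule exI[of _ 0]) (simp add: True)
  ultimately show ?thesis using True by (simp add: draw_eq)
next
  case False
  have ex: "(\<exists>k. hit p (to_hplane \<rho> (case_nat x s k))) \<longleftrightarrow> (\<exists>k. hit p (to_hplane \<rho> (s k)))"
  proof
    assume "\<exists>k. hit p (to_hplane \<rho> (case_nat x s k))"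
    then obtain k where "hit p (to_hplane \<rho> (case_nat x s k))" ..
    then show "\<exists>k. hit p (to_hplane \<rho> (s k))" using False by (cases k) auto
  next
    assume "\<exists>k. hit p (to_hplane \<rho> (s k))"
    then obtain k where "hit p (to_hplane \<rho> (s k))" ..
    then show "\<exists>k. hit p (to_hplane \<rho> (case_nat x s k))" by (intro exI[of _ "Suc k"]) simp
  qed
  show ?thesis
  proof (cases "\<exists>k. hit p (to_hplane \<rho> (s k))")
    case h: True
    then obtain k where "hit p (to_hplane \<rho> (case_nat x s (Suc k)))" by auto
    then have "(LEAST k. hit p (to_hplane \<rho> (case_nat x s k))) = Suc (LEAST k. hit p (to_hplane \<rho> (case_nat x s (Suc k))))"
      by (rule Least_Suc) (simp add: False)
    then show ?thesis using False h ex by (simp add: draw_eq)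
  qed (use False ex in \<open>simp add: draw_eq\<close>)
qed

lemma measurable_draw [measurable (raw)]:
  assumes [measurable]: "f \<in> borel_measurable M" "g \<in> measurable M proposals"
  shows "(\<lambda>z. draw (f z) (g z)) \<in> borel_measurable M"
proof -
  have [measurable]: "(\<lambda>z. to_hplane \<rho> (g z k)) \<in> borel_measurable M" for k
    using measurable_compose[OF measurable_compose[OF assms(2) measurable_proposals_nth] measurable_to_hplane] by simp
  have L: "(\<lambda>z. LEAST k. hit (f z) (to_hplane \<rho> (g z k))) \<in> measurable M (count_space UNIV)"
    by measurable
  have [measurable]: "(\<lambda>z. to_hplane \<rho> (g z (LEAST k. hit (f z) (to_hplane \<rho> (g z k))))) \<in> borel_measurable M"
    by (rule measurable_compose_countable[OF _ L]) simp
  show ?thesis unfolding draw_eq by measurable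
qed

text \<open>The substitution \<open>r = \<rho> * s\<close> shows that a proposal is distributed as
  \<open>lines\<close> divided by its total mass \<open>2 * \<rho>\<close>.\<close>

lemma nn_integral_proposal:
  assumes [measurable]: "f \<in> borel_measurable borel"
  shows "(\<integral>\<^sup>+x. f (to_hplane \<rho> x) \<partial>proposal) = (\<integral>\<^sup>+H. f H \<partial>lines) / ennreal (2 * \<rho>)"
proof -
  interpret U: prob_space "uniform_measure lborel {-1..1::real}"
    by (rule prob_space_uniform_measure) auto
  have [measurable]: "(\<lambda>x. f (to_hplane \<rho> x)) \<in> borel_measurable (unif_angle \<Otimes>\<^sub>M uniform_measure lborel {-1..1})"
    using measurable_compose[OF measurable_to_hplane assms, of \<rho>] unfolding proposal_def .
  have "(\<integral>\<^sup>+x. f (to_hplane \<rho> x) \<partial>proposal) =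
     (\<integral>\<^sup>+\<theta>. \<integral>\<^sup>+s. f (dirv \<theta>, \<rho> * s) \<partial>uniform_measure lborel {-1..1} \<partial>unif_angle)"
    unfolding proposal_def by (subst U.nn_integral_fst[symmetric]) (auto simp: to_hplane_def)
  also have "\<dots> = (\<integral>\<^sup>+u. \<integral>\<^sup>+s. f (u, \<rho> * s) \<partial>uniform_measure lborel {-1..1} \<partial>nu1)"
    unfolding nu1_def by (subst nn_integral_distr) auto
  also have "\<dots> = (\<integral>\<^sup>+u. (\<integral>\<^sup>+r. indicator {-\<rho>..\<rho>} r * f (u, r) \<partial>lborel) / ennreal (2 * \<rho>) \<partial>nu1)"
  proof (rule nn_integral_cong)
    fix u :: "real^2"
    have "(\<integral>\<^sup>+s. f (u, \<rho> * s) \<partial>uniform_measure lborel {-1..1}) =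
        (\<integral>\<^sup>+s. f (u, \<rho> * s) * indicator {-1..1} s \<partial>lborel) / ennreal 2"
      by (subst nn_integral_uniform_measure) auto
    also have "(\<integral>\<^sup>+r. indicator {-\<rho>..\<rho>} r * f (u, r) \<partial>lborel) =
        ennreal \<rho> * (\<integral>\<^sup>+s. indicator {-\<rho>..\<rho>} (\<rho> * s) * f (u, \<rho> * s) \<partial>lborel)"
      using rho_pos by (subst nn_integral_real_affine[where c=\<rho> and t=0]) auto
    then have "(\<integral>\<^sup>+s. f (u, \<rho> * s) * indicator {-1..1} s \<partial>lborel) / ennreal 2 =
       (\<integral>\<^sup>+r. indicator {-\<rho>..\<rho>} r * f (u, r) \<partial>lborel) / ennreal (2 * \<rho>)"
    proof -
      have "indicator {-\<rho>..\<rho>} (\<rho> * s) = (indicator {-1..1} s :: ennreal)" for s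
        using mult_le_cancel_left_pos[OF rho_pos, of s 1] mult_le_cancel_left_pos[OF rho_pos, of "-1" s]
        by (simp add: indicator_def)
      then have e: "(\<integral>\<^sup>+r. indicator {-\<rho>..\<rho>} r * f (u, r) \<partial>lborel) =
         ennreal \<rho> * (\<integral>\<^sup>+s. f (u, \<rho> * s) * indicator {-1..1} s \<partial>lborel)"
        using \<open>(\<integral>\<^sup>+r. indicator {-\<rho>..\<rho>} r * f (u, r) \<partial>lborel) = _\<close> by (simp add: mult.commute)

      have c: "ennreal \<rho> * inverse (ennreal (2 * \<rho>)) = inverse (ennreal 2)"
        using rho_pos by (subst (1 2) inverse_ennreal) (auto simp: ennreal_mult[symmetric])
      have "ennreal \<rho> * J / ennreal (2 * \<rho>) = J * (ennreal \<rho> * inverse (ennreal (2 * \<rho>)))" for J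
        by (simp only: divide_ennreal_def mult_ac)
      then show ?thesis unfolding e c by (simp only: divide_ennreal_def)
    qed
    finally show "(\<integral>\<^sup>+s. f (u, \<rho> * s) \<partial>uniform_measure lborel {-1..1}) =
       (\<integral>\<^sup>+r. indicator {-\<rho>..\<rho>} r * f (u, r) \<partial>lborel) / ennreal (2 * \<rho>)" .
  qed
  also have "\<dots> = (\<integral>\<^sup>+H. f H \<partial>lines) / ennreal (2 * \<rho>)"
    by (subst nn_integral_divide) (auto simp: nn_integral_lines)
  finally show ?thesis .
qed

text \<open>Rejection sampling: conditioning on the first proposal gives
  \<open>I = P(hit, H \<in> A) + P(no hit) I\<close> for the probability \<open>I\<close> that the drawn line lies in \<open>A\<close>.\<close>
lemma distr_draw:
  assumes "0 < Lam p"
  shows "distr proposals borel (draw p) = uniform_measure lines {H. hit p H}"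
proof (rule measure_eqI)
  interpret P: prob_space proposals by (rule prob_space_proposals)
  interpret PP: pair_sigma_finite proposal proposals ..
  have iter: "distr (proposal \<Otimes>\<^sub>M proposals) proposals (\<lambda>(x, s). case_nat x s) = proposals"
    unfolding proposals_def by (rule proposals.PiM_iter)
  have cn [measurable]: "(\<lambda>(x, s). case_nat x s) \<in> measurable (proposal \<Otimes>\<^sub>M proposals) proposals"
    unfolding proposals_def by measurable
  fix A assume "A \<in> sets (distr proposals borel (draw p))"
  then have A [measurable]: "A \<in> sets borel" by simp
  have dm: "draw p \<in> borel_measurable proposals" by measurable
  have dA: "{s. draw p s \<in> A} \<in> sets proposals"
    using measurable_sets[OF dm A] by (simp add: vimage_def)
  define I where "I = emeasure proposals {s. draw p s \<in> A}"
  define a where "a = emeasure lines {H. hit p H \<and> H \<in> A}"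
  have "I = (\<integral>\<^sup>+s. indicator {s. draw p s \<in> A} s \<partial>proposals)"
    unfolding I_def by (rule nn_integral_indicator[symmetric, OF dA])
  also have "\<dots> = (\<integral>\<^sup>+s. indicator A (draw p s) \<partial>proposals)"
    by (intro nn_integral_cong) (simp add: indicator_def)
  finally have I: "I = (\<integral>\<^sup>+s. indicator A (draw p s) \<partial>proposals)" .
  have "I = (\<integral>\<^sup>+s. indicator A (draw p s) \<partial>distr (proposal \<Otimes>\<^sub>M proposals) proposals (\<lambda>(x, s). case_nat x s))"
    unfolding iter by (rule I)
  also have "\<dots> = (\<integral>\<^sup>+z. indicator A (draw p (case_nat (fst z) (snd z))) \<partial>(proposal \<Otimes>\<^sub>M proposals))"
    by (subst nn_integral_distr) (auto simp: split_def)
  also have "\<dots> = (\<integral>\<^sup>+x. \<integral>\<^sup>+s. indicator A (draw p (case_nat x s)) \<partial>proposals \<partial>proposal)"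
    using cn by (subst P.nn_integral_fst[symmetric]) (auto simp: split_def)
  also have "\<dots> = (\<integral>\<^sup>+x. indicator {H. hit p H \<and> H \<in> A} (to_hplane \<rho> x) + I * indicator {H. \<not> hit p H} (to_hplane \<rho> x) \<partial>proposal)"
  proof (rule nn_integral_cong)
    fix x
    show "(\<integral>\<^sup>+s. indicator A (draw p (case_nat x s)) \<partial>proposals) =
      indicator {H. hit p H \<and> H \<in> A} (to_hplane \<rho> x) + I * indicator {H. \<not> hit p H} (to_hplane \<rho> x)"
    proof (cases "hit p (to_hplane \<rho> x)")
      case True
      then show ?thesis by (simp add: draw_case_nat P.emeasure_space_1[simplified] indicator_def)
    next
      case False
      then show ?thesis unfolding I by (simp add: draw_case_nat indicator_def)
    qed
  qed
  also have "\<dots> = (\<integral>\<^sup>+x. indicator {H. hit p H \<and> H \<in> A} (to_hplane \<rho> x) \<partial>proposal) +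
      I * (\<integral>\<^sup>+x. indicator {H. \<not> hit p H} (to_hplane \<rho> x) \<partial>proposal)"
    by (simp add: nn_integral_add nn_integral_cmult)
  also have "(\<integral>\<^sup>+x. indicator {H. hit p H \<and> H \<in> A} (to_hplane \<rho> x) \<partial>proposal) = a / ennreal (2 * \<rho>)"
    unfolding a_def by (subst nn_integral_proposal) auto
  finally have rec: "I = a / ennreal (2 * \<rho>) + I * (\<integral>\<^sup>+x. indicator {H. \<not> hit p H} (to_hplane \<rho> x) \<partial>proposal)" .
  have "(\<integral>\<^sup>+x. indicator {H. \<not> hit p H} (to_hplane \<rho> x) \<partial>proposal) + ennreal (Lam p) / ennreal (2 * \<rho>) =
     (\<integral>\<^sup>+x. indicator {H. \<not> hit p H} (to_hplane \<rho> x) + indicator {H. hit p H} (to_hplane \<rho> x) \<partial>proposal)"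
    unfolding emeasure_hit[symmetric] by (subst nn_integral_add) (auto simp: nn_integral_proposal)
  also have "\<dots> = (\<integral>\<^sup>+x. 1 \<partial>proposal)"
    by (intro nn_integral_cong) (auto simp: indicator_def)
  also have "\<dots> = 1" using proposal.emeasure_space_1 by simp
  finally have one: "(\<integral>\<^sup>+x. indicator {H. \<not> hit p H} (to_hplane \<rho> x) \<partial>proposal) + ennreal (Lam p) / ennreal (2 * \<rho>) = 1" .
  \<comment> \<open>Acceptance probability of one proposal. Its positivity allows the recursion
    \<open>rec\<close> to be solved for \<open>I\<close>.\<close>
  define q where "q = Lam p / (2 * \<rho>)"
  have q: "0 < q" using assms rho_pos by (simp add: q_def)
  have qe: "ennreal (Lam p) / ennreal (2 * \<rho>) = ennreal q"
    using rho_pos by (simp add: q_def divide_ennreal)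
  have "(\<integral>\<^sup>+x. indicator {H. \<not> hit p H} (to_hplane \<rho> x) \<partial>proposal) \<le> 1"
    unfolding one[symmetric] by simp
  then have "(\<integral>\<^sup>+x. indicator {H. \<not> hit p H} (to_hplane \<rho> x) \<partial>proposal) < top"
    by (rule le_less_trans) simp
  then obtain b where b: "0 \<le> b" "(\<integral>\<^sup>+x. indicator {H. \<not> hit p H} (to_hplane \<rho> x) \<partial>proposal) = ennreal b"
    unfolding less_top_ennreal by blast
  have "ennreal (b + q) = ennreal 1"
    using one unfolding qe b(2) ennreal_1 by (subst ennreal_plus) (use b(1) q in auto)
  then have bq: "b + q = 1" using b(1) q by (subst (asm) ennreal_inj) auto
  define I' where "I' = measure proposals {s. draw p s \<in> A}"
  have I': "I = ennreal I'" "0 \<le> I'"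
    by (simp_all add: I_def I'_def P.emeasure_eq_measure)
  define a' where "a' = measure lines {H. hit p H \<and> H \<in> A}"
  have a': "a = ennreal a'" "0 \<le> a'"
    by (simp_all add: a_def a'_def lines.emeasure_eq_measure)
  have "a / ennreal (2 * \<rho>) = ennreal (a' / (2 * \<rho>))"
    unfolding a'(1) using a'(2) rho_pos by (intro divide_ennreal) auto
  moreover have "I * ennreal b = ennreal (I' * b)"
    unfolding I'(1) using I'(2) b(1) by (intro ennreal_mult[symmetric]) auto
  moreover have "ennreal (a' / (2 * \<rho>)) + ennreal (I' * b) = ennreal (a' / (2 * \<rho>) + I' * b)"
    using a'(2) I'(2) b(1) rho_pos by (intro ennreal_plus[symmetric]) auto
  ultimately have "ennreal I' = ennreal (a' / (2 * \<rho>) + I' * b)"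
    using rec unfolding b(2) by (simp only: I'(1)[symmetric])
  then have "I' = a' / (2 * \<rho>) + I' * b"
    using a'(2) I'(2) b(1) rho_pos by (subst (asm) ennreal_inj) auto
  then have "I' * q = a' / (2 * \<rho>)" using bq by (metis add_diff_cancel_left' add_diff_cancel_right' mult.right_neutral right_diff_distrib)
  then have "I' = a' / Lam p" using assms rho_pos by (simp add: q_def field_simps)
  then have "I = a / ennreal (Lam p)"
    using assms a'(2) by (simp add: I' a' divide_ennreal)
  moreover have "emeasure (distr proposals borel (draw p)) A = I"
    unfolding I_def using dm A by (subst emeasure_distr) (auto simp: vimage_def)
  moreover have "emeasure (uniform_measure lines {H. hit p H}) A = a / ennreal (Lam p)"
    unfolding a_def by (subst emeasure_uniform_measure) (auto simp: emeasure_hit Int_def)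
  ultimately show "emeasure (distr proposals borel (draw p)) A = emeasure (uniform_measure lines {H. hit p H}) A"
    by simp
qed simp

text \<open>Lifetime and line are independent. The factor \<open>Lam p\<close> of the exponential
  density cancels the normalisation of the law of the line, so that what remains is the survival
  weight and the measure \<open>lines\<close> on the hitting lines.\<close>

lemma integral_node:
  fixes f :: "real \<times> hplane \<Rightarrow> 'b::{banach, second_countable_topology}"
  assumes L: "0 < Lam p" and [measurable]: "f \<in> borel_measurable borel" and B: "\<And>z. norm (f z) \<le> B"
  shows "(\<integral>n. f (fst n / Lam p, draw p (snd n)) \<partial>node_measure) =
    (\<integral>s. indicator {0..} s *\<^sub>R exp (- (Lam p * s)) *\<^sub>R
       (\<integral>H. indicator {H. hit p H} H *\<^sub>R f (s, H) \<partial>lines) \<partial>lborel)"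
proof -
  let ?E1 = "density lborel (exponential_density 1)" and ?E = "density lborel (exponential_density (Lam p))"
  let ?U = "uniform_measure lines {H. hit p H}"
  interpret P: prob_space proposals by (rule prob_space_proposals)
  interpret E1: prob_space ?E1 by (rule prob_space_exponential_density) simp
  interpret E: prob_space ?E by (rule prob_space_exponential_density) (rule L)
  interpret U: prob_space ?U
    by (rule prob_space_uniform_measure) (use L in \<open>auto simp: emeasure_hit\<close>)
  interpret EU: pair_prob_space ?E ?U ..
  have fm: "f \<in> borel_measurable (borel \<Otimes>\<^sub>M borel)" unfolding borel_prod by fact
  have dm: "draw p \<in> borel_measurable proposals" by measurable
  have distr: "distr node_measure (borel \<Otimes>\<^sub>M borel) (\<lambda>n. (fst n / Lam p, draw p (snd n))) = ?E \<Otimes>\<^sub>M ?U"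
    unfolding node_measure_eq exponential_scale[OF L, symmetric] distr_draw[OF L, symmetric]
  proof (subst pair_measure_distr)
    show "sigma_finite_measure (distr proposals borel (draw p))"
      unfolding distr_draw[OF L] by unfold_locales
  qed (use dm in \<open>auto simp: split_def\<close>)
  have mm: "(\<lambda>n. (fst n / Lam p, draw p (snd n))) \<in> measurable node_measure (borel \<Otimes>\<^sub>M borel)"
    unfolding node_measure_eq by measurable
  have sets_EU: "sets (?E \<Otimes>\<^sub>M ?U) = sets (borel \<Otimes>\<^sub>M borel)"
    by (intro sets_pair_measure_cong) auto
  have int: "integrable (?E \<Otimes>\<^sub>M ?U) f"
    by (rule EU.P.integrable_const_bound[of _ B])
       (use B fm in \<open>auto simp: measurable_cong_sets[OF sets_EU refl]\<close>)
  have [measurable]: "(\<lambda>H. f (s, H)) \<in> borel_measurable lines" for s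
    unfolding measurable_cong_sets[OF sets_lines refl] using measurable_compose[OF measurable_Pair1' fm] by simp
  have "(\<integral>n. f (fst n / Lam p, draw p (snd n)) \<partial>node_measure) = (\<integral>z. f z \<partial>(?E \<Otimes>\<^sub>M ?U))"
    unfolding distr[symmetric] by (rule integral_distr[OF mm fm, symmetric])
  also have "\<dots> = (\<integral>s. \<integral>H. f (s, H) \<partial>?U \<partial>?E)"
    by (rule EU.integral_fst'[OF int, symmetric])
  also have "\<dots> = (\<integral>s. (1 / Lam p) *\<^sub>R (\<integral>H. indicator {H. hit p H} H *\<^sub>R f (s, H) \<partial>lines) \<partial>?E)"
  proof (intro Bochner_Integration.integral_cong refl)
    fix s
    have "?U = density lines (\<lambda>H. ennreal (indicator {H. hit p H} H / Lam p))"
      unfolding uniform_measure_def emeasure_hit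
    proof (rule density_cong)
      have [measurable]: "{H. hit p H} \<in> sets lines" by simp
      show "(\<lambda>H. indicator {H. hit p H} H / ennreal (Lam p)) \<in> borel_measurable lines"
        "(\<lambda>H. ennreal (indicator {H. hit p H} H / Lam p)) \<in> borel_measurable lines"
        by measurable
    qed (use L in \<open>auto simp: indicator_def divide_ennreal[symmetric]\<close>)
    moreover have "(\<integral>H. f (s, H) \<partial>density lines (\<lambda>H. ennreal (indicator {H. hit p H} H / Lam p))) =
        (\<integral>H. (indicator {H. hit p H} H / Lam p) *\<^sub>R f (s, H) \<partial>lines)"
    proof (rule integral_density)
      have [measurable]: "{H. hit p H} \<in> sets lines" by simp
      show "(\<lambda>H. indicator {H. hit p H} H / Lam p) \<in> borel_measurable lines" by measurable
    qed (use L in auto)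
    ultimately have "(\<integral>H. f (s, H) \<partial>?U) = (\<integral>H. (indicator {H. hit p H} H / Lam p) *\<^sub>R f (s, H) \<partial>lines)"
      by (simp only:)
    also have "\<dots> = (\<integral>H. (1 / Lam p) *\<^sub>R (indicator {H. hit p H} H *\<^sub>R f (s, H)) \<partial>lines)"
      by (intro Bochner_Integration.integral_cong) auto
    finally show "(\<integral>H. f (s, H) \<partial>?U) = (1 / Lam p) *\<^sub>R (\<integral>H. indicator {H. hit p H} H *\<^sub>R f (s, H) \<partial>lines)"
      by (simp only: integral_scaleR_right)
  qed
  also have "\<dots> = (\<integral>s. exponential_density (Lam p) s *\<^sub>R ((1 / Lam p) *\<^sub>R (\<integral>H. indicator {H. hit p H} H *\<^sub>R f (s, H) \<partial>lines)) \<partial>lborel)"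
  proof (rule integral_density)
    have "(\<lambda>z. indicator {H. hit p H} (snd z) *\<^sub>R f z) \<in> borel_measurable (borel \<Otimes>\<^sub>M lines)"
      using fm by measurable
    then show "(\<lambda>s. (1 / Lam p) *\<^sub>R (\<integral>H. indicator {H. hit p H} H *\<^sub>R f (s, H) \<partial>lines)) \<in> borel_measurable lborel"
      by (intro borel_measurable_scaleR borel_measurable_const lines.borel_measurable_lebesgue_integral)
         (auto simp: split_def)
  qed (use L in \<open>auto simp: exponential_density_def\<close>)
  also have "\<dots> = (\<integral>s. indicator {0..} s *\<^sub>R exp (- (Lam p * s)) *\<^sub>R
       (\<integral>H. indicator {H. hit p H} H *\<^sub>R f (s, H) \<partial>lines) \<partial>lborel)"
    by (intro Bochner_Integration.integral_cong) (use L in \<open>auto simp: exponential_density_def indicator_def mult.commute\<close>)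
  finally show ?thesis .
qed

end

subsection \<open>Branching at the root\<close>

text \<open>The head of an address is the most recent branching, so the branch taken at the root is
  the last entry and the descendants of child \<open>b\<close> are the addresses
  \<open>v @ [b]\<close>.\<close>

definition subtree :: "bool \<Rightarrow> (bool list \<Rightarrow> 'a) \<Rightarrow> bool list \<Rightarrow> 'a" where
  "subtree b \<omega> = (\<lambda>v. \<omega> (v @ [b]))"

definition join :: "'a \<times> (bool list \<Rightarrow> 'a) \<times> (bool list \<Rightarrow> 'a) \<Rightarrow> bool list \<Rightarrow> 'a" where
  "join = (\<lambda>(n, \<omega>0, \<omega>1) v. if v = [] then n else if last v then \<omega>1 (butlast v) else \<omega>0 (butlast v))"

lemma join_simps [simp]: "join (n, \<omega>0, \<omega>1) [] = n" "subtree False (join (n, \<omega>0, \<omega>1)) = \<omega>0"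
  "subtree True (join (n, \<omega>0, \<omega>1)) = \<omega>1"
  by (simp_all add: join_def subtree_def)

lemma prob_space_Omega: "prob_space Omega"
  unfolding Omega_def by (rule prob_space_PiM) (rule prob_space_node_measure)

interpretation Omega: prob_space Omega by (rule prob_space_Omega)
interpretation node_measure: prob_space node_measure by (rule prob_space_node_measure)

lemma (in prob_space) norm_integral_le:
  fixes f :: "'a \<Rightarrow> 'b::{banach, second_countable_topology}"
  assumes "f \<in> borel_measurable M" "\<And>x. norm (f x) \<le> B"
  shows "norm (\<integral>x. f x \<partial>M) \<le> B"
proof -
  have "integrable M f" using assms by (intro integrable_const_bound[of _ B]) auto
  have "norm (\<integral>x. f x \<partial>M) \<le> (\<integral>x. norm (f x) \<partial>M)" by (rule integral_norm_bound)
  also have "\<dots> \<le> B"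
    using \<open>integrable M f\<close> assms(2) by (intro integral_le_const integrable_norm) auto
  finally show ?thesis .
qed

lemma measurable_Omega_nth [measurable]: "(\<lambda>\<omega>. \<omega> v) \<in> measurable Omega node_measure"
  unfolding Omega_def by measurable

lemma measurable_into_Omega:
  assumes "\<And>v. (\<lambda>z. f z v) \<in> measurable M node_measure"
  shows "f \<in> measurable M Omega"
  using measurable_PiM_single'[of UNIV "\<lambda>v z. f z v" M "\<lambda>_. node_measure"] assms
  by (simp add: Omega_def PiE_UNIV_domain)

lemma measurable_subtree [measurable]: "subtree b \<in> measurable Omega Omega"
  by (rule measurable_into_Omega) (simp add: subtree_def)

lemma measurable_join [measurable]: "join \<in> measurable (node_measure \<Otimes>\<^sub>M (Omega \<Otimes>\<^sub>M Omega)) Omega"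
proof (rule measurable_into_Omega)
  fix v
  show "(\<lambda>z. join z v) \<in> measurable (node_measure \<Otimes>\<^sub>M (Omega \<Otimes>\<^sub>M Omega)) node_measure"
    unfolding join_def split_def by measurable
qed

text \<open>Agreement on cylinder sets suffices. A finite set \<open>J\<close> of addresses splits
  into the root, if present, and the addresses ending in \<open>False\<close> or in
  \<open>True\<close>; the product over \<open>J\<close> factors accordingly.\<close>

lemma distr_join: "distr (node_measure \<Otimes>\<^sub>M (Omega \<Otimes>\<^sub>M Omega)) Omega join = Omega"
proof -
  interpret OO: pair_prob_space Omega Omega ..
  interpret PP: product_prob_space "\<lambda>_::bool list. node_measure" UNIV ..
  have "distr (node_measure \<Otimes>\<^sub>M (Omega \<Otimes>\<^sub>M Omega)) Omega join = (\<Pi>\<^sub>M v\<in>(UNIV::bool list set). node_measure)"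
  proof (rule PP.PiM_eq)
    show "sets (distr (node_measure \<Otimes>\<^sub>M (Omega \<Otimes>\<^sub>M Omega)) Omega join) = sets (\<Pi>\<^sub>M v\<in>(UNIV::bool list set). node_measure)"
      by (simp add: Omega_def)
  next
    fix J :: "bool list set" and A
    assume J: "finite J" "J \<subseteq> UNIV" and A: "\<And>v. v \<in> J \<Longrightarrow> A v \<in> sets node_measure"
    let ?emb = "\<lambda>J A. prod_emb UNIV (\<lambda>_. node_measure) J (Pi\<^sub>E J A)"
    let ?J = "\<lambda>b. {v. v @ [b] \<in> J}" and ?A = "\<lambda>b v. A (v @ [b])"
    let ?R = "if [] \<in> J then A [] else UNIV"
    have fJ: "finite (?J b)" for b
      using finite_vimageI[OF J(1), of "\<lambda>v. v @ [b]"] by (simp add: vimage_def inj_on_def)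
    have emb: "?emb J A = {\<omega>. \<forall>v\<in>J. \<omega> v \<in> A v}" for J :: "bool list set" and A
      by (auto simp: prod_emb_def PiE_iff)
    have box: "?emb J A \<in> sets Omega" if "finite J" "\<And>v. v \<in> J \<Longrightarrow> A v \<in> sets node_measure" for J A
      unfolding Omega_def using that by (intro sets_PiM_I) auto
    have em: "emeasure Omega (?emb J A) = (\<Prod>v\<in>J. emeasure node_measure (A v))"
      if "finite J" "\<And>v. v \<in> J \<Longrightarrow> A v \<in> sets node_measure" for J A
      unfolding Omega_def using that by (intro emeasure_PiM_emb prob_space_node_measure) auto
    have pre: "join -` ?emb J A \<inter> space (node_measure \<Otimes>\<^sub>M (Omega \<Otimes>\<^sub>M Omega)) =
        ?R \<times> (?emb (?J False) (?A False) \<times> ?emb (?J True) (?A True))"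
    proof -
      have key: "(\<forall>v\<in>J. join (n, \<omega>0, \<omega>1) v \<in> A v) \<longleftrightarrow>
         n \<in> ?R \<and> (\<forall>v\<in>?J False. \<omega>0 v \<in> ?A False v) \<and> (\<forall>v\<in>?J True. \<omega>1 v \<in> ?A True v)" (is "?l \<longleftrightarrow> ?r") for n \<omega>0 \<omega>1
      proof
        assume *: ?l
        have "\<omega>0 v \<in> ?A False v" if "v @ [False] \<in> J" for v
          using *[rule_format, OF that] by (simp add: join_def)
        moreover have "\<omega>1 v \<in> ?A True v" if "v @ [True] \<in> J" for v
          using *[rule_format, OF that] by (simp add: join_def)
        moreover have "n \<in> ?R" using *[rule_format, of "[]"] by auto
        ultimately show ?r by auto
      next
        assume *: ?r
        show ?l
        proof
          fix v assume v: "v \<in> J"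
          show "join (n, \<omega>0, \<omega>1) v \<in> A v"
          proof (cases v rule: rev_cases)
            case Nil then show ?thesis using * v by simp
          next
            case (snoc w b)
            then show ?thesis using * v by (cases b) (auto simp: join_def)
          qed
        qed
      qed
      show ?thesis unfolding emb
      proof (rule set_eqI)
        fix z :: "node_rand \<times> (bool list \<Rightarrow> node_rand) \<times> (bool list \<Rightarrow> node_rand)"
        obtain n \<omega>0 \<omega>1 where z: "z = (n, \<omega>0, \<omega>1)" by (cases z)
        show "z \<in> join -` {\<omega>. \<forall>v\<in>J. \<omega> v \<in> A v} \<inter> space (node_measure \<Otimes>\<^sub>M (Omega \<Otimes>\<^sub>M Omega)) \<longleftrightarrow>
          z \<in> ?R \<times> ({\<omega>. \<forall>v\<in>?J False. \<omega> v \<in> ?A False v} \<times> {\<omega>. \<forall>v\<in>?J True. \<omega> v \<in> ?A True v})"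
          by (simp only: z vimage_eq Int_iff mem_Collect_eq mem_Times_iff fst_conv snd_conv space_pair_measure
              space_node_measure space_Omega UNIV_Times_UNIV UNIV_I simp_thms key)
      qed
    qed
    have R: "?R \<in> sets node_measure" using A[of "[]"] sets.top[of node_measure] by auto
    have Jeq: "J = (if [] \<in> J then {[]} else {}) \<union> ((\<lambda>v. v @ [False]) ` ?J False \<union> (\<lambda>v. v @ [True]) ` ?J True)" (is "J = ?Ka \<union> (?Kb \<union> ?Kc)")
    proof
      show "J \<subseteq> ?Ka \<union> (?Kb \<union> ?Kc)"
      proof
        fix v assume v: "v \<in> J"
        show "v \<in> ?Ka \<union> (?Kb \<union> ?Kc)"
        proof (cases v rule: rev_cases)
          case (snoc w b) then show ?thesis using v by (cases b) auto
        qed (use v in auto)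
      qed
    qed auto
    have prodJ: "(\<Prod>v\<in>J. g v) = (if [] \<in> J then g [] else 1) * ((\<Prod>v\<in>?J False. g (v @ [False])) * (\<Prod>v\<in>?J True. g (v @ [True])))"
      for g :: "bool list \<Rightarrow> ennreal"
    proof -
      have f12: "finite ?Kb" "finite ?Kc" using fJ by auto
      have "(\<Prod>v\<in>J. g v) = (\<Prod>v\<in>?Ka \<union> (?Kb \<union> ?Kc). g v)" using Jeq by (rule arg_cong)
      also have "\<dots> = (\<Prod>v\<in>?Ka. g v) * (\<Prod>v\<in>?Kb \<union> ?Kc. g v)"
        using f12 by (intro prod.union_disjoint) auto
      also have "(\<Prod>v\<in>?Kb \<union> ?Kc. g v) = (\<Prod>v\<in>?Kb. g v) * (\<Prod>v\<in>?Kc. g v)"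
        using f12 by (intro prod.union_disjoint) auto
      also have "(\<Prod>v\<in>?Kb. g v) = (\<Prod>v\<in>?J False. g (v @ [False]))"
        by (subst prod.reindex) (auto simp: inj_on_def)
      also have "(\<Prod>v\<in>?Kc. g v) = (\<Prod>v\<in>?J True. g (v @ [True]))"
        by (subst prod.reindex) (auto simp: inj_on_def)
      finally show ?thesis by auto
    qed
    have b0: "?emb (?J b) (?A b) \<in> sets Omega" for b using fJ A by (intro box) auto
    have bJ: "?emb J A \<in> sets Omega" using J(1) A by (rule box)
    have "emeasure (distr (node_measure \<Otimes>\<^sub>M (Omega \<Otimes>\<^sub>M Omega)) Omega join) (?emb J A) =
       emeasure (node_measure \<Otimes>\<^sub>M (Omega \<Otimes>\<^sub>M Omega)) (?R \<times> (?emb (?J False) (?A False) \<times> ?emb (?J True) (?A True)))"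
      unfolding pre[symmetric] by (rule emeasure_distr[OF measurable_join bJ])
    also have "\<dots> = emeasure node_measure ?R * emeasure (Omega \<Otimes>\<^sub>M Omega) (?emb (?J False) (?A False) \<times> ?emb (?J True) (?A True))"
      using R b0 by (intro OO.P.emeasure_pair_measure_Times) auto
    also have "emeasure (Omega \<Otimes>\<^sub>M Omega) (?emb (?J False) (?A False) \<times> ?emb (?J True) (?A True)) =
      emeasure Omega (?emb (?J False) (?A False)) * emeasure Omega (?emb (?J True) (?A True))"
      using b0 by (intro Omega.emeasure_pair_measure_Times) auto
    also have "emeasure Omega (?emb (?J False) (?A False)) = (\<Prod>v\<in>?J False. emeasure node_measure (A (v @ [False])))"
      using fJ A by (intro em) auto
    also have "emeasure Omega (?emb (?J True) (?A True)) = (\<Prod>v\<in>?J True. emeasure node_measure (A (v @ [True])))"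
      using fJ A by (intro em) auto
    also have "emeasure node_measure ?R = (if [] \<in> J then emeasure node_measure (A []) else 1)"
      using node_measure.emeasure_space_1 by simp
    finally show "emeasure (distr (node_measure \<Otimes>\<^sub>M (Omega \<Otimes>\<^sub>M Omega)) Omega join) (?emb J A) =
        (\<Prod>v\<in>J. emeasure node_measure (A v))" unfolding prodJ .
  qed
  then show ?thesis by (simp only: Omega_def)
qed

text \<open>Branching property: the mark at the root and the marks of the two subtrees are
  independent, and each subtree is distributed as the whole tree.\<close>

lemma integral_Omega:
  fixes f :: "_ \<Rightarrow> 'b::{banach, second_countable_topology}"
  assumes f [measurable]: "f \<in> borel_measurable (node_measure \<Otimes>\<^sub>M (Omega \<Otimes>\<^sub>M Omega))"
    and B: "\<And>z. norm (f z) \<le> B"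
  shows "(\<integral>\<omega>. f (\<omega> [], subtree False \<omega>, subtree True \<omega>) \<partial>Omega) =
     (\<integral>n. \<integral>\<omega>0. \<integral>\<omega>1. f (n, \<omega>0, \<omega>1) \<partial>Omega \<partial>Omega \<partial>node_measure)"
proof -
  interpret OO: pair_prob_space Omega Omega ..
  interpret NOO: pair_prob_space node_measure "Omega \<Otimes>\<^sub>M Omega" ..
  have m: "(\<lambda>\<omega>. f (\<omega> [], subtree False \<omega>, subtree True \<omega>)) \<in> borel_measurable Omega"
    by measurable
  have "(\<integral>\<omega>. f (\<omega> [], subtree False \<omega>, subtree True \<omega>) \<partial>Omega) =
     (\<integral>\<omega>. f (\<omega> [], subtree False \<omega>, subtree True \<omega>) \<partial>distr (node_measure \<Otimes>\<^sub>M (Omega \<Otimes>\<^sub>M Omega)) Omega join)"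
    by (simp only: distr_join)
  also have "\<dots> = (\<integral>z. f (join z [], subtree False (join z), subtree True (join z)) \<partial>(node_measure \<Otimes>\<^sub>M (Omega \<Otimes>\<^sub>M Omega)))"
    by (rule integral_distr[OF measurable_join m])
  also have "\<dots> = (\<integral>z. f z \<partial>(node_measure \<Otimes>\<^sub>M (Omega \<Otimes>\<^sub>M Omega)))"
  proof (intro Bochner_Integration.integral_cong refl)
    fix z :: "node_rand \<times> (bool list \<Rightarrow> node_rand) \<times> (bool list \<Rightarrow> node_rand)"
    show "f (join z [], subtree False (join z), subtree True (join z)) = f z"
      by (cases z) simp
  qed
  also have "\<dots> = (\<integral>n. \<integral>w. f (n, w) \<partial>(Omega \<Otimes>\<^sub>M Omega) \<partial>node_measure)"
  proof (rule NOO.integral_fst'[symmetric])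
    show "integrable (node_measure \<Otimes>\<^sub>M (Omega \<Otimes>\<^sub>M Omega)) f"
      using B f by (intro NOO.P.integrable_const_bound[of _ B]) auto
  qed
  also have "\<dots> = (\<integral>n. \<integral>\<omega>0. \<integral>\<omega>1. f (n, \<omega>0, \<omega>1) \<partial>Omega \<partial>Omega \<partial>node_measure)"
  proof (intro Bochner_Integration.integral_cong refl)
    fix n :: node_rand
    have "(\<lambda>w. f (n, w)) \<in> borel_measurable (Omega \<Otimes>\<^sub>M Omega)" by simp
    then have "integrable (Omega \<Otimes>\<^sub>M Omega) (\<lambda>w. f (n, w))"
      using B by (intro OO.P.integrable_const_bound[of _ B]) auto
    from OO.integral_fst'[OF this]
    show "(\<integral>w. f (n, w) \<partial>(Omega \<Otimes>\<^sub>M Omega)) = (\<integral>\<omega>0. \<integral>\<omega>1. f (n, \<omega>0, \<omega>1) \<partial>Omega \<partial>Omega)"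
      by simp
  qed
  finally show ?thesis .
qed

lemma measurable_fst_node [measurable]: "fst \<in> borel_measurable node_measure"
proof -
  have "fst \<in> measurable node_measure (density lborel (exponential_density 1))"
    unfolding node_measure_eq by measurable
  then show ?thesis by simp
qed

lemma measurable_snd_node [measurable]: "snd \<in> measurable node_measure proposals"
  unfolding node_measure_eq by measurable

context convex_window
begin

text \<open>The total length created by the splits of the first \<open>n\<close> generations when the cell \<open>p\<close>
  evolves for time \<open>t\<close>.\<close>
primrec X :: "nat \<Rightarrow> real \<Rightarrow> (nat \<Rightarrow> hplane) \<Rightarrow> (bool list \<Rightarrow> node_rand) \<Rightarrow> real" where
  "X 0 t p \<omega> = 0"
| "X (Suc n) t p \<omega> =
     (let s = fst (\<omega> []) / Lam p; H = draw p (snd (\<omega> []))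
      in if s \<le> t then ell p H + X n (t - s) (child False H p) (subtree False \<omega>) +
            X n (t - s) (child True H p) (subtree True \<omega>) else 0)"

lemma measurable_X [measurable (raw)]:
  assumes "f \<in> borel_measurable M" "g \<in> borel_measurable M" "h \<in> measurable M Omega"
  shows "(\<lambda>z. X n (f z) (g z) (h z)) \<in> borel_measurable M"
  using assms
proof (induction n arbitrary: f g h)
  case 0
  then show ?case by simp
next
  case (Suc n)
  note [measurable] = Suc.prems
  have [measurable]: "(\<lambda>z. h z []) \<in> measurable M node_measure"
    using measurable_compose[OF Suc.prems(3) measurable_Omega_nth] .
  have S [measurable]: "(\<lambda>z. subtree b (h z)) \<in> measurable M Omega" for b
    using measurable_compose[OF Suc.prems(3) measurable_subtree] .
  have D [measurable]: "(\<lambda>z. draw (g z) (snd (h z []))) \<in> borel_measurable M"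
    by measurable
  have T [measurable]: "(\<lambda>z. fst (h z []) / Lam (g z)) \<in> borel_measurable M" by measurable
  have [measurable]: "(\<lambda>z. X n (f z - fst (h z []) / Lam (g z)) (child b (draw (g z) (snd (h z []))) (g z)) (subtree b (h z))) \<in> borel_measurable M" for b
    by (rule Suc.IH) measurable
  show ?case unfolding X.simps Let_def by measurable
qed

lemma X_nonneg [simp]: "0 \<le> X n t p \<omega>"
  by (induction n arbitrary: t p \<omega>) (auto simp: Let_def)

lemma ell_draw_le: "ell p (draw p s) \<le> 2 * \<rho>"
  by (rule emeasure_chord(2)) simp

text \<open>The first \<open>n\<close> generations contain \<open>2 ^ n - 1\<close> nodes, each with
  a chord of length at most \<open>2 * \<rho>\<close>. This boundedness gives all expectations of
  truncated lengths for free.\<close>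

lemma X_le: "X n t p \<omega> \<le> (2 ^ n - 1) * (2 * \<rho>)"
proof (induction n arbitrary: t p \<omega>)
  case (Suc n)
  have "0 \<le> (2 ^ Suc n - 1) * (2 * \<rho>)"
    using rho_pos one_le_power[of "2::real" "Suc n"] by (intro mult_nonneg_nonneg) auto
  moreover have "ell p (draw p s) + X n t' p' \<omega>' + X n t'' p'' \<omega>'' \<le> (2 ^ Suc n - 1) * (2 * \<rho>)" for s t' p' \<omega>' t'' p'' \<omega>''
    using ell_draw_le[of p s] Suc[of t' p' \<omega>'] Suc[of t'' p'' \<omega>''] by (simp add: algebra_simps)
  ultimately show ?case by (simp add: Let_def del: power_Suc)
qed simp

lemma X_mono: "X n t p \<omega> \<le> X (Suc n) t p \<omega>"
proof (induction n arbitrary: t p \<omega>)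
  case (Suc n)
  show ?case
    unfolding X.simps(2)[of "Suc n" t p \<omega>] X.simps(2)[of n t p \<omega>] Let_def
    by (auto intro!: add_mono Suc simp del: X.simps)
qed (simp add: Let_def)

lemma Lam_child: "Lam (child b H p) \<le> Lam p"
proof -
  have "{H'. hit (child b H p) H'} \<subseteq> {H'. hit p H'}"
    using cell_child_subset[of b H p] by (auto simp: hit_def)
  then show ?thesis unfolding Lam_def by (rule lines.finite_measure_mono) simp
qed

lemma ell_eq_0_of_Lam: "Lam p = 0 \<Longrightarrow> norm (fst H) = 1 \<Longrightarrow> ell p H = 0"
proof -
  assume L: "Lam p = 0" and n: "norm (fst H) = 1"
  let ?S = "{t. snd H *\<^sub>R fst H + t *\<^sub>R perp (fst H) \<in> cell p}"
  have "perp (fst H) \<noteq> 0" using n norm_perp[of "fst H"] by (metis norm_zero zero_neq_one)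
  then have "t = t'" if "t \<in> ?S" "t' \<in> ?S" for t t'
    using Lam_eq_0[OF L, of "snd H *\<^sub>R fst H + t *\<^sub>R perp (fst H)" "snd H *\<^sub>R fst H + t' *\<^sub>R perp (fst H)"] that by simp
  then have "\<exists>t. ?S \<subseteq> {t}" by blast
  then obtain t where "?S \<subseteq> {t}" ..
  then have "emeasure lborel ?S \<le> emeasure lborel {t}" by (intro emeasure_mono) auto
  then have "emeasure lborel ?S = 0" by simp
  then show ?thesis by (simp add: ell_def chord_len_def measure_def)
qed

text \<open>For \<open>Lam p = 0\<close> the quotient that defines the lifetime is 0, so the
  recursion may split such a cell again and again without delay. Nothing is created, because the
  cell is at most a point and all its chords have length 0.\<close>

lemma X_eq_0_of_Lam: "Lam p = 0 \<Longrightarrow> X n t p \<omega> = 0"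
proof (induction n arbitrary: t p \<omega>)
  case (Suc n)
  have "Lam (child b H p) = 0" for b H
    using Lam_child[of b H p] Lam_nonneg[of "child b H p"] Suc.prems by linarith
  then show ?case using Suc by (simp add: Let_def ell_eq_0_of_Lam)
qed simp

lemma area_eq_0_of_Lam: "Lam p = 0 \<Longrightarrow> area p = 0"
proof -
  assume L: "Lam p = 0"
  have "\<exists>x. cell p \<subseteq> {x}" using Lam_eq_0[OF L] by blast
  then obtain x where "cell p \<subseteq> {x}" ..
  then have "emeasure lborel (cell p) \<le> emeasure lborel {x}" by (intro emeasure_mono) auto
  then have "emeasure lborel (cell p) = 0" by simp
  then show ?thesis by (simp add: area_def measure_def)
qed

lemma V_eq_0_of_Lam: "Lam p = 0 \<Longrightarrow> V t p = 0"
proof -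
  assume L: "Lam p = 0"
  have "cov p h = 0" for h using cov_le_area[of p h] area_eq_0_of_Lam[OF L] by simp
  then show ?thesis by (simp add: V_def)
qed

text \<open>Conditioning on the first split: its time and line come from the mark at the root, the
  further evolution from two independent subtrees.\<close>

lemma integral_root:
  fixes f :: "_ \<Rightarrow> 'b::{banach, second_countable_topology}"
  assumes L: "0 < Lam p"
    and f [measurable]: "f \<in> borel_measurable (borel \<Otimes>\<^sub>M (Omega \<Otimes>\<^sub>M Omega))"
    and B: "\<And>z. norm (f z) \<le> B"
  shows "(\<integral>\<omega>. f ((fst (\<omega> []) / Lam p, draw p (snd (\<omega> []))), subtree False \<omega>, subtree True \<omega>) \<partial>Omega) =
    (\<integral>s. indicator {0..} s *\<^sub>R exp (- (Lam p * s)) *\<^sub>R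
       (\<integral>H. indicator {H. hit p H} H *\<^sub>R (\<integral>\<omega>0. \<integral>\<omega>1. f ((s, H), \<omega>0, \<omega>1) \<partial>Omega \<partial>Omega) \<partial>lines) \<partial>lborel)"
proof -
  have pm [measurable]: "(\<lambda>n. (fst n / Lam p, draw p (snd n))) \<in> borel_measurable node_measure"
  proof -
    have 1: "(\<lambda>n. fst n / Lam p) \<in> borel_measurable node_measure" by measurable
    have 2: "(\<lambda>n. draw p (snd n)) \<in> borel_measurable node_measure"
      by (rule measurable_draw[OF measurable_const measurable_snd_node]) simp
    show ?thesis by (subst borel_prod[symmetric]) (rule measurable_Pair[OF 1 2])
  qed
  have "(\<integral>\<omega>. f ((fst (\<omega> []) / Lam p, draw p (snd (\<omega> []))), subtree False \<omega>, subtree True \<omega>) \<partial>Omega) =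
     (\<integral>n. \<integral>\<omega>0. \<integral>\<omega>1. f ((fst n / Lam p, draw p (snd n)), \<omega>0, \<omega>1) \<partial>Omega \<partial>Omega \<partial>node_measure)"
  proof -
    have "(\<lambda>z. f ((fst (fst z) / Lam p, draw p (snd (fst z))), snd z)) \<in> borel_measurable (node_measure \<Otimes>\<^sub>M (Omega \<Otimes>\<^sub>M Omega))"
      by measurable
    from integral_Omega[OF this B] show ?thesis by simp
  qed
  also have "\<dots> = (\<integral>s. indicator {0..} s *\<^sub>R exp (- (Lam p * s)) *\<^sub>R
       (\<integral>H. indicator {H. hit p H} H *\<^sub>R (\<integral>\<omega>0. \<integral>\<omega>1. f ((s, H), \<omega>0, \<omega>1) \<partial>Omega \<partial>Omega) \<partial>lines) \<partial>lborel)"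
  proof (rule integral_node[OF L, of "\<lambda>z. \<integral>\<omega>0. \<integral>\<omega>1. f (z, \<omega>0, \<omega>1) \<partial>Omega \<partial>Omega" B])
    show "(\<lambda>z. \<integral>\<omega>0. \<integral>\<omega>1. f (z, \<omega>0, \<omega>1) \<partial>Omega \<partial>Omega) \<in> borel_measurable borel"
      by measurable
    fix z :: "real \<times> hplane"
    have "norm (\<integral>\<omega>1. f (z, \<omega>0, \<omega>1) \<partial>Omega) \<le> B" for \<omega>0
      using B by (intro Omega.norm_integral_le) auto
    then show "norm (\<integral>\<omega>0. \<integral>\<omega>1. f (z, \<omega>0, \<omega>1) \<partial>Omega \<partial>Omega) \<le> B"
      by (rule Omega.norm_integral_le[rotated]) measurable
  qed
  finally show ?thesis .
qed

end

subsection \<open>Comparison with a Gaussian characteristic function\<close>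

text \<open>By \<open>variation_of_constants\<close>, \<open>y t\<close> is the weighted integral of
  \<open>of_real L * y + y'\<close>, and \<open>b t\<close> that of \<open>L * b + b'\<close>. If
  the source \<open>K\<close> misses the first by at most the second, the integrals differ by at
  most \<open>b t\<close>: a scalar supersolution controls the error.\<close>

lemma mild_comparison:
  fixes y K :: "real \<Rightarrow> 'a::{real_normed_field, euclidean_space}"
  assumes t: "0 \<le> t"
    and y: "\<And>s. s \<in> {0..t} \<Longrightarrow> (y has_vector_derivative y' s) (at s within {0..t})"
      "continuous_on {0..t} y'" "y 0 = 0"
    and b: "\<And>s. s \<in> {0..t} \<Longrightarrow> (b has_real_derivative b' s) (at s within {0..t})"
      "continuous_on {0..t} b'" "b 0 = 0"
    and K [measurable]: "K \<in> borel_measurable borel" and KB: "\<And>s. s \<in> {0..t} \<Longrightarrow> norm (K s) \<le> C"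
    and le: "\<And>s. s \<in> {0..t} \<Longrightarrow> norm (K s - (of_real L * y s + y' s)) \<le> L * b s + b' s"
  shows "norm ((\<integral>s. indicator {0..t} s *\<^sub>R exp (- (L * s)) *\<^sub>R K (t - s) \<partial>lborel) - y t) \<le> b t"
proof -
  define Ft where "Ft = (\<lambda>s. exp (- (of_real s * of_real L)) * (of_real L * y (t - s) + y' (t - s)))"
  have b1: "\<And>s. s \<in> {0..t} \<Longrightarrow> (b has_vector_derivative b' s) (at s within {0..t})"
    using b(1) by (simp add: has_real_derivative_iff_has_vector_derivative)
  have cy: "continuous_on {0..t} y" "continuous_on {0..t} b"
    unfolding continuous_on_eq_continuous_within
    using has_vector_derivative_continuous[OF y(1)] has_vector_derivative_continuous[OF b1] by blast+
  have maps: "(\<lambda>s. t - s) ` {0..t} \<subseteq> {0..t}" by auto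
  have 1: "y t = (\<integral>s. indicator {0..t} s *\<^sub>R Ft s \<partial>lborel)"
    using variation_of_constants[OF t y(1,2), of "of_real L"] y(3) by (simp add: Ft_def)
  have 2: "b t = (\<integral>s. indicator {0..t} s *\<^sub>R (exp (- (s * L)) * (L * b (t - s) + b' (t - s))) \<partial>lborel)"
    using variation_of_constants[OF t b1 b(2), of L] b(3) by simp
  have "continuous_on {0..t} Ft" unfolding Ft_def
    by (intro continuous_intros continuous_on_compose2[OF cy(1) _ maps] continuous_on_compose2[OF y(2) _ maps])
  then have i1: "integrable lborel (\<lambda>s. indicator {0..t} s *\<^sub>R Ft s)"
    by (rule borel_integrable_compact[OF compact_Icc])
  have "continuous_on {0..t} (\<lambda>s. exp (- (s * L)) * (L * b (t - s) + b' (t - s)))"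
    by (intro continuous_intros continuous_on_compose2[OF cy(2) _ maps] continuous_on_compose2[OF b(2) _ maps])
  then have i2: "integrable lborel (\<lambda>s. indicator {0..t} s *\<^sub>R (exp (- (s * L)) * (L * b (t - s) + b' (t - s))))"
    by (rule borel_integrable_compact[OF compact_Icc])
  have i3: "integrable lborel (\<lambda>s. indicator {0..t} s *\<^sub>R exp (- (L * s)) *\<^sub>R K (t - s))"
  proof (rule Bochner_Integration.integrable_bound)
    show "integrable lborel (\<lambda>s. indicator {0..t} s *\<^sub>R (exp (- (L * s)) * C))"
      by (rule borel_integrable_compact[OF compact_Icc]) (intro continuous_intros)
    show "AE s in lborel. norm (indicator {0..t} s *\<^sub>R exp (- (L * s)) *\<^sub>R K (t - s)) \<le>
        norm (indicator {0..t} s *\<^sub>R (exp (- (L * s)) * C))"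
    proof (rule AE_I2)
      fix s
      show "norm (indicator {0..t} s *\<^sub>R exp (- (L * s)) *\<^sub>R K (t - s)) \<le>
        norm (indicator {0..t} s *\<^sub>R (exp (- (L * s)) * C))"
      proof (cases "s \<in> {0..t}")
        case True
        then have "norm (K (t - s)) \<le> \<bar>C\<bar>" using KB[of "t - s"] by auto
        then show ?thesis using True by (simp add: abs_mult)
      qed simp
    qed
  qed measurable
  let ?d = "\<lambda>s. indicator {0..t} s *\<^sub>R exp (- (L * s)) *\<^sub>R K (t - s) - indicator {0..t} s *\<^sub>R Ft s"
  have d1: "(\<integral>s. indicator {0..t} s *\<^sub>R exp (- (L * s)) *\<^sub>R K (t - s) \<partial>lborel) - y t = (\<integral>s. ?d s \<partial>lborel)"
    unfolding 1 by (rule Bochner_Integration.integral_diff[symmetric, OF i3 i1])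
  have d2: "norm (\<integral>s. ?d s \<partial>lborel) \<le> (\<integral>s. norm (indicator {0..t} s *\<^sub>R exp (- (L * s)) *\<^sub>R K (t - s) - indicator {0..t} s *\<^sub>R Ft s) \<partial>lborel)"
    by (rule integral_norm_bound)
  have d3: "(\<integral>s. norm (?d s) \<partial>lborel) \<le> b t"
    unfolding 2
  proof (rule integral_mono)
    fix s
    show "norm (indicator {0..t} s *\<^sub>R exp (- (L * s)) *\<^sub>R K (t - s) - indicator {0..t} s *\<^sub>R Ft s)
      \<le> indicator {0..t} s *\<^sub>R (exp (- (s * L)) * (L * b (t - s) + b' (t - s)))"
    proof (cases "s \<in> {0..t}")
      case True
      have e: "exp (- (of_real s * of_real L)) = (of_real (exp (- (L * s))) :: 'a)"
      proof -
        have "- (of_real s * of_real L) = (of_real (- (L * s)) :: 'a)" by (simp add: mult.commute)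
        then show ?thesis by (simp only: exp_of_real)
      qed
      have "exp (- (L * s)) *\<^sub>R K (t - s) - Ft s = exp (- (L * s)) *\<^sub>R (K (t - s) - (of_real L * y (t - s) + y' (t - s)))"
        unfolding Ft_def e by (simp only: scaleR_conv_of_real right_diff_distrib)
      then have "norm (exp (- (L * s)) *\<^sub>R K (t - s) - Ft s) = exp (- (L * s)) * norm (K (t - s) - (of_real L * y (t - s) + y' (t - s)))"
        by (simp only: norm_scaleR abs_exp_cancel)
      also have "\<dots> \<le> exp (- (L * s)) * (L * b (t - s) + b' (t - s))"
        using le[of "t - s"] True by (intro mult_left_mono) auto
      finally show ?thesis using True by (simp add: mult.commute)
    qed simp
  qed (rule integrable_norm[OF Bochner_Integration.integrable_diff[OF i3 i1]], rule i2)
  show ?thesis unfolding d1 using d2 d3 by (rule order_trans)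
qed

text \<open>Expansion to second order in \<open>a\<close> and to first order in \<open>b\<close>.
  The damping \<open>exp (- v)\<close> with \<open>b \<le> v\<close> absorbs \<open>exp b\<close>,
  so the bound contains no exponential.\<close>

lemma exp_perturbation:
  fixes a b v :: real
  assumes "0 \<le> b" "b \<le> v"
  shows "cmod (of_real (exp (- v)) * (iexp a * of_real (exp b) - (1 + \<i> * of_real a - of_real (a^2 / 2) + of_real b)))
    \<le> \<bar>a\<bar>^3 / 6 + b^2 + \<bar>a\<bar> * b"
proof -
  let ?R = "iexp a - (1 + \<i> * of_real a - of_real (a^2 / 2))"
  have 1: "cmod ?R \<le> \<bar>a\<bar>^3 / 6"
    using iexp_approx1[of a 2] by (simp add: eval_nat_numeral power2_eq_square field_simps)
  have 2: "cmod (iexp a - 1) \<le> \<bar>a\<bar>"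
    using iexp_approx1[of a 0] by simp
  have v: "exp (- v) * exp b \<le> 1" "exp (- v) \<le> 1" "0 \<le> exp (- v)"
    using assms by (auto simp flip: exp_add)
  have eb: "exp b - 1 \<le> b * exp b"
  proof -
    have "1 - b \<le> exp (- b)" using exp_ge_add_one_self[of "- b"] by simp
    then have "(1 - b) * exp b \<le> exp (- b) * exp b" by (intro mult_right_mono) auto
    then show ?thesis by (simp add: exp_minus algebra_simps)
  qed
  have eb0: "0 \<le> exp b - 1" using assms by simp
  have eb1: "0 \<le> exp b - 1 - b" using exp_ge_add_one_self[of b] by linarith
  have eb2: "exp b - 1 - b \<le> b^2 * exp b"
  proof -
    have "exp b - 1 - b \<le> b * (exp b - 1)" using eb by (simp add: algebra_simps)
    also have "\<dots> \<le> b * (b * exp b)" using eb assms by (intro mult_left_mono) auto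
    finally show ?thesis by (simp add: power2_eq_square mult.assoc)
  qed
  have v1: "exp (- v) * (exp b - 1) \<le> b"
  proof -
    have "exp (- v) * (exp b - 1) \<le> exp (- v) * (b * exp b)" using eb v by (intro mult_left_mono) auto
    also have "\<dots> = b * (exp (- v) * exp b)" by simp
    also have "\<dots> \<le> b * 1" using v assms by (intro mult_left_mono) auto
    finally show ?thesis by simp
  qed
  have v2: "exp (- v) * (exp b - 1 - b) \<le> b^2"
  proof -
    have "exp (- v) * (exp b - 1 - b) \<le> exp (- v) * (b^2 * exp b)" using eb2 v by (intro mult_left_mono) auto
    also have "\<dots> = b^2 * (exp (- v) * exp b)" by simp
    also have "\<dots> \<le> b^2 * 1" using v assms by (intro mult_left_mono) auto
    finally show ?thesis by simp
  qed
  \<comment> \<open>Three remainders: third order in \<open>a\<close>, mixed in \<open>a\<close> and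
    \<open>b\<close>, and second order in \<open>b\<close>.\<close>
  have "of_real (exp (- v)) * (iexp a * of_real (exp b) - (1 + \<i> * of_real a - of_real (a^2 / 2) + of_real b)) =
    of_real (exp (- v)) * ?R + (iexp a - 1) * of_real (exp (- v) * (exp b - 1)) + of_real (exp (- v) * (exp b - 1 - b))"
    by (simp add: algebra_simps)
  also have "cmod \<dots> \<le> cmod (of_real (exp (- v)) * ?R) + cmod ((iexp a - 1) * of_real (exp (- v) * (exp b - 1))) +
      cmod (of_real (exp (- v) * (exp b - 1 - b)))"
    by (intro order_trans[OF norm_triangle_ineq] add_mono norm_triangle_ineq order_refl)
  also have "cmod (of_real (exp (- v)) * ?R) = exp (- v) * cmod ?R"
    by (simp only: norm_mult norm_of_real abs_of_nonneg[OF v(3)])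
  also have "cmod ((iexp a - 1) * of_real (exp (- v) * (exp b - 1))) = cmod (iexp a - 1) * (exp (- v) * (exp b - 1))"
    using eb0 by (simp only: norm_mult norm_of_real abs_of_nonneg[OF mult_nonneg_nonneg[OF v(3) eb0]])
  also have "cmod (of_real (exp (- v) * (exp b - 1 - b))) = exp (- v) * (exp b - 1 - b)"
    by (simp only: norm_of_real abs_of_nonneg[OF mult_nonneg_nonneg[OF v(3) eb1]])
  also have "exp (- v) * cmod ?R + cmod (iexp a - 1) * (exp (- v) * (exp b - 1)) + exp (- v) * (exp b - 1 - b) \<le>
      1 * (\<bar>a\<bar>^3 / 6) + \<bar>a\<bar> * b + b^2"
    using 1 2 v v1 v2 eb0 by (intro add_mono mult_mono) auto
  finally show ?thesis by simp
qed

section \<open>Characteristic function and mean of the truncated length\<close>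

context convex_window
begin

definition chi :: "nat \<Rightarrow> real \<Rightarrow> real \<Rightarrow> (nat \<Rightarrow> hplane) \<Rightarrow> complex" where
  "chi n \<theta> t p = (\<integral>\<omega>. iexp (\<theta> * X n t p \<omega>) \<partial>Omega)"

definition mean :: "nat \<Rightarrow> real \<Rightarrow> (nat \<Rightarrow> hplane) \<Rightarrow> real" where
  "mean n t p = (\<integral>\<omega>. X n t p \<omega> \<partial>Omega)"

definition gauss :: "real \<Rightarrow> real \<Rightarrow> (nat \<Rightarrow> hplane) \<Rightarrow> complex" where
  "gauss \<theta> t p = iexp (\<theta> * (t * area p)) * of_real (exp (- (\<theta>^2 * V t p / 2)))"

lemma measurable_chi [measurable (raw)]:
  assumes [measurable]: "f \<in> borel_measurable M" "g \<in> borel_measurable M"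
  shows "(\<lambda>z. chi n \<theta> (f z) (g z)) \<in> borel_measurable M"
  unfolding chi_def by measurable

lemma measurable_mean [measurable (raw)]:
  assumes [measurable]: "f \<in> borel_measurable M" "g \<in> borel_measurable M"
  shows "(\<lambda>z. mean n (f z) (g z)) \<in> borel_measurable M"
  unfolding mean_def by measurable

lemma integrable_X: "integrable Omega (X n t p)"
  using X_le by (intro Omega.integrable_const_bound[of _ "(2 ^ n - 1) * (2 * \<rho>)"]) auto

lemma integrable_iexp_X: "integrable Omega (\<lambda>\<omega>. iexp (\<theta> * X n t p \<omega>))"
  by (intro Omega.integrable_const_bound[of _ 1]) auto

lemma norm_chi_le: "cmod (chi n \<theta> t p) \<le> 1"
  unfolding chi_def by (rule Omega.norm_integral_le) auto

lemma norm_gauss_le: "0 \<le> t \<Longrightarrow> cmod (gauss \<theta> t p) \<le> 1"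
  by (simp add: gauss_def norm_mult)

lemma integral_root_before:
  fixes f :: "_ \<Rightarrow> 'b::{banach, second_countable_topology}"
  assumes L: "0 < Lam p"
    and f [measurable]: "f \<in> borel_measurable (borel \<Otimes>\<^sub>M (Omega \<Otimes>\<^sub>M Omega))"
    and B: "\<And>z. norm (f z) \<le> B"
  shows "(\<integral>\<omega>. (if fst (\<omega> []) / Lam p \<le> t
        then f ((fst (\<omega> []) / Lam p, draw p (snd (\<omega> []))), subtree False \<omega>, subtree True \<omega>) else 0) \<partial>Omega) =
    (\<integral>s. indicator {0..t} s *\<^sub>R exp (- (Lam p * s)) *\<^sub>R
       (\<integral>H. indicator {H. hit p H} H *\<^sub>R (\<integral>\<omega>0. \<integral>\<omega>1. f ((s, H), \<omega>0, \<omega>1) \<partial>Omega \<partial>Omega) \<partial>lines) \<partial>lborel)"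
proof -
  have [measurable]: "(fst :: real \<times> hplane \<Rightarrow> _) \<in> borel_measurable borel"
    by (intro borel_measurable_continuous_onI continuous_intros)
  have m: "(\<lambda>z. if fst (fst z) \<le> t then f z else 0) \<in> borel_measurable (borel \<Otimes>\<^sub>M (Omega \<Otimes>\<^sub>M Omega))"
    by measurable
  have "norm (if fst (fst z) \<le> t then f z else 0) \<le> B" for z
    using B[of z] order_trans[OF norm_ge_zero B[of z]] by auto
  from integral_root[OF L m this]
  have "(\<integral>\<omega>. (if fst (\<omega> []) / Lam p \<le> t
        then f ((fst (\<omega> []) / Lam p, draw p (snd (\<omega> []))), subtree False \<omega>, subtree True \<omega>) else 0) \<partial>Omega) =
    (\<integral>s. indicator {0..} s *\<^sub>R exp (- (Lam p * s)) *\<^sub>R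
       (\<integral>H. indicator {H. hit p H} H *\<^sub>R (\<integral>\<omega>0. \<integral>\<omega>1. (if s \<le> t then f ((s, H), \<omega>0, \<omega>1) else 0) \<partial>Omega \<partial>Omega) \<partial>lines) \<partial>lborel)"
    by simp
  also have "\<dots> = (\<integral>s. indicator {0..t} s *\<^sub>R exp (- (Lam p * s)) *\<^sub>R
       (\<integral>H. indicator {H. hit p H} H *\<^sub>R (\<integral>\<omega>0. \<integral>\<omega>1. f ((s, H), \<omega>0, \<omega>1) \<partial>Omega \<partial>Omega) \<partial>lines) \<partial>lborel)"
    by (intro Bochner_Integration.integral_cong refl) (auto simp: indicator_def)
  finally show ?thesis .
qed

text \<open>Subtracting 1 makes the integrand vanish when the root cell survives beyond
  \<open>t\<close>, so only splits up to \<open>t\<close> enter. Given the first split, independence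
  of the subtrees makes the characteristic functions of the children multiply.\<close>

lemma chi_Suc:
  assumes L: "0 < Lam p"
  shows "chi (Suc n) \<theta> t p - 1 = (\<integral>s. indicator {0..t} s *\<^sub>R exp (- (Lam p * s)) *\<^sub>R
       (\<integral>H. indicator {H. hit p H} H *\<^sub>R
          (iexp (\<theta> * ell p H) * (chi n \<theta> (t - s) (child False H p) * chi n \<theta> (t - s) (child True H p)) - 1) \<partial>lines) \<partial>lborel)"
proof -
  define f where "f = (\<lambda>z :: (real \<times> hplane) \<times> (bool list \<Rightarrow> node_rand) \<times> (bool list \<Rightarrow> node_rand).
    iexp (\<theta> * ell p (snd (fst z))) * (iexp (\<theta> * X n (t - fst (fst z)) (child False (snd (fst z)) p) (fst (snd z))) *
     iexp (\<theta> * X n (t - fst (fst z)) (child True (snd (fst z)) p) (snd (snd z)))) - 1)"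
  have [measurable]: "(fst :: real \<times> hplane \<Rightarrow> _) \<in> borel_measurable borel" "(snd :: real \<times> hplane \<Rightarrow> _) \<in> borel_measurable borel"
    by (intro borel_measurable_continuous_onI continuous_intros)+
  have fm: "f \<in> borel_measurable (borel \<Otimes>\<^sub>M (Omega \<Otimes>\<^sub>M Omega))" unfolding f_def by measurable
  have fB: "norm (f z) \<le> 2" for z
    unfolding f_def by (rule order_trans[OF norm_triangle_ineq4]) (simp add: norm_mult)
  have int: "integrable Omega (\<lambda>\<omega>. iexp (\<theta> * X (Suc n) t p \<omega>))" by (rule integrable_iexp_X)
  have "chi (Suc n) \<theta> t p - 1 = (\<integral>\<omega>. iexp (\<theta> * X (Suc n) t p \<omega>) - 1 \<partial>Omega)"
    unfolding chi_def using int by (subst Bochner_Integration.integral_diff) (auto simp: Omega.prob_space[simplified])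
  also have "\<dots> = (\<integral>\<omega>. (if fst (\<omega> []) / Lam p \<le> t
        then f ((fst (\<omega> []) / Lam p, draw p (snd (\<omega> []))), subtree False \<omega>, subtree True \<omega>) else 0) \<partial>Omega)"
    by (intro Bochner_Integration.integral_cong refl) (auto simp: f_def Let_def distrib_left exp_add mult.assoc)
  also have "\<dots> = (\<integral>s. indicator {0..t} s *\<^sub>R exp (- (Lam p * s)) *\<^sub>R
       (\<integral>H. indicator {H. hit p H} H *\<^sub>R (\<integral>\<omega>0. \<integral>\<omega>1. f ((s, H), \<omega>0, \<omega>1) \<partial>Omega \<partial>Omega) \<partial>lines) \<partial>lborel)"
    by (rule integral_root_before[OF L fm fB])
  also have "\<dots> = (\<integral>s. indicator {0..t} s *\<^sub>R exp (- (Lam p * s)) *\<^sub>R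
       (\<integral>H. indicator {H. hit p H} H *\<^sub>R
          (iexp (\<theta> * ell p H) * (chi n \<theta> (t - s) (child False H p) * chi n \<theta> (t - s) (child True H p)) - 1) \<partial>lines) \<partial>lborel)"
  proof -
    have "(\<integral>\<omega>0. \<integral>\<omega>1. f ((s, H), \<omega>0, \<omega>1) \<partial>Omega \<partial>Omega) =
       iexp (\<theta> * ell p H) * (chi n \<theta> (t - s) (child False H p) * chi n \<theta> (t - s) (child True H p)) - 1" for s H
    proof -
      have "(\<integral>\<omega>1. f ((s, H), \<omega>0, \<omega>1) \<partial>Omega) =
        iexp (\<theta> * ell p H) * (iexp (\<theta> * X n (t - s) (child False H p) \<omega>0) * chi n \<theta> (t - s) (child True H p)) - 1" for \<omega>0
        unfolding f_def chi_def using integrable_iexp_X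
        by (subst Bochner_Integration.integral_diff) (auto simp: Omega.prob_space[simplified] intro!: integrable_mult_right)
      then have "(\<integral>\<omega>0. \<integral>\<omega>1. f ((s, H), \<omega>0, \<omega>1) \<partial>Omega \<partial>Omega) =
        (\<integral>\<omega>0. iexp (\<theta> * ell p H) * (iexp (\<theta> * X n (t - s) (child False H p) \<omega>0) * chi n \<theta> (t - s) (child True H p)) - 1 \<partial>Omega)"
        by simp
      also have "\<dots> = iexp (\<theta> * ell p H) * (chi n \<theta> (t - s) (child False H p) * chi n \<theta> (t - s) (child True H p)) - 1"
        unfolding chi_def[of n \<theta> "t - s" "child False H p"] using integrable_iexp_X
        by (subst Bochner_Integration.integral_diff) (auto simp: Omega.prob_space[simplified] intro!: integrable_mult_right integrable_mult_left)
      finally show ?thesis .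
    qed
    then show ?thesis by simp
  qed
  finally show ?thesis .
qed

text \<open>The minimum with \<open>2 * \<rho>\<close> changes nothing for unit normals, hence
  nothing for drawn lines. It makes the integrand bounded for all \<open>H\<close>, as the
  first-split formula requires.\<close>

lemma mean_Suc:
  assumes L: "0 < Lam p"
  shows "mean (Suc n) t p = (\<integral>s. indicator {0..t} s *\<^sub>R exp (- (Lam p * s)) *\<^sub>R
       (\<integral>H. indicator {H. hit p H} H *\<^sub>R
          (min (ell p H) (2 * \<rho>) + mean n (t - s) (child False H p) + mean n (t - s) (child True H p)) \<partial>lines) \<partial>lborel)"
proof -
  define f where "f = (\<lambda>z :: (real \<times> hplane) \<times> (bool list \<Rightarrow> node_rand) \<times> (bool list \<Rightarrow> node_rand).
    min (ell p (snd (fst z))) (2 * \<rho>) + X n (t - fst (fst z)) (child False (snd (fst z)) p) (fst (snd z)) +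
     X n (t - fst (fst z)) (child True (snd (fst z)) p) (snd (snd z)))"
  have [measurable]: "(fst :: real \<times> hplane \<Rightarrow> _) \<in> borel_measurable borel" "(snd :: real \<times> hplane \<Rightarrow> _) \<in> borel_measurable borel"
    by (intro borel_measurable_continuous_onI continuous_intros)+
  have fm: "f \<in> borel_measurable (borel \<Otimes>\<^sub>M (Omega \<Otimes>\<^sub>M Omega))" unfolding f_def by measurable
  have fB: "norm (f z) \<le> 2 * \<rho> + (2 ^ n - 1) * (2 * \<rho>) + (2 ^ n - 1) * (2 * \<rho>)" for z
  proof -
    have "0 \<le> min (ell p H) (2 * \<rho>)" for H using rho_pos by simp
    then have "norm (f z) = f z" by (simp add: f_def)
    also have "\<dots> \<le> 2 * \<rho> + (2 ^ n - 1) * (2 * \<rho>) + (2 ^ n - 1) * (2 * \<rho>)"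
      unfolding f_def by (intro add_mono X_le) auto
    finally show ?thesis .
  qed
  have "mean (Suc n) t p = (\<integral>\<omega>. (if fst (\<omega> []) / Lam p \<le> t
        then f ((fst (\<omega> []) / Lam p, draw p (snd (\<omega> []))), subtree False \<omega>, subtree True \<omega>) else 0) \<partial>Omega)"
    unfolding mean_def
    by (intro Bochner_Integration.integral_cong refl) (auto simp: f_def Let_def min_absorb1 ell_draw_le)
  also have "\<dots> = (\<integral>s. indicator {0..t} s *\<^sub>R exp (- (Lam p * s)) *\<^sub>R
       (\<integral>H. indicator {H. hit p H} H *\<^sub>R (\<integral>\<omega>0. \<integral>\<omega>1. f ((s, H), \<omega>0, \<omega>1) \<partial>Omega \<partial>Omega) \<partial>lines) \<partial>lborel)"
    by (rule integral_root_before[OF L fm fB])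
  also have "\<dots> = (\<integral>s. indicator {0..t} s *\<^sub>R exp (- (Lam p * s)) *\<^sub>R
       (\<integral>H. indicator {H. hit p H} H *\<^sub>R
          (min (ell p H) (2 * \<rho>) + mean n (t - s) (child False H p) + mean n (t - s) (child True H p)) \<partial>lines) \<partial>lborel)"
  proof -
    have "(\<integral>\<omega>0. \<integral>\<omega>1. f ((s, H), \<omega>0, \<omega>1) \<partial>Omega \<partial>Omega) =
       min (ell p H) (2 * \<rho>) + mean n (t - s) (child False H p) + mean n (t - s) (child True H p)" for s H
      unfolding f_def mean_def using integrable_X by (simp add: Omega.prob_space[simplified])
    then show ?thesis by simp
  qed
  finally show ?thesis .
qed

end

text \<open>Shape of the truncation error: one more generation means one more time integration at
  rate \<open>c\<close>.\<close>

lemma power_fact_deriv: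
  fixes c :: real
  shows "((\<lambda>s. (c * s) ^ Suc n / fact (Suc n)) has_real_derivative c * ((c * s) ^ n / fact n)) (at s within S)"
proof -
  have "((\<lambda>s. (c * s) ^ Suc n / fact (Suc n)) has_real_derivative real (Suc n) * (c * s) ^ n * c / fact (Suc n)) (at s within S)"
    by (rule derivative_eq_intros refl | simp)+
  moreover have "real (Suc n) * (c * s) ^ n * c / fact (Suc n) = c * ((c * s) ^ n / fact n)"
    by (simp add: fact_Suc del: of_nat_Suc)
  ultimately show ?thesis by (simp only:)
qed

section \<open>Induction over the generations of the splitting tree\<close>

context convex_window
begin

lemma gauss_deriv:
  assumes "s \<in> {0..t}"
  shows "((\<lambda>s. gauss \<theta> s p) has_vector_derivative
     gauss \<theta> s p * (\<i> * of_real (\<theta> * area p) - of_real (\<theta>^2 / 2 * V' s p))) (at s within {0..t})"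
proof -
  have V: "((\<lambda>s. V s p) has_vector_derivative V' s p) (at s within {0..t})"
    using V_deriv[OF assms] by (simp add: has_real_derivative_iff_has_vector_derivative)
  have 1: "((\<lambda>s. \<i> * of_real (\<theta> * (s * area p)) + of_real (- (\<theta>^2 * V s p / 2))) has_vector_derivative
     \<i> * of_real (\<theta> * area p) - of_real (\<theta>^2 / 2 * V' s p)) (at s within {0..t})"
  proof -
    have "((\<lambda>s. of_real (\<theta> * (s * area p)) :: complex) has_vector_derivative of_real (\<theta> * area p)) (at s within {0..t})"
      by (intro has_vector_derivative_of_real) (auto intro!: derivative_eq_intros simp: has_real_derivative_iff_has_vector_derivative[symmetric])
    moreover have "((\<lambda>s. of_real (- (\<theta>^2 * V s p / 2)) :: complex) has_vector_derivative of_real (- (\<theta>^2 * V' s p / 2))) (at s within {0..t})"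
      using V_deriv[OF assms, of p]
      by (intro has_vector_derivative_of_real) (auto intro!: derivative_eq_intros simp: has_real_derivative_iff_has_vector_derivative[symmetric])
    ultimately have "((\<lambda>s. \<i> * of_real (\<theta> * (s * area p)) + of_real (- (\<theta>^2 * V s p / 2))) has_vector_derivative
       \<i> * of_real (\<theta> * area p) + of_real (- (\<theta>^2 * V' s p / 2))) (at s within {0..t})"
      by (intro has_vector_derivative_add has_vector_derivative_mult_right)
    then show ?thesis by simp
  qed
  have g: "gauss \<theta> s p = exp (\<i> * of_real (\<theta> * (s * area p)) + of_real (- (\<theta>^2 * V s p / 2)))" for s
    by (simp only: gauss_def exp_add exp_of_real)
  have "(exp \<circ> (\<lambda>s. \<i> * of_real (\<theta> * (s * area p)) + of_real (- (\<theta>^2 * V s p / 2))) has_vector_derivative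
     (\<i> * of_real (\<theta> * area p) - of_real (\<theta>^2 / 2 * V' s p)) *
     exp (\<i> * of_real (\<theta> * (s * area p)) + of_real (- (\<theta>^2 * V s p / 2)))) (at s within {0..t})"
    by (rule field_vector_diff_chain_within[OF 1]) (rule DERIV_exp[THEN has_field_derivative_at_within])
  then show ?thesis unfolding g by (simp add: o_def mult.commute)
qed

lemma continuous_gauss: "continuous_on {0..t} (\<lambda>s. gauss \<theta> s p)"
  unfolding continuous_on_eq_continuous_within
  using has_vector_derivative_continuous[OF gauss_deriv] by blast

lemma gauss_0 [simp]: "gauss \<theta> 0 p = 1"
  by (simp add: gauss_def)

text \<open>Telescoping in the unit disc: the errors of the two children add up and are not
  amplified.\<close>

lemma norm_diff_mult_le:
  fixes a b c d :: complex
  assumes "cmod b \<le> 1" "cmod c \<le> 1"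
  shows "cmod (a * b - c * d) \<le> cmod (a - c) + cmod (b - d)"
proof -
  have "a * b - c * d = (a - c) * b + c * (b - d)" by (simp add: algebra_simps)
  also have "cmod \<dots> \<le> cmod (a - c) * cmod b + cmod c * cmod (b - d)"
    by (metis norm_mult norm_triangle_ineq)
  also have "\<dots> \<le> cmod (a - c) * 1 + 1 * cmod (b - d)"
    using assms by (intro add_mono mult_mono) auto
  finally show ?thesis by simp
qed

text \<open>The phase factorises because the area is additive; \<open>V\<close> is additive up to
  the drop \<open>Vsep\<close>, which leaves the last factor.\<close>

lemma gauss_split:
  assumes "0 \<le> s" "norm (fst H) = 1"
  shows "gauss \<theta> s (child False H p) * gauss \<theta> s (child True H p) =
    gauss \<theta> s p * of_real (exp (\<theta>^2 * Vsep s p H / 2))"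
proof -
  let ?m = "child False H p" and ?q = "child True H p"
  have 1: "iexp (\<theta> * (s * area p)) = iexp (\<theta> * (s * area ?m)) * iexp (\<theta> * (s * area ?q))"
    unfolding exp_add[symmetric] by (subst area_split[OF assms(2), of p]) (simp add: algebra_simps)
  have "exp (- (\<theta>^2 * V s p / 2)) * exp (\<theta>^2 * Vsep s p H / 2) = exp (- (\<theta>^2 * V s ?m / 2)) * exp (- (\<theta>^2 * V s ?q / 2))"
    unfolding exp_add[symmetric] by (subst V_split[OF assms, of p]) (simp add: algebra_simps add_divide_distrib)
  then have 2: "of_real (exp (- (\<theta>^2 * V s p / 2))) * of_real (exp (\<theta>^2 * Vsep s p H / 2)) =
      (of_real (exp (- (\<theta>^2 * V s ?m / 2))) * of_real (exp (- (\<theta>^2 * V s ?q / 2))) :: complex)"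
    by (metis of_real_mult)
  have "gauss \<theta> s p * of_real (exp (\<theta>^2 * Vsep s p H / 2)) =
     iexp (\<theta> * (s * area p)) * (of_real (exp (- (\<theta>^2 * V s p / 2))) * of_real (exp (\<theta>^2 * Vsep s p H / 2)))"
    unfolding gauss_def by (simp only: mult.assoc)
  also have "\<dots> = gauss \<theta> s ?m * gauss \<theta> s ?q"
    unfolding 1 2 gauss_def by (simp only: mult_ac)
  finally show ?thesis ..
qed

text \<open>One-step error of the Gaussian ansatz. The logarithm-free bound on \<open>Vsep\<close>
  gives \<open>b \<le> pi * \<delta> * \<bar>a\<bar>\<close>, so all terms of
  \<open>exp_perturbation\<close> are of order \<open>\<delta> * a^2\<close>. With pi replaced by 4,
  and \<open>\<delta> \<le> 1\<close> used to reduce \<open>\<delta>^2\<close> to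
  \<open>\<delta>\<close>, they contribute 1, 16 and 4, which sum to 21.\<close>

lemma split_perturbation:
  fixes p :: "nat \<Rightarrow> hplane"
  assumes \<theta>: "\<bar>\<theta>\<bar> * \<rho> \<le> 1" and s: "0 \<le> s" and n: "norm (fst H) = 1"
  defines "g \<equiv> gauss \<theta> s p"
  shows "cmod (iexp (\<theta> * ell p H) * (gauss \<theta> s (child False H p) * gauss \<theta> s (child True H p)) - g -
      g * (\<i> * of_real (\<theta> * ell p H) - of_real (\<theta>^2 / 2 * (ell p H ^ 2 - Vsep s p H))))
    \<le> 21 * \<bar>\<theta>\<bar>^3 * \<rho> * ell p H ^ 2"
proof -
  define a b v \<delta> where "a = \<theta> * ell p H" and "b = \<theta>^2 * Vsep s p H / 2" and "v = \<theta>^2 * V s p / 2" and "\<delta> = \<bar>\<theta>\<bar> * \<rho>"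
  have \<delta>: "0 \<le> \<delta>" "\<delta> \<le> 1" using \<theta> rho_pos by (auto simp: \<delta>_def)
  have "Vsep s p H \<le> V s p" using V_split[OF s n, of p] V_nonneg[of s] by simp
  then have bv: "0 \<le> b" "b \<le> v" by (auto simp: b_def v_def mult_left_mono divide_right_mono)
  have a1: "\<bar>a\<bar> \<le> 2 * \<delta>"
  proof -
    have "\<bar>a\<bar> = \<bar>\<theta>\<bar> * ell p H" by (simp add: a_def abs_mult)
    also have "\<dots> \<le> \<bar>\<theta>\<bar> * (2 * \<rho>)" using emeasure_chord(2)[OF n, of p] by (intro mult_left_mono) auto
    finally show ?thesis by (simp add: \<delta>_def)
  qed
  have b1: "b \<le> 4 * \<delta> * \<bar>a\<bar>"
  proof -
    have "b \<le> \<theta>^2 * (2 * pi * \<rho> * ell p H) / 2"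
      unfolding b_def using Vsep_ennreal(2)[OF s n, of p] by (intro divide_right_mono mult_left_mono) auto
    also have "\<dots> = pi * \<delta> * \<bar>a\<bar>"
      by (simp add: \<delta>_def a_def abs_mult power2_eq_square)
    also have "\<dots> \<le> 4 * \<delta> * \<bar>a\<bar>" using pi_less_4 \<delta> by (intro mult_right_mono) auto
    finally show ?thesis .
  qed
  have "\<bar>a\<bar>^3 / 6 + b^2 + \<bar>a\<bar> * b \<le> 21 * \<delta> * a^2"
  proof -
    have "\<bar>a\<bar>^3 = \<bar>a\<bar> * a^2" by (simp add: power3_eq_cube power2_eq_square)
    also have "\<dots> \<le> 2 * \<delta> * a^2" using a1 by (intro mult_right_mono) auto
    finally have 1: "\<bar>a\<bar>^3 / 6 \<le> \<delta> * a^2"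
      using mult_nonneg_nonneg[OF \<delta>(1) zero_le_power2[of a]] by linarith
    have "\<bar>a\<bar> * b \<le> \<bar>a\<bar> * (4 * \<delta> * \<bar>a\<bar>)" using b1 by (intro mult_left_mono) auto
    also have "\<dots> = 4 * \<delta> * (\<bar>a\<bar> * \<bar>a\<bar>)" by (simp only: mult_ac)
    also have "\<dots> = 4 * \<delta> * a^2" by (simp add: power2_eq_square)
    finally have 2: "\<bar>a\<bar> * b \<le> 4 * \<delta> * a^2" .
    have "b^2 \<le> (4 * \<delta> * \<bar>a\<bar>)^2" using b1 bv by (intro power_mono) auto
    also have "\<dots> = 16 * \<delta> * a^2 * \<delta>" by (simp add: power_mult_distrib power2_eq_square)
    also have "\<dots> \<le> 16 * \<delta> * a^2 * 1" using \<delta> by (intro mult_left_mono) auto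
    finally have "b^2 \<le> 16 * \<delta> * a^2" by simp
    with 1 2 show ?thesis by simp
  qed
  also have "21 * \<delta> * a^2 = 21 * \<bar>\<theta>\<bar>^3 * \<rho> * ell p H ^ 2"
  proof -
    have "\<theta>^2 = \<bar>\<theta>\<bar>^2" by simp
    then show ?thesis by (simp only: \<delta>_def a_def power_mult_distrib) (simp add: power3_eq_cube power2_eq_square)
  qed
  finally have bound: "\<bar>a\<bar>^3 / 6 + b^2 + \<bar>a\<bar> * b \<le> 21 * \<bar>\<theta>\<bar>^3 * \<rho> * ell p H ^ 2" .
  have g: "g = iexp (\<theta> * (s * area p)) * of_real (exp (- v))" by (simp add: g_def gauss_def v_def)
  have q: "\<theta>^2 / 2 * (ell p H ^ 2 - Vsep s p H) = a^2 / 2 - b"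
    by (simp add: a_def b_def power_mult_distrib algebra_simps)
  have "iexp (\<theta> * ell p H) * (gauss \<theta> s (child False H p) * gauss \<theta> s (child True H p)) - g -
      g * (\<i> * of_real (\<theta> * ell p H) - of_real (\<theta>^2 / 2 * (ell p H ^ 2 - Vsep s p H))) =
    iexp (\<theta> * (s * area p)) * (of_real (exp (- v)) * (iexp a * of_real (exp b) - (1 + \<i> * of_real a - of_real (a^2 / 2) + of_real b)))"
    unfolding gauss_split[OF s n] g_def[symmetric] q a_def[symmetric] b_def[symmetric] g
    by (simp add: algebra_simps)
  also have "cmod \<dots> = cmod (of_real (exp (- v)) * (iexp a * of_real (exp b) - (1 + \<i> * of_real a - of_real (a^2 / 2) + of_real b)))"
    by (simp only: norm_mult norm_exp_i_times mult_1)
  also have "\<dots> \<le> \<bar>a\<bar>^3 / 6 + b^2 + \<bar>a\<bar> * b" by (rule exp_perturbation[OF bv])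
  finally show ?thesis using bound by simp
qed

lemma hit_in_sets_lines [measurable]: "{H. hit p H} \<in> sets lines"
  by simp

lemma integral_hit_const: "(\<integral>H. indicator {H. hit p H} H *\<^sub>R c \<partial>lines) = Lam p *\<^sub>R (c :: 'b::{banach, second_countable_topology})"
  "integrable lines (\<lambda>H. indicator {H. hit p H} H *\<^sub>R c)"
proof -
  show "integrable lines (\<lambda>H. indicator {H. hit p H} H *\<^sub>R c)"
  proof (rule lines.integrable_const_bound[of _ "norm c"])
    show "AE H in lines. norm (indicator {H. hit p H} H *\<^sub>R c) \<le> norm c" by (auto simp: indicator_def)
  qed measurable
  show "(\<integral>H. indicator {H. hit p H} H *\<^sub>R c \<partial>lines) = Lam p *\<^sub>R c"
    by (subst integral_scaleR_left) (auto simp: Lam_def lines.emeasure_eq_measure)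
qed

text \<open>The error bound is itself a supersolution of the first-split equation. Its part with
  \<open>V\<close> reproduces the source of the one-step errors by the equation of \<open>V\<close>;
  the other part carries the trivial bound 2 of generation 0 through the recursion.\<close>

lemma chi_gauss:
  assumes \<theta>: "\<bar>\<theta>\<bar> * \<rho> \<le> 1" and t: "0 \<le> t"
  shows "cmod (chi n \<theta> t p - gauss \<theta> t p) \<le> 21 * \<bar>\<theta>\<bar>^3 * \<rho> * V t p + 2 * ((4 * \<rho> * t) ^ n / fact n)"
  using t
proof (induction n arbitrary: t p)
  case 0
  have "cmod (chi 0 \<theta> t p - gauss \<theta> t p) \<le> cmod (chi 0 \<theta> t p) + cmod (gauss \<theta> t p)"
    by (rule norm_triangle_ineq4)
  also have "\<dots> \<le> 1 + 1" by (intro add_mono norm_chi_le norm_gauss_le 0)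
  finally show ?case using rho_pos by (simp add: add_increasing)
next
  case (Suc n)
  define \<eta> where "\<eta> = 21 * \<bar>\<theta>\<bar>^3 * \<rho>"
  have \<eta>: "0 \<le> \<eta>" using rho_pos by (simp add: \<eta>_def)
  show ?case
  proof (cases "Lam p = 0")
    \<comment> \<open>Degenerate cells are set apart because the first-split formula needs a
      positive rate; here both functions equal 1.\<close>
    case True
    have "chi (Suc n) \<theta> t p = 1"
      unfolding chi_def X_eq_0_of_Lam[OF True] by (simp add: Omega.prob_space[simplified])
    moreover have "gauss \<theta> t p = 1"
      by (simp add: gauss_def area_eq_0_of_Lam[OF True] V_eq_0_of_Lam[OF True])
    ultimately show ?thesis using rho_pos Suc.prems by (simp add: V_eq_0_of_Lam[OF True])
  next
    case False
    then have L: "0 < Lam p" using Lam_nonneg[of p] by linarith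
    \<comment> \<open>The rate \<open>4 * \<rho>\<close> is twice the bound
      \<open>2 * \<rho>\<close> for \<open>Lam p\<close>, since both children inherit the truncation
      error at each split.\<close>
    define b where "b = (\<lambda>s. \<eta> * V s p + 2 * ((4 * \<rho> * s) ^ Suc n / fact (Suc n)))"
    define b' where "b' = (\<lambda>s. \<eta> * V' s p + 4 * \<rho> * (2 * ((4 * \<rho> * s) ^ n / fact n)))"
    define k where "k = (\<lambda>s H. iexp (\<theta> * ell p H) * (chi n \<theta> s (child False H p) * chi n \<theta> s (child True H p)) - 1)"
    define K where "K = (\<lambda>s. \<integral>H. indicator {H. hit p H} H *\<^sub>R k s H \<partial>lines)"
    define y' where "y' = (\<lambda>s. gauss \<theta> s p * (\<i> * of_real (\<theta> * area p) - of_real (\<theta>^2 / 2 * V' s p)))"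
    have km: "(\<lambda>z. k (fst z) (snd z)) \<in> borel_measurable (borel \<Otimes>\<^sub>M lines)"
      unfolding k_def by measurable
    have km1: "k s \<in> borel_measurable lines" for s
      using measurable_compose[OF measurable_Pair1' km, of s] by simp
    have kB: "cmod (k s H) \<le> 2" for s H
    proof -
      have "cmod (k s H) \<le> cmod (iexp (\<theta> * ell p H) * (chi n \<theta> s (child False H p) * chi n \<theta> s (child True H p))) + cmod 1"
        unfolding k_def by (rule norm_triangle_ineq4)
      also have "\<dots> \<le> 1 + 1"
        using norm_chi_le by (auto simp: norm_mult intro!: mult_le_one)
      finally show ?thesis by simp
    qed
    have ik: "integrable lines (\<lambda>H. indicator {H. hit p H} H *\<^sub>R k s H)" for s
    proof (rule lines.integrable_const_bound[of _ 2])
      show "AE H in lines. norm (indicator {H. hit p H} H *\<^sub>R k s H) \<le> 2" using kB by (auto simp: indicator_def)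
    qed (use km1 in measurable)
    have "norm ((\<integral>s. indicator {0..t} s *\<^sub>R exp (- (Lam p * s)) *\<^sub>R K (t - s) \<partial>lborel) - (gauss \<theta> t p - 1)) \<le> b t"
    proof (rule mild_comparison[where y'=y' and b'=b' and C="2 * Lam p"])
      show "0 \<le> t" by fact
      show "((\<lambda>s. gauss \<theta> s p - 1) has_vector_derivative y' s) (at s within {0..t})" if "s \<in> {0..t}" for s
        unfolding y'_def using gauss_deriv[OF that] by (auto intro!: derivative_eq_intros)
      show "continuous_on {0..t} y'" unfolding y'_def
        by (intro continuous_intros continuous_gauss V'_continuous)
      show "(b has_real_derivative b' s) (at s within {0..t})" if "s \<in> {0..t}" for s
      proof -
        have "(b has_real_derivative \<eta> * V' s p + 2 * (4 * \<rho> * ((4 * \<rho> * s) ^ n / fact n))) (at s within {0..t})"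
          unfolding b_def by (intro DERIV_add DERIV_cmult V_deriv[OF that] power_fact_deriv)
        then show ?thesis by (simp add: b'_def mult_ac)
      qed
      show "continuous_on {0..t} b'" unfolding b'_def
        by (intro continuous_intros V'_continuous) auto
      show "b 0 = 0" by (simp add: b_def)
      show "K \<in> borel_measurable borel" unfolding K_def
        using km by (intro lines.borel_measurable_lebesgue_integral) (auto simp: split_def)
      show "norm (K s) \<le> 2 * Lam p" for s
      proof -
        have "norm (K s) \<le> (\<integral>H. norm (indicator {H. hit p H} H *\<^sub>R k s H) \<partial>lines)"
          unfolding K_def by (rule integral_norm_bound)
        also have "\<dots> \<le> (\<integral>H. indicator {H. hit p H} H *\<^sub>R 2 \<partial>lines)"
          using ik[of s] integral_hit_const(2)[of p "2::real"] kB
          by (intro integral_mono integrable_norm) (auto simp: indicator_def)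
        finally show ?thesis by (simp only: integral_hit_const) (simp add: mult.commute)
      qed
    next
      fix s assume "s \<in> {0..t}"
      then have s: "0 \<le> s" by simp
      define g where "g = gauss \<theta> s p"
      define E where "E = 2 * ((4 * \<rho> * s) ^ n / fact n)"
      have E0: "0 \<le> E" using s rho_pos by (simp add: E_def)
      let ?q = "\<lambda>H. g * (\<i> * of_real (\<theta> * ell p H) - of_real (\<theta>^2 / 2 * (ell p H ^ 2 - Vsep s p H)))"
      \<comment> \<open>Pointwise bound for the error source, arranged so that by
        \<open>V'_eq\<close> it integrates to
        \<open>\<eta> * V' s p + Lam p * (\<eta> * V s p + 2 * E)\<close>.\<close>
      let ?B = "\<lambda>H. \<eta> * (ell p H ^ 2 - Vsep s p H) + indicator {H. hit p H} H *\<^sub>R (\<eta> * V s p + 2 * E)"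
      have iV: "integrable lines (\<lambda>H. ell p H ^ 2 - Vsep s p H)"
        using integrable_ell(2) integrable_Vsep[OF s] by simp
      have iq: "integrable lines ?q"
        using integrable_ell iV integrable_Vsep[OF s] by (intro integrable_mult_right Bochner_Integration.integrable_diff integrable_of_real) simp_all
      have q: "(\<integral>H. ?q H \<partial>lines) = y' s"
      proof -
        have "(\<integral>H. ?q H \<partial>lines) = g * (\<integral>H. \<i> * of_real (\<theta> * ell p H) - of_real (\<theta>^2 / 2 * (ell p H ^ 2 - Vsep s p H)) \<partial>lines)"
          by (rule integral_mult_right_zero)
        also have "(\<integral>H. \<i> * of_real (\<theta> * ell p H) - of_real (\<theta>^2 / 2 * (ell p H ^ 2 - Vsep s p H)) \<partial>lines) =
          (\<integral>H. \<i> * of_real (\<theta> * ell p H) \<partial>lines) - (\<integral>H. of_real (\<theta>^2 / 2 * (ell p H ^ 2 - Vsep s p H)) \<partial>lines)"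
          using integrable_ell iV integrable_Vsep[OF s] by (intro Bochner_Integration.integral_diff integrable_mult_right integrable_of_real) simp_all
        also have "(\<integral>H. \<i> * of_real (\<theta> * ell p H) \<partial>lines) = \<i> * of_real (\<theta> * area p)"
          by (simp only: integral_mult_right_zero integral_complex_of_real integral_ell)
        also have "(\<integral>H. of_real (\<theta>^2 / 2 * (ell p H ^ 2 - Vsep s p H)) \<partial>lines) = complex_of_real (\<theta>^2 / 2 * V' s p)"
          by (simp only: integral_mult_right_zero integral_complex_of_real V'_eq[OF s])
        finally show ?thesis by (simp add: y'_def g_def)
      qed
      have "norm (K s - (of_real (Lam p) * (g - 1) + y' s)) =
        norm (\<integral>H. indicator {H. hit p H} H *\<^sub>R k s H - (indicator {H. hit p H} H *\<^sub>R (g - 1) + ?q H) \<partial>lines)"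
      proof -
        have "(\<integral>H. indicator {H. hit p H} H *\<^sub>R k s H - (indicator {H. hit p H} H *\<^sub>R (g - 1) + ?q H) \<partial>lines) =
          K s - ((\<integral>H. indicator {H. hit p H} H *\<^sub>R (g - 1) \<partial>lines) + (\<integral>H. ?q H \<partial>lines))"
          unfolding K_def
          by (subst Bochner_Integration.integral_diff[OF ik Bochner_Integration.integrable_add[OF integral_hit_const(2) iq]],
              subst Bochner_Integration.integral_add[OF integral_hit_const(2) iq]) (rule refl)
        then show ?thesis unfolding q integral_hit_const by (simp only: scaleR_conv_of_real)
      qed
      also have "\<dots> \<le> (\<integral>H. norm (indicator {H. hit p H} H *\<^sub>R k s H - (indicator {H. hit p H} H *\<^sub>R (g - 1) + ?q H)) \<partial>lines)"
        by (rule integral_norm_bound)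
      also have "\<dots> \<le> (\<integral>H. ?B H \<partial>lines)"
      proof (rule integral_mono_AE)
        show "integrable lines (\<lambda>H. norm (indicator {H. hit p H} H *\<^sub>R k s H - (indicator {H. hit p H} H *\<^sub>R (g - 1) + ?q H)))"
          by (intro integrable_norm Bochner_Integration.integrable_diff Bochner_Integration.integrable_add ik iq integral_hit_const)
        show "integrable lines ?B"
          by (intro Bochner_Integration.integrable_add integrable_mult_right iV integral_hit_const)
        show "AE H in lines. norm (indicator {H. hit p H} H *\<^sub>R k s H - (indicator {H. hit p H} H *\<^sub>R (g - 1) + ?q H)) \<le> ?B H"
          using AE_lines_unit
        proof eventually_elim
          case n: (elim H)
          show ?case
          proof (cases "hit p H")
            case False
            then have "ell p H = 0" using n by (simp add: ell_eq_0)
            moreover have "Vsep s p H = 0" using Vsep_ennreal(2)[OF s n, of p] Vsep_nonneg[of s p H] calculation by simp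
            ultimately show ?thesis using False by simp
          next
            case True
            let ?m = "child False H p" and ?r = "child True H p"
            let ?gg = "gauss \<theta> s ?m * gauss \<theta> s ?r" and ?cc = "chi n \<theta> s ?m * chi n \<theta> s ?r"
            define qH where "qH = ?q H"
            have "indicator {H. hit p H} H *\<^sub>R k s H - (indicator {H. hit p H} H *\<^sub>R (g - 1) + qH) =
              iexp (\<theta> * ell p H) * (?cc - ?gg) + (iexp (\<theta> * ell p H) * ?gg - g - qH)"
              using True by (simp add: k_def right_diff_distrib)
            then have "norm (indicator {H. hit p H} H *\<^sub>R k s H - (indicator {H. hit p H} H *\<^sub>R (g - 1) + qH)) =
              norm (iexp (\<theta> * ell p H) * (?cc - ?gg) + (iexp (\<theta> * ell p H) * ?gg - g - qH))"
              by (simp only:)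
            also have "\<dots> \<le> norm (iexp (\<theta> * ell p H) * (?cc - ?gg)) + norm (iexp (\<theta> * ell p H) * ?gg - g - qH)"
              by (rule norm_triangle_ineq)
            also have "\<dots> \<le> (\<eta> * V s ?m + E + (\<eta> * V s ?r + E)) + \<eta> * ell p H ^ 2"
            proof (rule add_mono)
              have "norm (iexp (\<theta> * ell p H) * (?cc - ?gg)) = norm (?cc - ?gg)"
                by (simp only: norm_mult norm_exp_i_times mult_1)
              also have "\<dots> \<le> norm (chi n \<theta> s ?m - gauss \<theta> s ?m) + norm (chi n \<theta> s ?r - gauss \<theta> s ?r)"
                by (rule norm_diff_mult_le[OF norm_chi_le norm_gauss_le[OF s]])
              also have "\<dots> \<le> \<eta> * V s ?m + E + (\<eta> * V s ?r + E)"
                unfolding \<eta>_def E_def by (intro add_mono Suc.IH s)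
              finally show "norm (iexp (\<theta> * ell p H) * (?cc - ?gg)) \<le> \<eta> * V s ?m + E + (\<eta> * V s ?r + E)" .
              show "norm (iexp (\<theta> * ell p H) * ?gg - g - qH) \<le> \<eta> * ell p H ^ 2"
                unfolding \<eta>_def g_def qH_def by (rule split_perturbation[OF \<theta> s n])
            qed
            finally have *: "norm (indicator {H. hit p H} H *\<^sub>R k s H - (indicator {H. hit p H} H *\<^sub>R (g - 1) + qH)) \<le>
              (\<eta> * V s ?m + E + (\<eta> * V s ?r + E)) + \<eta> * ell p H ^ 2" .
            \<comment> \<open>By \<open>V_split\<close> the two children together carry
              \<open>\<eta> * V\<close> less the drop \<open>\<eta> * Vsep\<close>, and this drop is
              paired with the squared chord in \<open>?B\<close>.\<close>
            have "(\<eta> * V s ?m + E + (\<eta> * V s ?r + E)) + \<eta> * ell p H ^ 2 = ?B H"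
              using True V_split[OF s n, of p] by (simp add: distrib_left right_diff_distrib)
            with * show ?thesis unfolding qH_def by (simp only:)
          qed
        qed
      qed
      also have "\<dots> = \<eta> * V' s p + Lam p * (\<eta> * V s p + 2 * E)"
      proof -
        have "(\<integral>H. ?B H \<partial>lines) = (\<integral>H. \<eta> * (ell p H ^ 2 - Vsep s p H) \<partial>lines) + (\<integral>H. indicator {H. hit p H} H *\<^sub>R (\<eta> * V s p + 2 * E) \<partial>lines)"
          by (intro Bochner_Integration.integral_add integrable_mult_right iV integral_hit_const)
        then show ?thesis by (simp only: integral_mult_right_zero V'_eq[OF s] integral_hit_const) simp
      qed
      also have "\<dots> \<le> Lam p * b s + b' s"
      proof -
        have "Lam p * (2 * E) \<le> 2 * \<rho> * (2 * E)"
          using Lam_le[of p] E0 by (intro mult_right_mono) auto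
        moreover have "0 \<le> Lam p * (2 * ((4 * \<rho> * s) ^ Suc n / fact (Suc n)))"
          using s rho_pos by (intro mult_nonneg_nonneg) auto
        ultimately show ?thesis unfolding b_def b'_def E_def[symmetric] by (simp add: algebra_simps)
      qed
      finally show "norm (K s - (of_real (Lam p) * (gauss \<theta> s p - 1) + y' s)) \<le> Lam p * b s + b' s"
        unfolding g_def .
    qed simp
    moreover have "chi (Suc n) \<theta> t p - 1 = (\<integral>s. indicator {0..t} s *\<^sub>R exp (- (Lam p * s)) *\<^sub>R K (t - s) \<partial>lborel)"
      unfolding K_def k_def by (rule chi_Suc[OF L])
    moreover have "chi (Suc n) \<theta> t p - gauss \<theta> t p = chi (Suc n) \<theta> t p - 1 - (gauss \<theta> t p - 1)"
      by simp
    ultimately show ?thesis unfolding b_def \<eta>_def by (simp only:)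
  qed
qed

text \<open>The scheme of \<open>chi_gauss\<close> with the exact solution
  \<open>t * area p\<close>, whose source is the integral of the chord length. The one-step error is
  zero, so only the truncation error is left; at generation 0 it is \<open>t * area p\<close>, at
  most the area of \<open>W\<close>.\<close>

lemma mean_bound:
  assumes "0 \<le> t" "t \<le> 1"
  shows "\<bar>mean n t p - t * area p\<bar> \<le> measure lborel W * ((4 * \<rho> * t) ^ n / fact n)"
  using assms
proof (induction n arbitrary: t p)
  case 0
  have "area p \<le> measure lborel W"
    unfolding area_def using cell_subset emeasure_W_finite compact_imp_closed[OF compact_W]
    by (intro measure_mono_fmeasurable) (auto simp: fmeasurable_def)
  moreover have "t * area p \<le> 1 * area p" using 0 by (intro mult_right_mono) auto
  ultimately show ?case using 0 by (simp add: mean_def)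
next
  case (Suc n)
  define A where "A = measure lborel W"
  have A: "0 \<le> A" by (simp add: A_def)
  show ?case
  proof (cases "Lam p = 0")
    case True
    then show ?thesis using rho_pos Suc.prems
      by (simp add: mean_def X_eq_0_of_Lam[OF True] area_eq_0_of_Lam[OF True])
  next
    case False
    then have L: "0 < Lam p" using Lam_nonneg[of p] by linarith
    define b where "b = (\<lambda>s. A * ((4 * \<rho> * s) ^ Suc n / fact (Suc n)))"
    define b' where "b' = (\<lambda>s. A * (4 * \<rho> * ((4 * \<rho> * s) ^ n / fact n)))"
    define k where "k = (\<lambda>s H. min (ell p H) (2 * \<rho>) + mean n s (child False H p) + mean n s (child True H p))"
    define K where "K = (\<lambda>s. \<integral>H. indicator {H. hit p H} H *\<^sub>R k s H \<partial>lines)"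
    define D where "D = 2 * \<rho> + (2 ^ n - 1) * (2 * \<rho>) + (2 ^ n - 1) * (2 * \<rho>)"
    have km: "(\<lambda>z. k (fst z) (snd z)) \<in> borel_measurable (borel \<Otimes>\<^sub>M lines)"
      unfolding k_def by measurable
    have km1: "k s \<in> borel_measurable lines" for s
      using measurable_compose[OF measurable_Pair1' km, of s] by simp
    have m0: "0 \<le> mean n s q" "mean n s q \<le> (2 ^ n - 1) * (2 * \<rho>)" for s q
      unfolding mean_def using X_le integrable_X
      by (auto intro!: Omega.integral_le_const integral_nonneg_AE)
    have kB: "\<bar>k s H\<bar> \<le> D" for s H
    proof -
      have "0 \<le> min (ell p H) (2 * \<rho>)" using rho_pos by simp
      then have "\<bar>k s H\<bar> = k s H" using m0 by (simp add: k_def)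
      also have "\<dots> \<le> D" unfolding k_def D_def by (intro add_mono m0) auto
      finally show ?thesis .
    qed
    have D0: "0 \<le> D" using kB[of 0 undefined] by simp
    have ik: "integrable lines (\<lambda>H. indicator {H. hit p H} H *\<^sub>R k s H)" for s
    proof (rule lines.integrable_const_bound[of _ D])
      show "AE H in lines. norm (indicator {H. hit p H} H *\<^sub>R k s H) \<le> D" using kB D0 by (auto simp: indicator_def)
    qed (use km1 in measurable)
    have "norm ((\<integral>s. indicator {0..t} s *\<^sub>R exp (- (Lam p * s)) *\<^sub>R K (t - s) \<partial>lborel) - t * area p) \<le> b t"
    proof (rule mild_comparison[where y="\<lambda>t. t * area p" and y'="\<lambda>_. area p" and b'=b' and C="D * Lam p"])
      show "0 \<le> t" by fact
      show "((\<lambda>t. t * area p) has_vector_derivative area p) (at s within {0..t})" for s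
        by (auto intro!: derivative_eq_intros simp: has_real_derivative_iff_has_vector_derivative[symmetric])
      show "(b has_real_derivative b' s) (at s within {0..t})" for s
      proof -
        show ?thesis
          unfolding b_def b'_def by (intro DERIV_cmult power_fact_deriv)
      qed
      show "continuous_on {0..t} b'" unfolding b'_def by (intro continuous_intros) auto
      show "b 0 = 0" by (simp add: b_def)
      show "K \<in> borel_measurable borel" unfolding K_def
        using km by (intro lines.borel_measurable_lebesgue_integral) (auto simp: split_def)
      show "norm (K s) \<le> D * Lam p" for s
      proof -
        have "norm (K s) \<le> (\<integral>H. norm (indicator {H. hit p H} H *\<^sub>R k s H) \<partial>lines)"
          unfolding K_def by (rule integral_norm_bound)
        also have "\<dots> \<le> (\<integral>H. indicator {H. hit p H} H *\<^sub>R D \<partial>lines)"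
          using ik[of s] integral_hit_const(2)[of p D] kB
          by (intro integral_mono integrable_norm) (auto simp: indicator_def)
        finally show ?thesis by (simp only: integral_hit_const) (simp add: mult.commute)
      qed
    next
      fix s assume "s \<in> {0..t}"
      then have s: "0 \<le> s" "s \<le> 1" using Suc.prems by auto
      define E where "E = A * ((4 * \<rho> * s) ^ n / fact n)"
      have E0: "0 \<le> E" using s rho_pos A by (simp add: E_def)
      let ?h = "\<lambda>H. indicator {H. hit p H} H :: real"
      have e: "Lam p * (s * area p) + area p = (\<integral>H. ?h H *\<^sub>R (s * area p) + ell p H \<partial>lines)"
        by (subst Bochner_Integration.integral_add[OF integral_hit_const(2) integrable_ell(1)])
           (unfold integral_hit_const integral_ell, simp)
      have "norm (K s - (of_real (Lam p) * (s * area p) + area p)) =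
         \<bar>\<integral>H. ?h H *\<^sub>R k s H - (?h H *\<^sub>R (s * area p) + ell p H) \<partial>lines\<bar>"
        unfolding of_real_eq_id id_apply e K_def real_norm_def
        by (subst Bochner_Integration.integral_diff) (auto intro!: ik integral_hit_const integrable_ell simp del: real_scaleR_def)
      also have "\<dots> \<le> (\<integral>H. ?h H *\<^sub>R (2 * E) \<partial>lines)"
      proof (rule integral_abs_bound_AE)
        show "integrable lines (\<lambda>H. ?h H *\<^sub>R k s H - (?h H *\<^sub>R (s * area p) + ell p H))"
          by (intro Bochner_Integration.integrable_diff Bochner_Integration.integrable_add ik integral_hit_const integrable_ell)
        show "integrable lines (\<lambda>H. ?h H *\<^sub>R (2 * E))" by (rule integral_hit_const)
        show "AE H in lines. \<bar>?h H *\<^sub>R k s H - (?h H *\<^sub>R (s * area p) + ell p H)\<bar> \<le> ?h H *\<^sub>R (2 * E)"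
          using AE_lines_unit
        proof eventually_elim
          case n: (elim H)
          show ?case
          proof (cases "hit p H")
            case False
            then show ?thesis using n by (simp add: ell_eq_0)
          next
            case True
            have "\<bar>mean n s q - s * area q\<bar> \<le> E" for q
              unfolding E_def A_def using s by (rule Suc.IH)
            from this[of "child False H p"] this[of "child True H p"] show ?thesis
              using True area_split[OF n, of p] emeasure_chord(2)[OF n, of p]
              by (simp add: k_def min_absorb1 algebra_simps abs_le_iff)
          qed
        qed
      qed
      also have "\<dots> = Lam p * (2 * E)" by (unfold integral_hit_const, simp)
      also have "\<dots> \<le> 2 * \<rho> * (2 * E)"
        using Lam_le[of p] E0 by (intro mult_right_mono) auto
      also have "\<dots> = b' s" by (simp add: b'_def E_def)
      also have "\<dots> \<le> Lam p * b s + b' s"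
        using s rho_pos A by (simp add: b_def)
      finally show "norm (K s - (of_real (Lam p) * (s * area p) + area p)) \<le> Lam p * b s + b' s" .
    qed (auto intro!: continuous_intros)
    moreover have "mean (Suc n) t p = (\<integral>s. indicator {0..t} s *\<^sub>R exp (- (Lam p * s)) *\<^sub>R K (t - s) \<partial>lborel)"
      unfolding K_def k_def by (rule mean_Suc[OF L])
    ultimately show ?thesis by (simp add: b_def A_def)
  qed
qed

end

subsection \<open>The total edge length as a limit over generations\<close>

lemma finite_lists_less: "finite {v :: bool list. length v < n}"
proof -
  have "{v :: bool list. length v < n} \<subseteq> {v. set v \<subseteq> UNIV \<and> length v \<le> n}" by auto
  then show ?thesis by (rule finite_subset) (rule finite_lists_length_le, simp)
qed

text \<open>Nonempty addresses are sorted by their last entry, the branch taken at the root.\<close>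

lemma sum_lists_Suc:
  fixes g :: "bool list \<Rightarrow> real"
  shows "(\<Sum>v | length v < Suc n. g v) = g [] + (\<Sum>v | length v < n. g (v @ [False])) + (\<Sum>v | length v < n. g (v @ [True]))"
proof -
  let ?S = "{v :: bool list. length v < n}"
  let ?F = "(\<lambda>v. v @ [False]) ` ?S" and ?T = "(\<lambda>v. v @ [True]) ` ?S"
  have fin: "finite ?F" "finite ?T" using finite_lists_less by auto
  have "{v :: bool list. length v < Suc n} = {[]} \<union> (?F \<union> ?T)"
  proof
    show "{v :: bool list. length v < Suc n} \<subseteq> {[]} \<union> (?F \<union> ?T)"
    proof
      fix v :: "bool list" assume v: "v \<in> {v. length v < Suc n}"
      show "v \<in> {[]} \<union> (?F \<union> ?T)"
      proof (cases v rule: rev_cases)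
        case (snoc w b) then show ?thesis using v by (cases b) auto
      qed simp
    qed
  qed auto
  then have "(\<Sum>v | length v < Suc n. g v) = (\<Sum>v\<in>{[]} \<union> (?F \<union> ?T). g v)" by (rule arg_cong)
  also have "\<dots> = g [] + (\<Sum>v\<in>?F \<union> ?T. g v)"
    using fin by (subst sum.union_disjoint) auto
  also have "(\<Sum>v\<in>?F \<union> ?T. g v) = (\<Sum>v\<in>?F. g v) + (\<Sum>v\<in>?T. g v)"
    using fin by (intro sum.union_disjoint) auto
  also have "(\<Sum>v\<in>?F. g v) = (\<Sum>v | length v < n. g (v @ [False]))"
    by (subst sum.reindex) (auto simp: inj_on_def)
  also have "(\<Sum>v\<in>?T. g v) = (\<Sum>v | length v < n. g (v @ [True]))"
    by (subst sum.reindex) (auto simp: inj_on_def)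
  finally show ?thesis by simp
qed

text \<open>Every finite set of addresses lies within finitely many generations, so the generation
  sums have the same supremum as all finite sums. The conventions match in the divergent case:
  \<open>infsum\<close> is then 0, and \<open>enn2real\<close> sends infinity to 0. Hence no
  summability has to be known.\<close>

lemma infsum_lists:
  fixes f :: "bool list \<Rightarrow> real"
  assumes f: "\<And>v. 0 \<le> f v"
  shows "infsum f UNIV = enn2real (\<Squnion>n. ennreal (\<Sum>v | length v < n. f v))"
proof (cases "f summable_on UNIV")
  case True
  have le: "(\<Sum>v | length v < n. f v) \<le> infsum f UNIV" for n
    by (rule finite_sum_le_infsum[OF True finite_lists_less]) (use f in auto)
  have nn: "0 \<le> infsum f UNIV" using f by (intro infsum_nonneg) auto
  have "(\<Squnion>n. ennreal (\<Sum>v | length v < n. f v)) = ennreal (infsum f UNIV)"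
  proof (rule antisym)
    show "(\<Squnion>n. ennreal (\<Sum>v | length v < n. f v)) \<le> ennreal (infsum f UNIV)"
      by (intro SUP_least ennreal_leI le)
    show "ennreal (infsum f UNIV) \<le> (\<Squnion>n. ennreal (\<Sum>v | length v < n. f v))"
    proof (rule ennreal_le_epsilon)
      fix e :: real assume e: "0 < e"
      have "\<forall>\<^sub>F F in finite_subsets_at_top UNIV. dist (sum f F) (infsum f UNIV) < e"
        using infsum_tendsto[OF True] e unfolding tendsto_iff by simp
      then obtain F where F: "finite F" "dist (sum f F) (infsum f UNIV) < e"
        unfolding eventually_finite_subsets_at_top by (metis order_refl subset_UNIV)
      define n where "n = Suc (Max (insert 0 (length ` F)))"
      have "F \<subseteq> {v. length v < n}"
        using F(1) by (auto simp: n_def less_Suc_eq_le)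
      then have "sum f F \<le> (\<Sum>v | length v < n. f v)"
        by (intro sum_mono2 finite_lists_less) (use f in auto)
      then have "infsum f UNIV \<le> (\<Sum>v | length v < n. f v) + e"
        using F(2) by (simp add: dist_real_def)
      then have "ennreal (infsum f UNIV) \<le> ennreal (\<Sum>v | length v < n. f v) + ennreal e"
        using e f by (subst ennreal_plus[symmetric]) (auto intro!: ennreal_leI sum_nonneg)
      also have "\<dots> \<le> (\<Squnion>n. ennreal (\<Sum>v | length v < n. f v)) + ennreal e"
        by (intro add_mono SUP_upper) auto
      finally show "ennreal (infsum f UNIV) \<le> (\<Squnion>n. ennreal (\<Sum>v | length v < n. f v)) + ennreal e" .
    qed
  qed
  then show ?thesis using nn by simp
next
  case False
  have top: "(\<Squnion>n. ennreal (\<Sum>v | length v < n. f v)) = top"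
  proof (rule ccontr)
    assume "(\<Squnion>n. ennreal (\<Sum>v | length v < n. f v)) \<noteq> top"
    then obtain B where B: "0 \<le> B" "(\<Squnion>n. ennreal (\<Sum>v | length v < n. f v)) = ennreal B"
      by (metis ennreal_cases)
    have b: "(\<Sum>v | length v < n. f v) \<le> B" for n
    proof -
      have "ennreal (\<Sum>v | length v < n. f v) \<le> ennreal B" unfolding B(2)[symmetric] by (rule SUP_upper) simp
      then show ?thesis using B(1) by (simp add: ennreal_le_iff)
    qed
    have "f summable_on UNIV"
    proof (rule nonneg_bdd_above_summable_on)
      show "bdd_above (sum f ` {F. F \<subseteq> UNIV \<and> finite F})"
      proof (rule bdd_aboveI2)
        fix F :: "bool list set" assume "F \<in> {F. F \<subseteq> UNIV \<and> finite F}"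
        then have F: "finite F" by simp
        define n where "n = Suc (Max (insert 0 (length ` F)))"
        have "F \<subseteq> {v. length v < n}"
          using F by (auto simp: n_def less_Suc_eq_le)
        then have "sum f F \<le> (\<Sum>v | length v < n. f v)"
          by (intro sum_mono2 finite_lists_less) (use f in auto)
        then show "sum f F \<le> B" using b by (rule order_trans)
      qed
    qed (use f in auto)
    with False show False by simp
  qed
  show ?thesis by (simp only: infsum_not_exists[OF False] top enn2real_top)
qed

context convex_window
begin

text \<open>\<open>node_state\<close> on half-plane sequences, with arbitrary initial cell and birth
  time, so that the evolution inside a subtree is again of this form.\<close>

primrec pst :: "(bool list \<Rightarrow> node_rand) \<Rightarrow> (nat \<Rightarrow> hplane) \<times> real \<Rightarrow> bool list \<Rightarrow> (nat \<Rightarrow> hplane) \<times> real" where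
  "pst \<omega> z [] = z"
| "pst \<omega> z (b # v) = (child b (draw (fst (pst \<omega> z v)) (snd (\<omega> v))) (fst (pst \<omega> z v)),
     snd (pst \<omega> z v) + fst (\<omega> v) / Lam (fst (pst \<omega> z v)))"

definition seg :: "real \<Rightarrow> (bool list \<Rightarrow> node_rand) \<Rightarrow> (nat \<Rightarrow> hplane) \<times> real \<Rightarrow> bool list \<Rightarrow> real" where
  "seg t \<omega> z v = (if snd (pst \<omega> z v) + fst (\<omega> v) / Lam (fst (pst \<omega> z v)) \<le> t
     then ell (fst (pst \<omega> z v)) (draw (fst (pst \<omega> z v)) (snd (\<omega> v))) else 0)"

definition whole :: "nat \<Rightarrow> hplane" where
  "whole = (\<lambda>_. (0, 0))"

lemma cell_whole [simp]: "cell whole = W"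
  by (simp add: cell_def whole_def)

lemma node_state_pst:
  "node_state \<omega> \<rho> W v = (cell (fst (pst \<omega> (whole, 0) v)), snd (pst \<omega> (whole, 0) v))"
proof (induction v)
  case (Cons b v)
  show ?case
    by (cases "split_line \<rho> (cell (fst (pst \<omega> (whole, 0) v))) (snd (\<omega> v))")
       (auto simp: Cons Let_def cell_child draw_def Lam_eq)
qed simp

lemma Vol1_Y_eq: "Vol1_Y t W \<omega> = infsum (seg t \<omega> (whole, 0)) UNIV"
proof -
  have "(if node_death \<omega> W v \<le> t then node_seg_len \<omega> W v else 0) = seg t \<omega> (whole, 0) v" for v
  proof -
    have "node_death \<omega> W v = snd (pst \<omega> (whole, 0) v) + fst (\<omega> v) / Lam (fst (pst \<omega> (whole, 0) v))"
      unfolding node_death_def node_state_pst by simp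
    moreover have "node_seg_len \<omega> W v = ell (fst (pst \<omega> (whole, 0) v)) (draw (fst (pst \<omega> (whole, 0) v)) (snd (\<omega> v)))"
      unfolding node_seg_len_def node_cell_def node_state_pst
      by (simp add: ell_def draw_def split_def Let_def)
    ultimately show ?thesis by (simp add: seg_def)
  qed
  then show ?thesis unfolding Vol1_Y_def by simp
qed

lemma seg_nonneg: "0 \<le> seg t \<omega> z v"
  by (simp add: seg_def)

lemma measurable_pst:
  "(\<lambda>\<omega>. fst (pst \<omega> z v)) \<in> borel_measurable Omega \<and> (\<lambda>\<omega>. snd (pst \<omega> z v)) \<in> borel_measurable Omega"
proof (induction v)
  case (Cons b v)
  have [measurable]: "(\<lambda>\<omega>. fst (pst \<omega> z v)) \<in> borel_measurable Omega" "(\<lambda>\<omega>. snd (pst \<omega> z v)) \<in> borel_measurable Omega"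
    using Cons by auto
  have D [measurable]: "(\<lambda>\<omega>. draw (fst (pst \<omega> z v)) (snd (\<omega> v))) \<in> borel_measurable Omega" by measurable
  show ?case unfolding pst.simps fst_conv snd_conv by measurable
qed simp

lemma measurable_seg [measurable]: "(\<lambda>\<omega>. seg t \<omega> z v) \<in> borel_measurable Omega"
proof -
  have [measurable]: "(\<lambda>\<omega>. fst (pst \<omega> z v)) \<in> borel_measurable Omega" "(\<lambda>\<omega>. snd (pst \<omega> z v)) \<in> borel_measurable Omega"
    using measurable_pst by auto
  have D [measurable]: "(\<lambda>\<omega>. draw (fst (pst \<omega> z v)) (snd (\<omega> v))) \<in> borel_measurable Omega" by measurable
  show ?thesis unfolding seg_def by measurable
qed

lemma measurable_Vol1_Y [measurable]: "Vol1_Y t W \<in> borel_measurable Omega"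
proof -
  have "Vol1_Y t W = (\<lambda>\<omega>. enn2real (\<Squnion>n. ennreal (\<Sum>v | length v < n. seg t \<omega> (whole, 0) v)))"
    by (rule ext) (simp add: Vol1_Y_eq infsum_lists[OF seg_nonneg])
  then show ?thesis by simp
qed

text \<open>The first branching is absorbed into the initial state. This converts the recursion of
  \<open>pst\<close>, which peels off the most recent branching, into one from the root.\<close>

lemma pst_snoc: "pst \<omega> z (v @ [b]) = pst (subtree b \<omega>) (pst \<omega> z [b]) v"
  by (induction v) (simp_all add: subtree_def del: pst.simps(2) add: pst.simps(2)[of _ _ _ "_ @ _"] pst.simps(2)[of _ "pst _ _ _"])

lemma seg_snoc: "seg t \<omega> z (v @ [b]) = seg t (subtree b \<omega>) (pst \<omega> z [b]) v"
  unfolding seg_def pst_snoc by (simp add: subtree_def)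

lemma pst_ge: "(\<And>v. 0 \<le> fst (\<omega> v)) \<Longrightarrow> snd z \<le> snd (pst \<omega> z v)"
  by (induction v) (auto intro!: add_increasing2 divide_nonneg_nonneg)

text \<open>Times do not decrease along a branch when all marks are nonnegative, so a start after
  \<open>t\<close> leaves no segment created by time \<open>t\<close>.\<close>

lemma seg_eq_0:
  assumes "\<And>v. 0 \<le> fst (\<omega> v)" "t < snd z"
  shows "seg t \<omega> z v = 0"
proof -
  have "snd z \<le> snd (pst \<omega> z v)" by (rule pst_ge) fact
  moreover have "0 \<le> fst (\<omega> v) / Lam (fst (pst \<omega> z v))" using assms(1) by (intro divide_nonneg_nonneg) auto
  ultimately have "\<not> snd (pst \<omega> z v) + fst (\<omega> v) / Lam (fst (pst \<omega> z v)) \<le> t" using assms(2) by linarith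
  then show ?thesis by (simp add: seg_def)
qed

text \<open>Splitting off the root turns the sum over addresses into the recursion of
  \<open>X\<close>. If the root survives beyond \<open>t\<close>, \<open>seg_eq_0\<close> removes
  all its descendants, in agreement with the value 0 of \<open>X\<close>.\<close>

lemma sum_seg:
  assumes "\<And>v. 0 \<le> fst (\<omega> v)"
  shows "(\<Sum>v | length v < n. seg t \<omega> (p, s) v) = X n (t - s) p \<omega>"
  using assms
proof (induction n arbitrary: p s \<omega>)
  case (Suc n)
  define T where "T = fst (\<omega> []) / Lam p"
  define H where "H = draw p (snd (\<omega> []))"
  have pst1: "pst \<omega> (p, s) [b] = (child b H p, s + T)" for b by (simp add: T_def H_def)
  have nn: "\<And>v. 0 \<le> fst (subtree b \<omega> v)" for b using Suc.prems by (simp add: subtree_def)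
  have sums: "(\<Sum>v | length v < Suc n. seg t \<omega> (p, s) v) = seg t \<omega> (p, s) [] +
     (\<Sum>v | length v < n. seg t (subtree False \<omega>) (child False H p, s + T) v) +
     (\<Sum>v | length v < n. seg t (subtree True \<omega>) (child True H p, s + T) v)"
    unfolding sum_lists_Suc seg_snoc pst1 ..
  show ?case
  proof (cases "s + T \<le> t")
    case True
    have "(\<Sum>v | length v < Suc n. seg t \<omega> (p, s) v) = ell p H +
       X n (t - (s + T)) (child False H p) (subtree False \<omega>) + X n (t - (s + T)) (child True H p) (subtree True \<omega>)"
      unfolding sums Suc.IH[OF nn] using True by (simp add: seg_def T_def H_def)
    then show ?thesis using True by (simp add: Let_def T_def[symmetric] H_def[symmetric] diff_diff_eq)
  next
    case False
    then have "seg t (subtree b \<omega>) (child b H p, s + T) v = 0" for b v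
      by (intro seg_eq_0 nn) simp
    moreover have "seg t \<omega> (p, s) [] = 0" using False by (simp add: seg_def T_def)
    ultimately show ?thesis unfolding sums using False by (simp add: Let_def T_def[symmetric])
  qed
qed simp

lemma AE_Omega_nonneg: "AE \<omega> in Omega. \<forall>v. 0 \<le> fst (\<omega> v)"
proof -
  interpret E1: prob_space "density lborel (exponential_density 1)"
    by (rule prob_space_exponential_density) simp
  interpret P: prob_space proposals by (rule prob_space_proposals)
  interpret EP: pair_prob_space "density lborel (exponential_density 1)" proposals ..
  have "AE n in node_measure. 0 \<le> fst n"
    unfolding node_measure_eq
  proof (rule EP.AE_pair_measure)
    show "{x \<in> space (density lborel (exponential_density 1) \<Otimes>\<^sub>M proposals). 0 \<le> fst x} \<in> sets (density lborel (exponential_density 1) \<Otimes>\<^sub>M proposals)"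
      by measurable
    have "AE x in density lborel (exponential_density 1). 0 \<le> x"
      by (subst AE_density) (auto simp: exponential_density_def)
    then show "AE x in density lborel (exponential_density 1). AE y in proposals. 0 \<le> fst (x, y)"
      by simp
  qed
  then have "AE \<omega> in Omega. 0 \<le> fst (\<omega> v)" for v
    unfolding Omega_def by (intro AE_PiM_component prob_space_node_measure) auto
  then show ?thesis by (simp add: AE_all_countable)
qed

lemma X_incseq: "incseq (\<lambda>n. X n t p \<omega>)"
  by (rule incseq_SucI) (rule X_mono)

lemma Vol1_Y_X: "AE \<omega> in Omega. Vol1_Y t W \<omega> = enn2real (\<Squnion>n. ennreal (X n t whole \<omega>))"
  using AE_Omega_nonneg
proof eventually_elim
  case (elim \<omega>)
  have "\<And>v. 0 \<le> fst (\<omega> v)" using elim by blast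
  from sum_seg[OF this, where s=0] show ?case
    by (simp add: Vol1_Y_eq infsum_lists[OF seg_nonneg])
qed

lemma power_over_fact_tendsto_0: "(\<lambda>n. x ^ n / fact n :: real) \<longlonglongrightarrow> 0"
proof -
  have "summable (\<lambda>n. x ^ n / fact n)" using summable_exp[of x] by (simp add: field_simps)
  then show ?thesis by (rule summable_LIMSEQ_zero)
qed

lemma mean_tendsto: "(\<lambda>n. mean n 1 p) \<longlonglongrightarrow> area p"
proof -
  have "(\<lambda>n. mean n 1 p - area p) \<longlonglongrightarrow> 0"
  proof (rule Lim_null_comparison)
    show "\<forall>\<^sub>F n in sequentially. norm (mean n 1 p - area p) \<le> measure lborel W * ((4 * \<rho>) ^ n / fact n)"
      using mean_bound[of 1 _ p] by simp
    show "(\<lambda>n. measure lborel W * ((4 * \<rho>) ^ n / fact n)) \<longlonglongrightarrow> 0"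
      by (rule tendsto_mult_right_zero) (rule power_over_fact_tendsto_0)
  qed
  then show ?thesis by (simp add: LIM_zero_iff)
qed

text \<open>Monotone convergence from the means of the truncated lengths. The finite expectation
  also makes the total length finite almost surely, so \<open>enn2real\<close> loses
  nothing.\<close>

lemma nn_integral_SUP_X: "(\<integral>\<^sup>+\<omega>. (\<Squnion>n. ennreal (X n 1 p \<omega>)) \<partial>Omega) = ennreal (area p)"
proof -
  have inc: "incseq (\<lambda>n \<omega>. ennreal (X n 1 p \<omega>))"
    using X_incseq by (auto simp: incseq_def le_fun_def intro!: ennreal_leI)
  have "(\<integral>\<^sup>+\<omega>. (\<Squnion>n. ennreal (X n 1 p \<omega>)) \<partial>Omega) = (\<Squnion>n. \<integral>\<^sup>+\<omega>. ennreal (X n 1 p \<omega>) \<partial>Omega)"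
    by (rule nn_integral_monotone_convergence_SUP[OF inc]) simp
  also have "\<dots> = (\<Squnion>n. ennreal (mean n 1 p))"
    unfolding mean_def using integrable_X by (simp add: nn_integral_eq_integral)
  also have "\<dots> = ennreal (area p)"
  proof (rule LIMSEQ_unique[OF LIMSEQ_SUP])
    have "mean n 1 p \<le> mean (Suc n) 1 p" for n
      unfolding mean_def using integrable_X X_mono by (intro integral_mono) auto
    then show "incseq (\<lambda>n. ennreal (mean n 1 p))" by (intro incseq_SucI ennreal_leI)
    show "(\<lambda>n. ennreal (mean n 1 p)) \<longlonglongrightarrow> ennreal (area p)"
      by (intro tendsto_ennrealI mean_tendsto)
  qed
  finally show ?thesis .
qed

lemma Vol1_Y_limit: "AE \<omega> in Omega. (\<lambda>n. X n 1 whole \<omega>) \<longlonglongrightarrow> Vol1_Y 1 W \<omega>"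
proof -
  have "AE \<omega> in Omega. (\<Squnion>n. ennreal (X n 1 whole \<omega>)) \<noteq> \<infinity>"
    by (rule nn_integral_PInf_AE) (auto simp: nn_integral_SUP_X)
  with Vol1_Y_X[of 1] show ?thesis
  proof eventually_elim
    case (elim \<omega>)
    have "(\<lambda>n. ennreal (X n 1 whole \<omega>)) \<longlonglongrightarrow> (\<Squnion>n. ennreal (X n 1 whole \<omega>))"
      using X_incseq by (intro LIMSEQ_SUP) (auto simp: incseq_def intro!: ennreal_leI)
    also have "(\<Squnion>n. ennreal (X n 1 whole \<omega>)) = ennreal (Vol1_Y 1 W \<omega>)"
      using elim by (simp only: ennreal_enn2real_if infinity_ennreal_def if_False)
    finally show ?case
      by (rule tendsto_ennrealD) (use elim in auto)
  qed
qed

lemma Vol1_Y_nonneg: "0 \<le> Vol1_Y t W \<omega>"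
  by (simp add: Vol1_Y_eq infsum_nonneg seg_nonneg)

lemma integral_Vol1_Y: "(\<integral>\<omega>. Vol1_Y 1 W \<omega> \<partial>Omega) = measure lborel W"
proof -
  have "AE \<omega> in Omega. (\<Squnion>n. ennreal (X n 1 whole \<omega>)) \<noteq> \<infinity>"
    by (rule nn_integral_PInf_AE) (auto simp: nn_integral_SUP_X)
  with Vol1_Y_X[of 1] have "AE \<omega> in Omega. ennreal (Vol1_Y 1 W \<omega>) = (\<Squnion>n. ennreal (X n 1 whole \<omega>))"
    by eventually_elim (simp only: ennreal_enn2real_if infinity_ennreal_def if_False)
  then have "(\<integral>\<^sup>+\<omega>. ennreal (Vol1_Y 1 W \<omega>) \<partial>Omega) = ennreal (area whole)"
    unfolding nn_integral_SUP_X[symmetric] by (rule nn_integral_cong_AE)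
  then have "(\<integral>\<omega>. Vol1_Y 1 W \<omega> \<partial>Omega) = area whole"
    by (subst integral_eq_nn_integral) (auto simp: Vol1_Y_nonneg)
  then show ?thesis by (simp add: area_def)
qed

text \<open>For a fixed window the truncation error tends to 0 with the number of generations.
  Centring at the exact mean, which is the area, cancels the phase of \<open>gauss\<close> and
  leaves its real factor.\<close>

lemma char_Vol1_Y:
  assumes \<theta>: "\<bar>\<theta>\<bar> * \<rho> \<le> 1"
  shows "cmod ((\<integral>\<omega>. iexp (\<theta> * (Vol1_Y 1 W \<omega> - (\<integral>\<omega>'. Vol1_Y 1 W \<omega>' \<partial>Omega))) \<partial>Omega) - exp (- (\<theta>^2 * V 1 whole / 2)))
    \<le> 21 * \<bar>\<theta>\<bar>^3 * \<rho> * V 1 whole"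
proof -
  define I where "I = (\<integral>\<omega>. iexp (\<theta> * Vol1_Y 1 W \<omega>) \<partial>Omega)"
  have "(\<lambda>n. chi n \<theta> 1 whole) \<longlonglongrightarrow> I"
    unfolding chi_def I_def
  proof (rule integral_dominated_convergence[where w="\<lambda>_. 1"])
    show "AE \<omega> in Omega. (\<lambda>n. iexp (\<theta> * X n 1 whole \<omega>)) \<longlonglongrightarrow> iexp (\<theta> * Vol1_Y 1 W \<omega>)"
      using Vol1_Y_limit by eventually_elim (intro tendsto_intros)
  qed auto
  then have "(\<lambda>n. cmod (chi n \<theta> 1 whole - gauss \<theta> 1 whole)) \<longlonglongrightarrow> cmod (I - gauss \<theta> 1 whole)"
    by (intro tendsto_intros)
  moreover have "(\<lambda>n. 21 * \<bar>\<theta>\<bar>^3 * \<rho> * V 1 whole + 2 * ((4 * \<rho> * 1) ^ n / fact n)) \<longlonglongrightarrow> 21 * \<bar>\<theta>\<bar>^3 * \<rho> * V 1 whole + 2 * 0"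
    by (intro tendsto_intros power_over_fact_tendsto_0)
  ultimately have le: "cmod (I - gauss \<theta> 1 whole) \<le> 21 * \<bar>\<theta>\<bar>^3 * \<rho> * V 1 whole + 2 * 0"
    by (rule LIMSEQ_le) (use chi_gauss[OF \<theta>, of 1 _ whole] in auto)
  have a: "(\<integral>\<omega>'. Vol1_Y 1 W \<omega>' \<partial>Omega) = area whole" by (simp add: integral_Vol1_Y area_def)
  have e: "iexp (\<theta> * (x - area whole)) = iexp (- (\<theta> * area whole)) * iexp (\<theta> * x)" for x
    unfolding exp_add[symmetric] by (simp add: algebra_simps)
  have "(\<integral>\<omega>. iexp (\<theta> * (Vol1_Y 1 W \<omega> - (\<integral>\<omega>'. Vol1_Y 1 W \<omega>' \<partial>Omega))) \<partial>Omega) = iexp (- (\<theta> * area whole)) * I"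
    unfolding a e I_def by (rule integral_mult_right_zero)
  moreover have "of_real (exp (- (\<theta>^2 * V 1 whole / 2))) = iexp (- (\<theta> * area whole)) * gauss \<theta> 1 whole"
    unfolding gauss_def mult.assoc[symmetric] exp_add[symmetric] by simp
  ultimately have eq: "(\<integral>\<omega>. iexp (\<theta> * (Vol1_Y 1 W \<omega> - (\<integral>\<omega>'. Vol1_Y 1 W \<omega>' \<partial>Omega))) \<partial>Omega) - exp (- (\<theta>^2 * V 1 whole / 2)) =
      iexp (- (\<theta> * area whole)) * (I - gauss \<theta> 1 whole)"
    by (simp only: right_diff_distrib)
  show ?thesis unfolding eq norm_mult norm_exp_i_times using le by simp
qed

end

subsection \<open>Asymptotics of the variance functional\<close>

lemma has_integral_inverse: "1 \<le> d \<Longrightarrow> ((\<lambda>h. pi / (2 * h)) has_integral (pi / 2 * ln d)) {1..d}"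
proof -
  assume d: "1 \<le> d"
  have "((\<lambda>h. pi / (2 * h)) has_integral (pi / 2 * ln d - pi / 2 * ln 1)) {1..d}"
    by (rule fundamental_theorem_of_calculus[OF d])
       (auto intro!: derivative_eq_intros simp: has_real_derivative_iff_has_vector_derivative[symmetric])
  then show ?thesis by simp
qed

lemma idecay_uminus [simp]: "idecay t (- h) = idecay t h"
  by (simp add: idecay_def)

lemma idecay_le_inverse: "0 < h \<Longrightarrow> idecay t h \<le> pi / (2 * h)"
  using idecay_mult[of h t] mult_pos_pos[OF pi_gt_zero decay_bounds(1)[of t h]] by (simp add: field_simps)

lemma nn_integral_reflect:
  fixes f :: "real \<Rightarrow> ennreal"
  assumes [measurable]: "f \<in> borel_measurable borel"
  shows "(\<integral>\<^sup>+h. f (- h) \<partial>lborel) = (\<integral>\<^sup>+h. f h \<partial>lborel)"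
  by (subst (2) nn_integral_real_affine[where c="-1" and t=0]) auto

text \<open>\<open>idecay 1\<close> is at most 1 on [-1, 1], which contributes 2, and at most pi /
  (2 |h|) outside, where each of the two tails contributes \<open>pi / 2 * ln D\<close>.\<close>

lemma nn_integral_idecay_le:
  assumes D: "1 \<le> D"
  shows "(\<integral>\<^sup>+h. ennreal (idecay 1 h) * indicator {-D..D} h \<partial>lborel) \<le> ennreal (2 + pi * ln D)"
proof -
  let ?g = "\<lambda>h. indicator {1..D} h * ennreal (pi / (2 * h))"
  have "(\<integral>\<^sup>+h. ennreal (idecay 1 h) * indicator {-D..D} h \<partial>lborel) \<le>
    (\<integral>\<^sup>+h. indicator {-1..1} h + (?g h + ?g (- h)) \<partial>lborel)"
  proof (rule nn_integral_mono)
    fix h :: real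
    consider "h < -1" | "-1 \<le> h" "h \<le> 1" | "1 < h" by linarith
    then show "ennreal (idecay 1 h) * indicator {-D..D} h \<le> indicator {-1..1} h + (?g h + ?g (- h))"
    proof cases
      case 1
      then have "idecay 1 (- h) \<le> pi / (2 * (- h))" by (intro idecay_le_inverse) auto
      then show ?thesis using 1 by (auto simp: indicator_def simp del: mult_minus_right divide_minus_right intro!: ennreal_leI)
    next
      case 2
      have "ennreal (idecay 1 h) \<le> 1" using idecay_le[of 1 h] by simp
      then show ?thesis using 2 D by (auto simp: indicator_def intro: add_increasing2)
    next
      case 3
      then have "idecay 1 h \<le> pi / (2 * h)" by (intro idecay_le_inverse) auto
      then show ?thesis using 3 by (auto simp: indicator_def intro!: ennreal_leI)
    qed
  qed
  also have "\<dots> = (\<integral>\<^sup>+h. indicator {-1..1} h \<partial>(lborel :: real measure)) + ((\<integral>\<^sup>+h. ?g h \<partial>lborel) + (\<integral>\<^sup>+h. ?g (- h) \<partial>lborel))"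
    by (subst nn_integral_add, measurable, subst nn_integral_add) auto
  also have "(\<integral>\<^sup>+h. ?g (- h) \<partial>lborel) = (\<integral>\<^sup>+h. ?g h \<partial>lborel)"
    by (rule nn_integral_reflect) measurable
  also have "(\<integral>\<^sup>+h. ?g h \<partial>lborel) = ennreal (pi / 2 * ln D)"
  proof -
    have "(\<integral>\<^sup>+h. ?g h \<partial>lborel) = (\<integral>\<^sup>+h. ennreal (indicator {1..D} h * (pi / (2 * h))) \<partial>lborel)"
      by (intro nn_integral_cong) (auto simp: indicator_def)
    also have "\<dots> = ennreal (pi / 2 * ln D)"
      by (rule nn_integral_has_integral_lebesgue[OF _ has_integral_inverse[OF D]]) auto
    finally show ?thesis .
  qed
  also have "(\<integral>\<^sup>+h. indicator {-1..1} h \<partial>(lborel :: real measure)) = ennreal 2"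
    by simp
  also have "ennreal 2 + (ennreal (pi / 2 * ln D) + ennreal (pi / 2 * ln D)) = ennreal (2 + (pi / 2 * ln D + pi / 2 * ln D))"
  proof -
    have e: "0 \<le> pi / 2 * ln D" using D by simp
    show ?thesis
      by (subst ennreal_plus[symmetric, OF e e], rule ennreal_plus[symmetric]) (use e in auto)
  qed
  also have "2 + (pi / 2 * ln D + pi / 2 * ln D) = 2 + pi * ln D" by simp
  finally show ?thesis .
qed

text \<open>On [1, d] the deficit of \<open>idecay 1 h\<close> against \<open>pi / (2 * h)\<close>
  is at most \<open>pi / 2 * exp (- (2 / pi * h))\<close>, because 1 / h is at most 1 there. Its
  integral is at most \<open>pi^2 / 4\<close>, and the two signs of \<open>h\<close> together lose
  \<open>pi^2 / 2\<close>.\<close>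

lemma nn_integral_idecay_ge:
  assumes d: "1 \<le> d"
  shows "ennreal (pi * ln d - pi^2 / 2) \<le> (\<integral>\<^sup>+h. ennreal (idecay 1 h) * indicator {-d..d} h \<partial>lborel)"
proof -
  let ?w = "\<lambda>h. pi / (2 * h) - pi / 2 * exp (- (2 / pi * h))"
  have c: "continuous_on {1..d} (idecay 1)"
  proof (rule continuous_on_eq[where f="\<lambda>h. (1 - exp (- (2 / pi * \<bar>h\<bar> * 1))) / (2 / pi * \<bar>h\<bar>)"])
    show "continuous_on {1..d} (\<lambda>h. (1 - exp (- (2 / pi * \<bar>h\<bar> * 1))) / (2 / pi * \<bar>h\<bar>))"
      by (intro continuous_intros) auto
  qed (auto simp: idecay_def)
  define J where "J = integral {1..d} (idecay 1)"
  have J: "(idecay 1 has_integral J) {1..d}"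
    unfolding J_def by (intro integrable_integral integrable_continuous_interval c)
  have "((\<lambda>h. pi / 2 * exp (- (2 / pi * h))) has_integral
      (- (pi^2 / 4 * exp (- (2 / pi * d))) - (- (pi^2 / 4 * exp (- (2 / pi * 1)))))) {1..d}"
    by (rule fundamental_theorem_of_calculus[OF d])
       (auto intro!: derivative_eq_intros simp: has_real_derivative_iff_has_vector_derivative[symmetric] power2_eq_square field_simps)
  from has_integral_diff[OF has_integral_inverse[OF d] this]
  have "pi / 2 * ln d - (- (pi^2 / 4 * exp (- (2 / pi * d))) - (- (pi^2 / 4 * exp (- (2 / pi * 1))))) \<le> J"
  proof (rule has_integral_le[OF _ J])
    fix h assume h: "h \<in> {1..d}"
    have "idecay 1 h = pi / (2 * h) - pi / 2 * (exp (- (2 / pi * h)) / h)"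
      using h by (simp add: idecay_def field_simps)
    moreover have "exp (- (2 / pi * h)) / h \<le> exp (- (2 / pi * h)) / 1"
      using h by (intro divide_left_mono) auto
    then have "pi / 2 * (exp (- (2 / pi * h)) / h) \<le> pi / 2 * (exp (- (2 / pi * h)) / 1)"
      by (rule mult_left_mono) simp
    ultimately show "?w h \<le> idecay 1 h" unfolding div_by_1 by linarith
  qed
  moreover have "pi^2 / 4 * exp (- (2 / pi * 1)) \<le> pi^2 / 4 * 1" by (intro mult_left_mono) auto
  moreover have "0 \<le> pi^2 / 4 * exp (- (2 / pi * d))" by simp
  ultimately have J1: "pi / 2 * ln d - pi^2 / 4 \<le> J" by linarith
  have J0: "0 \<le> J" using J by (rule has_integral_nonneg) (simp add: idecay_nonneg)
  let ?g = "\<lambda>h. indicator {1<..d} h * ennreal (idecay 1 h)"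
  have g: "(\<integral>\<^sup>+h. ?g h \<partial>lborel) = ennreal J"
  proof -
    have "(\<integral>\<^sup>+h. ?g h \<partial>lborel) = (\<integral>\<^sup>+h. ennreal (indicator {1..d} h * idecay 1 h) \<partial>lborel)"
    proof (rule nn_integral_cong_AE)
      show "AE h in lborel. ?g h = ennreal (indicator {1..d} h * idecay 1 h)"
        using AE_lborel_singleton[of 1] by eventually_elim (auto simp: indicator_def)
    qed
    also have "\<dots> = ennreal J"
      by (rule nn_integral_has_integral_lebesgue[OF _ J]) (simp add: idecay_nonneg)
    finally show ?thesis .
  qed
  have "ennreal (pi * ln d - pi^2 / 2) \<le> ennreal (J + J)"
    using J1 by (intro ennreal_leI) simp
  also have "\<dots> = (\<integral>\<^sup>+h. ?g h \<partial>lborel) + (\<integral>\<^sup>+h. ?g (- h) \<partial>lborel)"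
  proof -
    have "(\<integral>\<^sup>+h. ?g (- h) \<partial>lborel) = (\<integral>\<^sup>+h. ?g h \<partial>lborel)"
      by (rule nn_integral_reflect) measurable
    then show ?thesis using J0 by (simp only: g ennreal_plus)
  qed
  also have "\<dots> = (\<integral>\<^sup>+h. ?g h + ?g (- h) \<partial>lborel)"
    by (rule nn_integral_add[symmetric]) auto
  also have "\<dots> \<le> (\<integral>\<^sup>+h. ennreal (idecay 1 h) * indicator {-d..d} h \<partial>lborel)"
    by (intro nn_integral_mono) (auto simp: indicator_def)
  finally show ?thesis .
qed

lemma emeasure_lborel_affine:
  fixes S :: "(real^2) set"
  assumes "compact S"
  shows "emeasure lborel ((\<lambda>x. m *\<^sub>R x + c) ` S) = ennreal (m^2) * emeasure lborel S"
proof -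
  have "compact ((\<lambda>x. m *\<^sub>R x + c) ` S)"
    by (intro compact_continuous_image continuous_intros assms)
  then have "(\<lambda>x. m *\<^sub>R x + c) ` S \<in> sets borel" "S \<in> sets borel"
    using assms by (auto intro: borel_closed compact_imp_closed)
  then show ?thesis using emeasure_lebesgue_affine[of m c S] by simp
qed

context convex_window
begin

lemma area_whole: "area whole = measure lborel W"
  by (simp add: area_def)

text \<open>The covariogram is at most the area and vanishes beyond distance
  \<open>2 * \<rho>\<close>, so only the integral of \<open>idecay 1\<close> over that range
  matters.\<close>

lemma V_upper: "V 1 whole \<le> measure lborel W * (2 + pi * ln (2 * \<rho>))"
proof -
  have D: "1 \<le> 2 * \<rho>" using rho_ge_1 by simp
  have "ennreal (V 1 whole) = (\<integral>\<^sup>+h. ennreal (idecay 1 h) * cov whole h \<partial>lborel)"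
    by (rule V_covm) simp
  also have "\<dots> \<le> (\<integral>\<^sup>+h. ennreal (area whole) * (ennreal (idecay 1 h) * indicator {-(2*\<rho>)..2*\<rho>} h) \<partial>lborel)"
  proof (rule nn_integral_mono)
    fix h
    show "ennreal (idecay 1 h) * cov whole h \<le> ennreal (area whole) * (ennreal (idecay 1 h) * indicator {-(2*\<rho>)..2*\<rho>} h)"
    proof (cases "2 * \<rho> < \<bar>h\<bar>")
      case True then show ?thesis by (simp add: cov_eq_0)
    next
      case False
      then have "ennreal (area whole) * (ennreal (idecay 1 h) * indicator {-(2*\<rho>)..2*\<rho>} h) = ennreal (idecay 1 h) * ennreal (area whole)"
        by (auto simp: indicator_def abs_le_iff mult.commute)
      then show ?thesis using cov_le_area[of whole h] by (auto intro: mult_left_mono)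
    qed
  qed
  also have "\<dots> = ennreal (area whole) * (\<integral>\<^sup>+h. ennreal (idecay 1 h) * indicator {-(2*\<rho>)..2*\<rho>} h \<partial>lborel)"
    by (rule nn_integral_cmult) measurable
  also have "\<dots> \<le> ennreal (area whole) * ennreal (2 + pi * ln (2 * \<rho>))"
    by (intro mult_left_mono nn_integral_idecay_le D) auto
  also have "\<dots> = ennreal (area whole * (2 + pi * ln (2 * \<rho>)))"
    by (rule ennreal_mult'[symmetric]) simp
  finally show ?thesis using D
    by (subst (asm) ennreal_le_iff) (auto simp: area_whole intro!: mult_nonneg_nonneg add_nonneg_nonneg)
qed

text \<open>If \<open>W\<close> contains a ball of radius \<open>r\<close> around \<open>c\<close>, then \<open>(1 - \<delta>) W + \<delta> c\<close> lies in \<open>W\<close> together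
  with all its translates by vectors of length at most \<open>\<delta> r\<close>.\<close>
lemma gcov_lower:
  assumes B: "cball c r \<subseteq> W" and \<delta>: "0 < \<delta>" "\<delta> < 1" and h: "\<bar>h\<bar> \<le> \<delta> * r" and u: "norm u = 1"
  shows "ennreal ((1 - \<delta>)^2 * area whole) \<le> gcov whole u h"
proof -
  have r: "0 \<le> r"
  proof -
    have "0 \<le> \<delta> * r" using h by linarith
    then show ?thesis using \<delta> by (simp add: zero_le_mult_iff)
  qed
  let ?S = "(\<lambda>x. (1 - \<delta>) *\<^sub>R x + \<delta> *\<^sub>R c) ` W"
  let ?C = "{x. x \<in> cell whole \<and> x + h *\<^sub>R perp u \<in> cell whole}"
  have in_W: "(1 - \<delta>) *\<^sub>R x + \<delta> *\<^sub>R y \<in> W" if "x \<in> W" "y \<in> W" for x y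
    using convexD_alt[OF convex_W that, of \<delta>] \<delta> by simp
  have c: "c \<in> W" using B r by auto
  have c': "c + (h / \<delta>) *\<^sub>R perp u \<in> W"
  proof -
    have "norm ((h / \<delta>) *\<^sub>R perp u) \<le> r" using h \<delta> u by (simp add: field_simps)
    then show ?thesis using B by (auto simp: dist_norm)
  qed
  have "?S \<subseteq> ?C"
  proof
    fix z assume "z \<in> ?S"
    then obtain x where x: "x \<in> W" "z = (1 - \<delta>) *\<^sub>R x + \<delta> *\<^sub>R c" by auto
    have "z + h *\<^sub>R perp u = (1 - \<delta>) *\<^sub>R x + \<delta> *\<^sub>R (c + (h / \<delta>) *\<^sub>R perp u)"
      using \<delta> by (simp add: x scaleR_add_right)
    also have "\<dots> \<in> W" by (rule in_W[OF x(1) c'])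
    finally have "z + h *\<^sub>R perp u \<in> W" .
    moreover have "z \<in> W" unfolding x(2) by (rule in_W[OF x(1) c])
    ultimately show "z \<in> ?C" by simp
  qed
  moreover have "{x. x \<in> cell p \<and> x + h *\<^sub>R perp u \<in> cell p} \<in> sets lborel" for p by simp
  ultimately have "emeasure lborel ?S \<le> emeasure lborel ?C" by (rule emeasure_mono)
  moreover have "emeasure lborel ?S = ennreal ((1 - \<delta>)^2 * area whole)"
    using emeasure_cell[of whole] by (simp add: emeasure_lborel_affine[OF compact_W] ennreal_mult)
  ultimately show ?thesis by (simp add: gcov_def)
qed

text \<open>For |h| at most \<open>\<delta> * r\<close> every directional covariogram keeps the
  fraction \<open>(1 - \<delta>)^2\<close> of the area; \<open>nn_integral_idecay_ge\<close>
  supplies the logarithm on this range.\<close>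

lemma V_lower:
  assumes B: "cball c r \<subseteq> W" and \<delta>: "0 < \<delta>" "\<delta> < 1" and r: "1 \<le> \<delta> * r"
  shows "(1 - \<delta>)^2 * measure lborel W * (pi * ln (\<delta> * r) - pi^2 / 2) \<le> V 1 whole"
proof -
  let ?a = "(1 - \<delta>)^2 * area whole" and ?d = "\<delta> * r"
  have cov: "ennreal ?a \<le> cov whole h" if "\<bar>h\<bar> \<le> ?d" for h
  proof -
    have "ennreal ?a = (\<integral>\<^sup>+(u::real^2). ennreal ?a \<partial>nu1)"
      using nu1.emeasure_space_1 by simp
    also have "\<dots> \<le> cov whole h"
      unfolding cov_def using AE_nu1_unit
      by (intro nn_integral_mono_AE) (auto elim!: eventually_mono intro: gcov_lower[OF B \<delta> that])
    finally show ?thesis .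
  qed
  have "ennreal (?a * (pi * ln ?d - pi^2 / 2)) = ennreal ?a * ennreal (pi * ln ?d - pi^2 / 2)"
    by (rule ennreal_mult') simp
  also have "\<dots> \<le> ennreal ?a * (\<integral>\<^sup>+h. ennreal (idecay 1 h) * indicator {-?d..?d} h \<partial>lborel)"
    by (intro mult_left_mono nn_integral_idecay_ge r) auto
  also have "\<dots> = (\<integral>\<^sup>+h. ennreal ?a * (ennreal (idecay 1 h) * indicator {-?d..?d} h) \<partial>lborel)"
    by (rule nn_integral_cmult[symmetric]) measurable
  also have "\<dots> \<le> (\<integral>\<^sup>+h. ennreal (idecay 1 h) * cov whole h \<partial>lborel)"
  proof (rule nn_integral_mono)
    fix h
    show "ennreal ?a * (ennreal (idecay 1 h) * indicator {-?d..?d} h) \<le> ennreal (idecay 1 h) * cov whole h"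
    proof (cases "\<bar>h\<bar> \<le> ?d")
      case True
      have "ennreal ?a * (ennreal (idecay 1 h) * indicator {-?d..?d} h) \<le> ennreal ?a * (ennreal (idecay 1 h) * 1)"
        by (intro mult_left_mono) (auto simp: indicator_def)
      also have "\<dots> = ennreal (idecay 1 h) * ennreal ?a" by (simp add: mult.commute)
      also have "\<dots> \<le> ennreal (idecay 1 h) * cov whole h" using cov[OF True] by (intro mult_left_mono) auto
      finally show ?thesis .
    next
      case False
      then show ?thesis by (auto simp: indicator_def abs_le_iff)
    qed
  qed
  also have "\<dots> = ennreal (V 1 whole)" by (rule V_covm(1)[symmetric]) simp
  finally show ?thesis by (simp add: area_whole ennreal_le_iff)
qed

text \<open>\<open>V\<close> depends on the window through the locale. Stating its properties for an
  existential number allows one value to be chosen for each scaled window outside the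
  locale.\<close>

lemma window_bounds:
  "\<exists>v\<ge>0. v \<le> measure lborel W * (2 + pi * ln (2 * \<rho>)) \<and>
     (\<forall>c r \<delta>. cball c r \<subseteq> W \<longrightarrow> 0 < \<delta> \<longrightarrow> \<delta> < 1 \<longrightarrow> 1 \<le> \<delta> * r \<longrightarrow>
        (1 - \<delta>)^2 * measure lborel W * (pi * ln (\<delta> * r) - pi^2 / 2) \<le> v) \<and>
     (\<forall>\<theta>. \<bar>\<theta>\<bar> * \<rho> \<le> 1 \<longrightarrow>
        cmod ((\<integral>\<omega>. iexp (\<theta> * (Vol1_Y 1 W \<omega> - (\<integral>\<omega>'. Vol1_Y 1 W \<omega>' \<partial>Omega))) \<partial>Omega) - exp (- (\<theta>^2 * v / 2)))
          \<le> 21 * \<bar>\<theta>\<bar>^3 * \<rho> * v)"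
  using V_upper V_lower char_Vol1_Y by (intro exI[of _ "V 1 whole"]) auto

end

subsection \<open>The central limit theorem\<close>

lemma real_distribution_normal:
  assumes "0 < \<sigma>"
  shows "real_distribution (density lborel (normal_density 0 \<sigma>))"
  unfolding real_distribution_def real_distribution_axioms_def
  using prob_space_normal_density[OF assms] by simp

lemma char_normal:
  assumes \<sigma>: "0 < \<sigma>"
  shows "char (density lborel (normal_density 0 \<sigma>)) t = exp (- (\<sigma>^2 * t^2 / 2))"
proof -
  let ?N = "density lborel (normal_density 0 \<sigma>)"
  interpret N: prob_space ?N by (rule prob_space_normal_density[OF \<sigma>])
  have "distributed ?N lborel (\<lambda>x. x) (normal_density 0 \<sigma>)"
    by (auto simp: distributed_def distr_id2)
  then have "distributed ?N lborel (\<lambda>x. (x - 0) / \<sigma>) std_normal_density"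
    using N.normal_standard_normal_convert[OF \<sigma>, of "\<lambda>x. x" 0] by simp
  then have d: "distr ?N lborel (\<lambda>x. x / \<sigma>) = std_normal_distribution"
    by (simp add: distributed_def)
  have "char ?N t = (\<integral>x. iexp ((t * \<sigma>) * (x / \<sigma>)) \<partial>?N)"
    unfolding char_def using \<sigma> by simp
  also have "\<dots> = (\<integral>x. iexp ((t * \<sigma>) * x) \<partial>distr ?N lborel (\<lambda>x. x / \<sigma>))"
    by (rule integral_distr[symmetric]) auto
  also have "\<dots> = char std_normal_distribution (t * \<sigma>)"
    unfolding d char_def ..
  also have "\<dots> = exp (- (\<sigma>^2 * t^2 / 2))"
    by (simp add: char_std_normal_distribution power_mult_distrib mult.commute)
  finally show ?thesis .
qed

lemma convex_window_scale:
  assumes "convex_window W"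
  shows "convex_window ((\<lambda>x. R *\<^sub>R x) ` W)"
proof -
  interpret convex_window W by fact
  show ?thesis
    using compact_scaling[OF compact_W] convex_scaling[OF convex_W] nonempty_W by unfold_locales auto
qed

lemma measure_scale:
  assumes "compact (W :: (real^2) set)"
  shows "measure lborel ((\<lambda>x. R *\<^sub>R x) ` W) = R^2 * measure lborel W"
  using emeasure_lborel_affine[OF assms, of R 0] by (simp add: measure_def enn2real_mult)

text \<open>The summand 1 in \<open>bound_radius\<close> does not scale with the window, whence the
  additive constant.\<close>

lemma bound_radius_scale:
  assumes "convex_window W" "0 \<le> R"
  shows "bound_radius ((\<lambda>x. R *\<^sub>R x) ` W) \<le> R * bound_radius W + 1"
proof -
  interpret convex_window W by fact
  have "Sup (norm ` (\<lambda>x. R *\<^sub>R x) ` W) \<le> R * bound_radius W"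
  proof (rule cSup_least)
    show "norm ` (\<lambda>x. R *\<^sub>R x) ` W \<noteq> {}" using nonempty_W by auto
    fix y assume "y \<in> norm ` (\<lambda>x. R *\<^sub>R x) ` W"
    then obtain x where "x \<in> W" "y = R * norm x" using assms(2) by auto
    then show "y \<le> R * bound_radius W" using norm_le[of x] assms(2) by (auto intro: mult_left_mono)
  qed
  then show ?thesis by (simp add: bound_radius_def[of "(\<lambda>x. R *\<^sub>R x) ` W"])
qed

lemma cball_scale:
  assumes "cball c r \<subseteq> W" "0 < R"
  shows "cball (R *\<^sub>R c) (R * r) \<subseteq> (\<lambda>x. R *\<^sub>R x) ` (W :: (real^2) set)"
proof
  fix y assume y: "y \<in> cball (R *\<^sub>R c) (R * r)"
  have "R *\<^sub>R c - y = R *\<^sub>R (c - (1 / R) *\<^sub>R y)" using assms(2) by (simp add: scaleR_diff_right)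
  then have "dist (R *\<^sub>R c) y = R * dist c ((1 / R) *\<^sub>R y)"
    using assms(2) unfolding dist_norm by (simp only: norm_scaleR abs_of_pos)
  then have "(1 / R) *\<^sub>R y \<in> W" using y assms by auto
  then show "y \<in> (\<lambda>x. R *\<^sub>R x) ` W"
    using assms(2) by (intro image_eqI[of _ _ "(1 / R) *\<^sub>R y"]) auto
qed

text \<open>Levy's continuity theorem concerns sequences, so convergence along \<open>at_top\<close>
  is tested on sequences tending to infinity.\<close>

lemma converges_in_law_char:
  fixes g :: "real \<Rightarrow> (bool list \<Rightarrow> node_rand) \<Rightarrow> real"
  assumes meas: "\<And>R. 0 < R \<Longrightarrow> g R \<in> borel_measurable Omega"
    and \<sigma>: "0 < \<sigma>"
    and lim: "\<And>t. ((\<lambda>R. \<integral>\<omega>. iexp (t * g R \<omega>) \<partial>Omega) \<longlongrightarrow> complex_of_real (exp (- (\<sigma>^2 * t^2 / 2)))) at_top"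
  shows "converges_in_law at_top (\<lambda>R. distr Omega borel (g R)) (density lborel (normal_density 0 \<sigma>))"
  unfolding converges_in_law_def
proof (intro allI impI)
  fix f :: "real \<Rightarrow> real" assume f: "continuous_on UNIV f \<and> bounded (range f)"
  obtain B where B: "\<And>x. norm (f x) \<le> B" using f by (auto simp: bounded_iff)
  let ?N = "density lborel (normal_density 0 \<sigma>)"
  show "((\<lambda>R. \<integral>x. f x \<partial>distr Omega borel (g R)) \<longlongrightarrow> (\<integral>x. f x \<partial>?N)) at_top"
  proof (rule tendsto_at_topI_sequentially)
    fix S :: "nat \<Rightarrow> real" assume S: "filterlim S at_top sequentially"
    \<comment> \<open>Finitely many \<open>S n\<close> may fail to be positive. Raising them to 1
      makes every member of the sequence a probability law without changing the limit.\<close>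
    define Q where "Q = (\<lambda>n. max 1 (S n))"
    have ev: "\<forall>\<^sub>F n in sequentially. Q n = S n"
      using S[unfolded filterlim_at_top, rule_format, of 1] by eventually_elim (simp add: Q_def)
    have Qpos: "0 < Q n" for n by (simp add: Q_def)
    have Q: "filterlim Q at_top sequentially"
      using S by (rule filterlim_mono_eventually) (use ev in \<open>auto elim: eventually_mono\<close>)
    have rd: "real_distribution (distr Omega borel (g (Q n)))" for n
      by (rule Omega.real_distribution_distr) (rule meas[OF Qpos])
    have "weak_conv_m (\<lambda>n. distr Omega borel (g (Q n))) ?N"
    proof (rule levy_continuity[OF rd real_distribution_normal[OF \<sigma>]])
      fix t
      have "char (distr Omega borel (g (Q n))) t = (\<integral>\<omega>. iexp (t * g (Q n) \<omega>) \<partial>Omega)" for n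
        unfolding char_def using meas[OF Qpos] by (subst integral_distr) auto
      moreover have "(\<lambda>n. \<integral>\<omega>. iexp (t * g (Q n) \<omega>) \<partial>Omega) \<longlonglongrightarrow> complex_of_real (exp (- (\<sigma>^2 * t^2 / 2)))"
        by (rule filterlim_compose[OF lim Q])
      ultimately show "(\<lambda>n. char (distr Omega borel (g (Q n))) t) \<longlonglongrightarrow> char ?N t"
        by (simp only: char_normal[OF \<sigma>])
    qed
    then have "(\<lambda>n. \<integral>x. f x \<partial>distr Omega borel (g (Q n))) \<longlonglongrightarrow> (\<integral>x. f x \<partial>?N)"
      by (rule weak_conv_imp_integral_bdd_continuous_conv[OF rd real_distribution_normal[OF \<sigma>], where B=B])
         (use f B in \<open>auto simp: continuous_on_eq_continuous_at\<close>)
    then show "(\<lambda>n. \<integral>x. f x \<partial>distr Omega borel (g (S n))) \<longlonglongrightarrow> (\<integral>x. f x \<partial>?N)"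
      by (rule Lim_transform_eventually) (use ev in \<open>auto elim: eventually_mono\<close>)
  qed
qed

text \<open>Up to the constant the error is \<open>\<bar>\<theta>\<bar> * rad R\<close> times
  \<open>\<theta>^2 * v R\<close>. The second factor converges by the assumption on
  \<open>v\<close>, while the first is of order 1 / sqrt (ln R): the logarithm in the normalisation
  is what makes the approximation effective.\<close>

lemma norm_char_limit:
  fixes v rad :: "real \<Rightarrow> real" and \<tau> :: real
  assumes v: "((\<lambda>R. v R / (R^2 * ln R)) \<longlongrightarrow> a) at_top"
    and rad: "\<And>R. 1 < R \<Longrightarrow> 0 \<le> rad R \<and> rad R \<le> R * M + 1"
    and char: "\<And>R \<theta>. 1 < R \<Longrightarrow> \<bar>\<theta>\<bar> * rad R \<le> 1 \<Longrightarrow>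
       cmod (\<phi> R \<theta> - of_real (exp (- (\<theta>^2 * v R / 2)))) \<le> 21 * \<bar>\<theta>\<bar>^3 * rad R * v R"
  shows "((\<lambda>R. \<phi> R (\<tau> / (R * sqrt (ln R)))) \<longlongrightarrow> of_real (exp (- (a * \<tau>^2 / 2)))) at_top"
proof -
  define \<theta> where "\<theta> = (\<lambda>R::real. \<tau> / (R * sqrt (ln R)))"
  define q where "q = (\<lambda>R. v R / (R^2 * ln R))"
  have big: "\<forall>\<^sub>F R in at_top. (1::real) < R" by (rule eventually_gt_at_top)
  have \<theta>2: "\<theta> R ^ 2 * v R = \<tau>^2 * q R" if "1 < R" for R
    using that by (simp add: \<theta>_def q_def power_divide power_mult_distrib)
  have \<theta>r: "((\<lambda>R. \<bar>\<theta> R\<bar> * rad R) \<longlongrightarrow> 0) at_top"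
  proof (rule Lim_null_comparison)
    show "\<forall>\<^sub>F R in at_top. norm (\<bar>\<theta> R\<bar> * rad R) \<le> \<bar>\<tau>\<bar> * ((R * M + 1) / (R * sqrt (ln R)))"
      using big
    proof eventually_elim
      case (elim R)
      have "norm (\<bar>\<theta> R\<bar> * rad R) = \<bar>\<theta> R\<bar> * rad R" using rad[OF elim] by simp
      also have "\<dots> \<le> \<bar>\<theta> R\<bar> * (R * M + 1)" using rad[OF elim] by (intro mult_left_mono) auto
      also have "\<dots> = \<bar>\<tau>\<bar> * ((R * M + 1) / (R * sqrt (ln R)))" using elim by (simp add: \<theta>_def abs_divide abs_mult)
      finally show ?case .
    qed
    have "((\<lambda>R::real. (R * M + 1) / (R * sqrt (ln R))) \<longlongrightarrow> 0) at_top"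
      by real_asymp
    then show "((\<lambda>R. \<bar>\<tau>\<bar> * ((R * M + 1) / (R * sqrt (ln R)))) \<longlongrightarrow> 0) at_top"
      by (rule tendsto_mult_right_zero)
  qed
  have small: "\<forall>\<^sub>F R in at_top. \<bar>\<theta> R\<bar> * rad R \<le> 1"
    using order_tendstoD(2)[OF \<theta>r zero_less_one] by eventually_elim simp
  have "((\<lambda>R. \<phi> R (\<theta> R) - of_real (exp (- (\<theta> R ^ 2 * v R / 2)))) \<longlongrightarrow> 0) at_top"
  proof (rule Lim_null_comparison)
    show "\<forall>\<^sub>F R in at_top. norm (\<phi> R (\<theta> R) - of_real (exp (- (\<theta> R ^ 2 * v R / 2)))) \<le>
        21 * (\<bar>\<theta> R\<bar> * rad R) * (\<tau>^2 * q R)"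
      using big small
    proof eventually_elim
      case (elim R)
      have "21 * \<bar>\<theta> R\<bar>^3 * rad R * v R = 21 * (\<bar>\<theta> R\<bar> * rad R) * (\<bar>\<theta> R\<bar>^2 * v R)"
        by (simp only: power3_eq_cube power2_eq_square mult_ac)
      then show ?case using char[OF elim] \<theta>2[OF elim(1)] by (simp only: power2_abs)
    qed
    have "((\<lambda>R. 21 * (\<bar>\<theta> R\<bar> * rad R) * (\<tau>^2 * q R)) \<longlongrightarrow> 21 * 0 * (\<tau>^2 * a)) at_top"
      by (intro tendsto_intros \<theta>r v[folded q_def])
    then show "((\<lambda>R. 21 * (\<bar>\<theta> R\<bar> * rad R) * (\<tau>^2 * q R)) \<longlongrightarrow> 0) at_top" by simp
  qed
  moreover have "((\<lambda>R. complex_of_real (exp (- (\<theta> R ^ 2 * v R / 2)))) \<longlongrightarrow> of_real (exp (- (a * \<tau>^2 / 2)))) at_top"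
  proof -
    have "((\<lambda>R. complex_of_real (exp (- (\<tau>^2 * q R / 2)))) \<longlongrightarrow> of_real (exp (- (\<tau>^2 * a / 2)))) at_top"
      by (intro tendsto_intros v[folded q_def]) auto
    moreover have "\<forall>\<^sub>F R in at_top. complex_of_real (exp (- (\<tau>^2 * q R / 2))) = of_real (exp (- (\<theta> R ^ 2 * v R / 2)))"
      using big by eventually_elim (simp only: \<theta>2)
    ultimately have "((\<lambda>R. complex_of_real (exp (- (\<theta> R ^ 2 * v R / 2)))) \<longlongrightarrow> of_real (exp (- (\<tau>^2 * a / 2)))) at_top"
      by (rule Lim_transform_eventually)
    then show ?thesis by (simp only: mult.commute[of a])
  qed
  ultimately have "((\<lambda>R. (\<phi> R (\<theta> R) - of_real (exp (- (\<theta> R ^ 2 * v R / 2)))) + of_real (exp (- (\<theta> R ^ 2 * v R / 2)))) \<longlongrightarrow>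
      0 + of_real (exp (- (a * \<tau>^2 / 2)))) at_top"
    by (rule tendsto_add)
  then show ?thesis by (simp add: \<theta>_def)
qed

theorem theorem2:
  fixes W :: "(real^2) set"
  assumes "compact W" and "convex W" and "interior W \<noteq> {}"
  shows "converges_in_law at_top
           (\<lambda>R::real. distr Omega borel
              (\<lambda>\<omega>. (Vol1_Y 1 ((\<lambda>x. R *\<^sub>R x) ` W) \<omega>
                     - (\<integral>\<omega>'. Vol1_Y 1 ((\<lambda>x. R *\<^sub>R x) ` W) \<omega>' \<partial>Omega))
                    / (R * sqrt (ln R))))
           (density lborel (normal_density 0 (sqrt (pi * measure lborel W))))"
proof -
  let ?W = "\<lambda>R::real. (\<lambda>x. R *\<^sub>R x) ` W"
  define A where "A = measure lborel W"
  have "W \<noteq> {}" using assms(3) interior_subset by auto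
  then have W: "convex_window W" using assms by unfold_locales auto
  interpret convex_window W by (rule W)
  obtain x where "x \<in> interior W" using assms(3) by auto
  then obtain r where r: "0 < r" "cball x r \<subseteq> W" by (auto simp: mem_interior_cball)
  have A: "0 < A"
  proof -
    have "0 < measure lborel (cball x r)"
      using r(1) content_cball_pos[of r x] by simp
    also have "\<dots> \<le> A" unfolding A_def
      using r(2) emeasure_W_finite compact_imp_closed[OF compact_W]
      by (intro measure_mono_fmeasurable) (auto simp: fmeasurable_def)
    finally show ?thesis .
  qed
  have WR: "convex_window (?W R)" for R by (rule convex_window_scale[OF W])
  define M where "M = bound_radius W"
  have M: "0 < M" unfolding M_def by (rule rho_pos)
  define \<phi> where "\<phi> = (\<lambda>R \<theta>. \<integral>\<omega>. iexp (\<theta> * (Vol1_Y 1 (?W R) \<omega> - (\<integral>\<omega>'. Vol1_Y 1 (?W R) \<omega>' \<partial>Omega))) \<partial>Omega)"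
  \<comment> \<open>\<open>v R\<close> takes the place of the variance functional at scale
    \<open>R\<close>; these four properties are all that the limit requires.\<close>
  obtain v where v0: "\<And>R. 0 \<le> v R"
    and v1: "\<And>R. v R \<le> measure lborel (?W R) * (2 + pi * ln (2 * bound_radius (?W R)))"
    and v2: "\<And>R c r \<delta>. cball c r \<subseteq> ?W R \<Longrightarrow> 0 < \<delta> \<Longrightarrow> \<delta> < 1 \<Longrightarrow> 1 \<le> \<delta> * r \<Longrightarrow>
        (1 - \<delta>)^2 * measure lborel (?W R) * (pi * ln (\<delta> * r) - pi^2 / 2) \<le> v R"
    and v3: "\<And>R \<theta>. \<bar>\<theta>\<bar> * bound_radius (?W R) \<le> 1 \<Longrightarrow>
        cmod (\<phi> R \<theta> - exp (- (\<theta>^2 * v R / 2))) \<le> 21 * \<bar>\<theta>\<bar>^3 * bound_radius (?W R) * v R"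
    using convex_window.window_bounds[OF WR] unfolding \<phi>_def by metis
  have rad: "0 \<le> bound_radius (?W R) \<and> bound_radius (?W R) \<le> R * M + 1" if "1 < R" for R
    using convex_window.rho_pos[OF WR, of R] bound_radius_scale[OF W, of R] that by (simp add: M_def)
  \<comment> \<open>The lower bound takes the shrinking parameter
    \<open>\<delta> = 1 / ln R\<close>. It tends to 0, so \<open>(1 - \<delta>)^2\<close> tends to
    1, yet slowly enough for \<open>ln (\<delta> * (R * r))\<close> to stay asymptotic to
    \<open>ln R\<close>.\<close>
  have vlim: "((\<lambda>R. v R / (R^2 * ln R)) \<longlongrightarrow> pi * A) at_top"
  proof (rule tendsto_sandwich[where
      f="\<lambda>R. A * ((1 - 1 / ln R)^2 * ((pi * ln (R * r / ln R) - pi^2 / 2) / ln R))" and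
      h="\<lambda>R. A * ((2 + pi * ln (2 * (R * M + 1))) / ln R)"])
    show "((\<lambda>R. A * ((2 + pi * ln (2 * (R * M + 1))) / ln R)) \<longlongrightarrow> pi * A) at_top"
    proof -
      have "((\<lambda>R. (2 + pi * ln (2 * (R * M + 1))) / ln R) \<longlongrightarrow> pi) at_top"
        using M by real_asymp
      from tendsto_mult_left[OF this, of A] show ?thesis by (simp add: mult.commute)
    qed
    show "((\<lambda>R. A * ((1 - 1 / ln R)^2 * ((pi * ln (R * r / ln R) - pi^2 / 2) / ln R))) \<longlongrightarrow> pi * A) at_top"
    proof -
      have "((\<lambda>R. (1 - 1 / ln R)^2 * ((pi * ln (R * r / ln R) - pi^2 / 2) / ln R)) \<longlongrightarrow> pi) at_top"
        using r(1) by real_asymp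
      from tendsto_mult_left[OF this, of A] show ?thesis by (simp add: mult.commute)
    qed
    \<comment> \<open>\<open>exp 1 < R\<close> gives \<open>1 < ln R\<close>, hence
      \<open>\<delta> < 1\<close>; \<open>big2\<close> is the condition
      \<open>1 \<le> \<delta> * (R * r)\<close> on the scaled inscribed ball.\<close>
    have big: "\<forall>\<^sub>F R in at_top. exp 1 < (R::real)" by (rule eventually_gt_at_top)
    have big2: "\<forall>\<^sub>F R in at_top. 1 \<le> R * r / ln R" using r(1) by real_asymp
    show "\<forall>\<^sub>F R in at_top. v R / (R^2 * ln R) \<le> A * ((2 + pi * ln (2 * (R * M + 1))) / ln R)"
      using big
    proof eventually_elim
      case (elim R)
      have R: "1 < R" using elim exp_ge_add_one_self[of "1::real"] by linarith
      have "ln (2 * bound_radius (?W R)) \<le> ln (2 * (R * M + 1))"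
        using rad[OF R] convex_window.rho_pos[OF WR, of R] by (intro ln_mono) auto
      then have "measure lborel (?W R) * (2 + pi * ln (2 * bound_radius (?W R))) \<le>
          measure lborel (?W R) * (2 + pi * ln (2 * (R * M + 1)))"
        by (intro mult_left_mono add_left_mono) auto
      with v1[of R] have "v R \<le> R^2 * A * (2 + pi * ln (2 * (R * M + 1)))"
        by (simp add: measure_scale[OF compact_W] A_def)
      then have "v R / (R^2 * ln R) \<le> R^2 * A * (2 + pi * ln (2 * (R * M + 1))) / (R^2 * ln R)"
        using R by (intro divide_right_mono) auto
      then show ?case using R by simp
    qed
    show "\<forall>\<^sub>F R in at_top. A * ((1 - 1 / ln R)^2 * ((pi * ln (R * r / ln R) - pi^2 / 2) / ln R)) \<le> v R / (R^2 * ln R)"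
      using big big2
    proof eventually_elim
      case (elim R)
      have R: "1 < R" using elim(1) exp_ge_add_one_self[of "1::real"] by linarith
      have lnR: "1 < ln R" using elim(1) R ln_less_cancel_iff[of "exp 1" R] by simp
      have "(1 - 1 / ln R)^2 * measure lborel (?W R) * (pi * ln (1 / ln R * (R * r)) - pi^2 / 2) \<le> v R"
        using cball_scale[OF r(2), of R] R lnR elim(2) by (intro v2) auto
      then have "(1 - 1 / ln R)^2 * (R^2 * A) * (pi * ln (R * r / ln R) - pi^2 / 2) / (R^2 * ln R) \<le> v R / (R^2 * ln R)"
        using R by (intro divide_right_mono) (auto simp: measure_scale[OF compact_W] A_def)
      moreover have "(1 - 1 / ln R)^2 * (R^2 * A) * (pi * ln (R * r / ln R) - pi^2 / 2) / (R^2 * ln R) =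
         A * ((1 - 1 / ln R)^2 * ((pi * ln (R * r / ln R) - pi^2 / 2) / ln R))"
        using R by simp
      ultimately show ?case by simp
    qed
  qed
  have sq: "(sqrt (pi * measure lborel W))^2 = pi * A" using A by (simp add: A_def)
  have comm: "t * (d / c) = t / c * d" for t d c :: real by simp
  show ?thesis
  proof (rule converges_in_law_char)
    show "0 < sqrt (pi * measure lborel W)" using A by (simp add: A_def)
    show "(\<lambda>\<omega>. (Vol1_Y 1 (?W R) \<omega> - (\<integral>\<omega>'. Vol1_Y 1 (?W R) \<omega>' \<partial>Omega)) / (R * sqrt (ln R))) \<in> borel_measurable Omega" for R
      using convex_window.measurable_Vol1_Y[OF WR, of 1 R] by measurable
    show "((\<lambda>R. \<integral>\<omega>. iexp (t * ((Vol1_Y 1 (?W R) \<omega> - (\<integral>\<omega>'. Vol1_Y 1 (?W R) \<omega>' \<partial>Omega)) / (R * sqrt (ln R)))) \<partial>Omega) \<longlongrightarrow>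
        complex_of_real (exp (- ((sqrt (pi * measure lborel W))^2 * t^2 / 2)))) at_top" for t
      unfolding sq comm using norm_char_limit[OF vlim rad v3, of t] unfolding \<phi>_def .
  qed
qed

end
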